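(* Let $\Omega\subset\mathbb{P}(\mathbb{R}^{d+1})$ be a properly convex domain and let $\gamma\in\mathrm{Aut}(\Omega)$ be a rank one isometry with an axis $\ell_\gamma=(a,b)$ where $a\in E_\gamma^+$ and $b\in E_\gamma^-$. Then: (1) $\gamma$ is biproximal; (2) $\ell_\gamma$ is the unique axis of $\gamma$ in $\Omega$; (3) the only fixed points of $\gamma$ in $\overline\Omega$ are $a$ and $b$; (4) if $z'\in\partial\Omega\setminus\{a,b\}$, then $(a,z')\cup(b,z')\subset\Omega$; (5) if $z\in\partial\Omega\setminus\{a,b\}$, then neither $(a,z)$ nor $(b,z)$ is contained in a half triangle in $\Omega$.
   Context: A properly convex domain is a nonempty open set $\Omega\subset\mathbb{P}(\mathbb{R}^{d+1})$ such that some affine chart contains $\overline\Omega$ and in it $\Omega$ is a bounded convex set. For $x,y\in\overline\Omega$, $[x,y]\subset\overline\Omega$ is the closed projective line segment joining them, and $(x,y)=[x,y]\setminus\{x,y\}$. The Hilbert metric is $d_\Omega(x,y)=\frac12\log\frac{|b-x||y-a|}{|b-y||x-a|}$, where $a,b\in\partial\Omega$ are the endpoints of the intersection of $\overline\Omega$ with the projective line through $x\ne y$, ordered $a,x,y,b$ (computed in an affine chart containing $\overline{\Omega}$). $\mathrm{Aut}(\Omega)=\{g\in\mathrm{PGL}_{d+1}(\mathbb{R}): g\Omega=\Omega\}$. Half triangle: for $x,y\in\partial\Omega$ with $(x,y)\subset\Omega$, $(x,y)$ is contained in a half triangle in $\Omega$ if there is $w\in\partial\Omega$ with $[x,w]\cup[w,y]\subset\partial\Omega$.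 Rank one isometry: $\gamma\in\mathrm{Aut}(\Omega)$ is a rank one isometry if (a) $\tau_\Omega(\gamma):=\inf_{x\in\Omega}d_\Omega(x,\gamma x)>0$; (b) $\gamma$ has an axis, i.e. a non-trivial (open) projective line segment of the form $\mathbb{P}(V)\cap\Omega$ with $V\le\mathbb{R}^{d+1}$ a two-dimensional $\gamma$-invariant linear subspace; (c) no axis of $\gamma$ is contained in a half triangle in $\Omega$. $E_\gamma^\pm$: for a lift $\tilde\gamma\in\mathrm{GL}_{d+1}(\mathbb{R})$ of $\gamma$, consider its real Jordan decomposition. $E_\gamma^+\subset\mathbb{P}(\mathbb{R}^{d+1})$ is the projectivization of the direct sum, over the real Jordan blocks whose eigenvalue $\mu$ has maximal modulus among all eigenvalues of $\tilde\gamma$, of the eigenline in the block (if $\mu\in\mathbb{R}$) or the two-dimensional $\tilde\gamma$-invariant subspace of the block on which $\tilde\gamma$ is conjugate to $\begin{pmatrix}\alpha&-\beta\\ \beta&\alpha\end{pmatrix}$, $\mu=\alpha+i\beta$ (if $\mu\in\mathbb{C}\setminus\mathbb{R}$). Equivalently it is the projectivization of the real points of $\bigoplus_{|\mu|\text{ max}}\ker_{\mathbb{C}}(\tilde\gamma-\mu)$. $E_\gamma^-:=E_{\gamma^{-1}}^+$. Biproximal: order the complex eigenvalues of a lift with multiplicity by $|\lambda_1|\ge\dots\ge|\lambda_{d+1}|$; $\gamma$ is biproximal if $|\lambda_1|>|\lambda_2|$ and $|\lambda_d|>|\lambda_{d+1}|$. *)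

theory Defs
  imports
    "HOL-Analysis.Analysis"
    "HOL-Computational_Algebra.Fundamental_Theorem_Algebra"
begin

section \<open>Real projective space\<close>

text \<open>
  Throughout, \<open>real^'n\<close> plays the role of \<open>R^(d+1)\<close>, that is, \<open>CARD('n) = d + 1\<close>.
\<close>

definition proj_rel :: "real^'n \<Rightarrow> real^'n \<Rightarrow> bool" where
  "proj_rel v w \<longleftrightarrow> v \<noteq> 0 \<and> (\<exists>c. c \<noteq> 0 \<and> w = c *\<^sub>R v)"

lemma proj_rel_nonzero: "proj_rel v w \<Longrightarrow> v \<noteq> 0 \<and> w \<noteq> 0"
  by (auto simp: proj_rel_def)

lemma proj_rel_refl: "proj_rel v v \<longleftrightarrow> v \<noteq> 0"
  unfolding proj_rel_def by (auto intro!: exI[of _ 1])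

lemma part_equivp_proj_rel: "part_equivp (proj_rel :: real^'n \<Rightarrow> real^'n \<Rightarrow> bool)"
proof (rule part_equivpI)
  show "\<exists>x::real^'n. proj_rel x x"
    by (rule exI[of _ 1]) (simp add: proj_rel_refl)
  show "symp (proj_rel :: real^'n \<Rightarrow> real^'n \<Rightarrow> bool)"
  proof (rule sympI)
    fix v w :: "real^'n"
    assume "proj_rel v w"
    then obtain c where c: "v \<noteq> 0" "c \<noteq> 0" "w = c *\<^sub>R v"
      unfolding proj_rel_def by blast
    then have "w \<noteq> 0" "v = inverse c *\<^sub>R w" "inverse c \<noteq> 0"
      by simp_all
    then show "proj_rel w v"
      unfolding proj_rel_def by blast
  qed
  show "transp (proj_rel :: real^'n \<Rightarrow> real^'n \<Rightarrow> bool)"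
  proof (rule transpI)
    fix u v w :: "real^'n"
    assume "proj_rel u v" "proj_rel v w"
    then obtain c c' where "u \<noteq> 0" "c \<noteq> 0" "v = c *\<^sub>R u" "c' \<noteq> 0" "w = c' *\<^sub>R v"
      unfolding proj_rel_def by blast
    then have "u \<noteq> 0" "c' * c \<noteq> 0" "w = (c' * c) *\<^sub>R u"
      by simp_all
    then show "proj_rel u w"
      unfolding proj_rel_def by blast
  qed
qed

quotient_type 'n proj_space = "real^'n" / partial: "proj_rel :: real^'n \<Rightarrow> real^'n \<Rightarrow> bool"
  morphisms proj_rep proj_pt
  by (rule part_equivp_proj_rel)

lemma proj_pt_eq_iff: "v \<noteq> 0 \<Longrightarrow> w \<noteq> 0 \<Longrightarrow> proj_pt v = proj_pt w \<longleftrightarrow> proj_rel v w"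
  using Quotient3_rel[OF Quotient3_proj_space, of v w] by (auto simp: proj_rel_refl)

text \<open>The quotient topology.\<close>

instantiation proj_space :: (finite) topological_space
begin

definition open_proj_space :: "'a proj_space set \<Rightarrow> bool" where
  "open_proj_space U \<longleftrightarrow> open {v. v \<noteq> 0 \<and> proj_pt v \<in> U}"

instance
proof
  have "{v::real^'a. v \<noteq> 0 \<and> proj_pt v \<in> UNIV} = - {0}"
    by auto
  then show "open (UNIV :: 'a proj_space set)"
    unfolding open_proj_space_def by (simp add: open_Compl)
next
  fix S T :: "'a proj_space set"
  assume "open S" "open T"
  moreover have "{v. v \<noteq> 0 \<and> proj_pt v \<in> S \<inter> T}
      = {v. v \<noteq> 0 \<and> proj_pt v \<in> S} \<inter> {v. v \<noteq> 0 \<and> proj_pt v \<in> T}"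
    by auto
  ultimately show "open (S \<inter> T)"
    unfolding open_proj_space_def by auto
next
  fix K :: "'a proj_space set set"
  assume K: "\<forall>S\<in>K. open S"
  have "{v. v \<noteq> 0 \<and> proj_pt v \<in> \<Union>K} = (\<Union>S\<in>K. {v. v \<noteq> 0 \<and> proj_pt v \<in> S})"
    by auto
  then show "open (\<Union>K)"
    using K unfolding open_proj_space_def by auto
qed

end

definition projectivization :: "(real^'n) set \<Rightarrow> 'n proj_space set" where
  "projectivization W = {proj_pt v | v. v \<in> W \<and> v \<noteq> 0}"

text \<open>
  A nonzero linear functional \<open>v \<mapsto> u \<bullet> v\<close> determines the affine chart consisting of the points
  \<open>[v]\<close> with \<open>u \<bullet> v \<noteq> 0\<close>; it is identified with the affine hyperplane \<open>{v. u \<bullet> v = 1}\<close> of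
  \<open>real^'n\<close>. Outside the chart, \<open>affine_coord u\<close> takes the junk value 0.
\<close>


definition affine_chart :: "real^'n \<Rightarrow> 'n proj_space set" where
  "affine_chart u = projectivization {v. u \<bullet> v \<noteq> 0}"

lift_definition affine_coord :: "real^'n \<Rightarrow> 'n proj_space \<Rightarrow> real^'n" is
  "\<lambda>u v. v /\<^sub>R (u \<bullet> v)"
proof -
  fix u v w :: "real^'n"
  assume "proj_rel v w"
  then obtain c where c: "c \<noteq> 0" "w = c *\<^sub>R v"
    unfolding proj_rel_def by blast
  then show "v /\<^sub>R (u \<bullet> v) = w /\<^sub>R (u \<bullet> w)"
    by simp
qed


section \<open>The projective linear group\<close>

definition pgl_rel :: "real^'n^'n \<Rightarrow> real^'n^'n \<Rightarrow> bool" where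
  "pgl_rel A B \<longleftrightarrow> invertible A \<and> (\<exists>c. c \<noteq> 0 \<and> B = c *\<^sub>R A)"

lemma invertible_scaleR:
  fixes A :: "real^'n^'n"
  assumes "invertible A" "c \<noteq> 0"
  shows "invertible (c *\<^sub>R A)"
  using assms by (simp add: scalar_invertible)

lemma part_equivp_pgl_rel: "part_equivp (pgl_rel :: real^'n^'n \<Rightarrow> real^'n^'n \<Rightarrow> bool)"
proof (rule part_equivpI)
  have "pgl_rel (mat 1 :: real^'n^'n) (mat 1)"
    unfolding pgl_rel_def by (auto intro!: exI[of _ 1] simp: invertible_def)
  then show "\<exists>x::real^'n^'n. pgl_rel x x" ..
  show "symp (pgl_rel :: real^'n^'n \<Rightarrow> real^'n^'n \<Rightarrow> bool)"
  proof (rule sympI)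
    fix A B :: "real^'n^'n"
    assume "pgl_rel A B"
    then obtain c where c: "invertible A" "c \<noteq> 0" "B = c *\<^sub>R A"
      unfolding pgl_rel_def by blast
    then have "invertible B" "A = inverse c *\<^sub>R B" "inverse c \<noteq> 0"
      by (simp_all add: invertible_scaleR)
    then show "pgl_rel B A"
      unfolding pgl_rel_def by blast
  qed
  show "transp (pgl_rel :: real^'n^'n \<Rightarrow> real^'n^'n \<Rightarrow> bool)"
  proof (rule transpI)
    fix A B C :: "real^'n^'n"
    assume "pgl_rel A B" "pgl_rel B C"
    then obtain c c' where "invertible A" "c \<noteq> 0" "B = c *\<^sub>R A" "c' \<noteq> 0" "C = c' *\<^sub>R B"
      unfolding pgl_rel_def by blast
    then have "invertible A" "c' * c \<noteq> 0" "C = (c' * c) *\<^sub>R A"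
      by simp_all
    then show "pgl_rel A C"
      unfolding pgl_rel_def by blast
  qed
qed

quotient_type 'n pgl = "real^'n^'n" / partial: "pgl_rel :: real^'n^'n \<Rightarrow> real^'n^'n \<Rightarrow> bool"
  morphisms pgl_rep pgl_of
  by (rule part_equivp_pgl_rel)

lemma matrix_inv_scaleR:
  fixes A :: "real^'n^'n"
  assumes A: "invertible A" and c: "c \<noteq> 0"
  shows "matrix_inv (c *\<^sub>R A) = inverse c *\<^sub>R matrix_inv A"
proof -
  have inv: "B ** matrix_inv B = mat 1 \<and> matrix_inv B ** B = mat 1"
    if "invertible B" for B :: "real^'n^'n"
    using someI_ex[OF that[unfolded invertible_def]] unfolding matrix_inv_def by simp
  let ?X = "inverse c *\<^sub>R matrix_inv A" and ?B = "c *\<^sub>R A"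
  have "?X ** ?B = mat 1"
    using inv[OF A] c by (simp add: matrix_scalar_ac flip: scalar_matrix_assoc)
  moreover have "?B ** matrix_inv ?B = mat 1"
    using inv[OF invertible_scaleR[OF A c]] by blast
  ultimately show ?thesis
    using matrix_mul_assoc[of ?X ?B "matrix_inv ?B"] by simp
qed

lemma invertible_matrix_inv:
  fixes A :: "real^'n^'n"
  assumes "invertible A"
  shows "invertible (matrix_inv A)"
  using someI_ex[OF assms[unfolded invertible_def]] unfolding matrix_inv_def invertible_def by blast

lift_definition pgl_inverse :: "'n::finite pgl \<Rightarrow> 'n pgl"
  is "matrix_inv :: real^'n^'n \<Rightarrow> real^'n^'n"
proof -
  fix A B :: "real^'n^'n"
  assume "pgl_rel A B"
  then obtain c where c: "invertible A" "c \<noteq> 0" "B = c *\<^sub>R A"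
    unfolding pgl_rel_def by blast
  have "matrix_inv B = inverse c *\<^sub>R matrix_inv A"
    unfolding c(3) by (rule matrix_inv_scaleR[OF c(1,2)])
  moreover have "inverse c \<noteq> 0"
    using c(2) by simp
  ultimately show "pgl_rel (matrix_inv A) (matrix_inv B)"
    unfolding pgl_rel_def using invertible_matrix_inv[OF c(1)] by blast
qed

lift_definition pgl_act :: "'n::finite pgl \<Rightarrow> 'n proj_space \<Rightarrow> 'n proj_space"
  is "\<lambda>(A :: real^'n^'n) v. A *v v"
proof -
  fix A B :: "real^'n^'n" and v w :: "real^'n"
  assume "pgl_rel A B" "proj_rel v w"
  then obtain c k where c: "invertible A" "c \<noteq> 0" "B = c *\<^sub>R A"
    and k: "v \<noteq> 0" "k \<noteq> 0" "w = k *\<^sub>R v"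
    unfolding pgl_rel_def proj_rel_def by blast
  have "A *v v \<noteq> 0"
    using inj_matrix_vector_mult[OF c(1)] k(1)
    by (metis injD matrix_vector_mult_0_right)
  moreover have "B *v w = (c * k) *\<^sub>R (A *v v)"
    by (simp add: c(3) k(3) vec_eq_iff matrix_vector_mult_def sum_distrib_left mult_ac)
  ultimately show "proj_rel (A *v v) (B *v w)"
    unfolding proj_rel_def using c(2) k(2) by (auto intro!: exI[of _ "c * k"])
qed


section \<open>Eigenvalues\<close>

definition complex_vec :: "real^'n \<Rightarrow> complex^'n" where
  "complex_vec v = (\<chi> i. complex_of_real (v $ i))"

definition complex_mat :: "real^'n^'n \<Rightarrow> complex^'n^'n" where
  "complex_mat A = (\<chi> i j. complex_of_real (A $ i $ j))"

definition charpoly :: "complex^'n^'n \<Rightarrow> complex poly" where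
  "charpoly M = det (\<chi> i j. (if i = j then [:0, 1:] else 0) - [:M $ i $ j:])"

definition eigenvalues :: "real^'n^'n \<Rightarrow> complex multiset" where
  "eigenvalues A = proots (charpoly (complex_mat A))"

definition eigenvalue_moduli :: "real^'n^'n \<Rightarrow> real list" where
  "eigenvalue_moduli A = rev (sorted_list_of_multiset (image_mset cmod (eigenvalues A)))"

text \<open>The list is indexed from 0, so the last index is \<open>d = CARD('n) - 1\<close>.\<close>

definition biproximal_mat :: "real^'n^'n \<Rightarrow> bool" where
  "biproximal_mat A \<longleftrightarrow>
     (let l = eigenvalue_moduli A; d = CARD('n) - 1
      in l ! 0 > l ! 1 \<and> l ! (d - 1) > l ! d)"

definition eigenspace :: "complex^'n^'n \<Rightarrow> complex \<Rightarrow> (complex^'n) set" where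
  "eigenspace M \<mu> = {w. M *v w = \<mu> *s w}"

definition top_eigenvalues :: "real^'n^'n \<Rightarrow> complex set" where
  "top_eigenvalues A =
     {\<mu>. \<mu> \<in># eigenvalues A \<and> (\<forall>\<nu>. \<nu> \<in># eigenvalues A \<longrightarrow> cmod \<nu> \<le> cmod \<mu>)}"

text \<open>
  The real vectors in the (automatically direct) sum of the complex eigenspaces for the eigenvalues
  of maximal modulus. In terms of the real Jordan form, each block with real eigenvalue of maximal
  modulus contributes its eigenline and each block with nonreal eigenvalue of maximal modulus
  contributes its two-dimensional invariant subspace.
\<close>

definition top_eigenvectors :: "real^'n^'n \<Rightarrow> (real^'n) set" where
  "top_eigenvectors A =
     {v. complex_vec v \<in> vec.span (\<Union>\<mu>\<in>top_eigenvalues A. eigenspace (complex_mat A) \<mu>)}"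

lemma poly_charpoly:
  "poly (charpoly M) x = det (\<chi> i j. (if i = j then x else 0) - M $ i $ j)"
proof -
  have "poly (if i = j then [:0, 1:] else 0) x = (if i = j then x else 0)" for i j :: 'a
    by simp
  then show ?thesis
    unfolding charpoly_def det_def by (simp add: poly_sum poly_prod)
qed

lemma coeff_prod_linear:
  fixes f :: "'a \<Rightarrow> 'b::comm_ring_1 poly"
  assumes "finite S" "\<And>i. i \<in> S \<Longrightarrow> degree (f i) \<le> 1"
  shows "degree (prod f S) \<le> card S \<and> coeff (prod f S) (card S) = (\<Prod>i\<in>S. coeff (f i) 1)"
  using assms
proof (induction S rule: finite_induct)
  case empty
  then show ?case by simp
next
  case (insert x S)
  then have IH: "degree (prod f S) \<le> card S"
      "coeff (prod f S) (card S) = (\<Prod>i\<in>S. coeff (f i) 1)"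
    and x: "degree (f x) \<le> 1"
    by auto
  have "degree (f x * prod f S) \<le> 1 + card S"
    using degree_mult_le[of "f x" "prod f S"] IH(1) x by linarith
  moreover have "coeff (f x * prod f S) (1 + card S) = coeff (f x) 1 * coeff (prod f S) (card S)"
  proof (cases "degree (f x) = 1 \<and> degree (prod f S) = card S")
    case True
    then show ?thesis
      using coeff_mult_degree_sum[of "f x" "prod f S"] by simp
  next
    case False
    then have "degree (f x) < 1 \<or> degree (prod f S) < card S"
      using x IH(1) by linarith
    moreover from this have "degree (f x * prod f S) < 1 + card S"
      using degree_mult_le[of "f x" "prod f S"] x IH(1) by linarith
    ultimately show ?thesis
      by (auto simp: coeff_eq_0)
  qed
  ultimately show ?case
    using insert.hyps IH(2) by simp
qed

lemma degree_charpoly: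
  fixes M :: "complex^'n^'n"
  shows "degree (charpoly M) = CARD('n)"
proof -
  define f where "f p i = (if i = p i then [:0, 1:] else 0) - [:M $ i $ p i:]" for p and i :: 'n
  have deg: "degree (f p i) \<le> 1" and co: "coeff (f p i) 1 = (mat 1 :: complex^'n^'n) $ i $ p i"
    for p i by (auto simp: f_def mat_def)
  have prod: "degree (\<Prod>i\<in>UNIV. f p i) \<le> CARD('n)"
      "coeff (\<Prod>i\<in>UNIV. f p i) CARD('n) = (\<Prod>i\<in>UNIV. (mat 1 :: complex^'n^'n) $ i $ p i)" for p
    using coeff_prod_linear[of UNIV "f p"] deg co by simp_all
  have eq: "charpoly M = (\<Sum>p | p permutes UNIV. of_int (sign p) * (\<Prod>i\<in>UNIV. f p i))"
    unfolding charpoly_def det_def f_def by simp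
  have sgn: "of_int (sign p) * q = smult (of_int (sign p)) q" for p :: "'n \<Rightarrow> 'n" and q :: "complex poly"
    by (simp add: of_int_poly)
  have "coeff (charpoly M) CARD('n) = det (mat 1 :: complex^'n^'n)"
    unfolding eq sgn coeff_sum coeff_smult prod det_def ..
  then have "coeff (charpoly M) CARD('n) = 1"
    by simp
  moreover have "degree (charpoly M) \<le> CARD('n)"
    unfolding eq sgn by (intro degree_sum_le order_trans[OF degree_smult_le] prod) simp
  ultimately show ?thesis
    by (metis le_degree le_antisym zero_neq_one)
qed

lemma size_eigenvalues: "size (eigenvalues A) = CARD('n)" for A :: "real^'n^'n"
  by (simp add: eigenvalues_def size_proots_complex degree_charpoly)

lemma eigenvalues_scaleR:
  fixes A :: "real^'n^'n"
  assumes c: "c \<noteq> 0"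
  shows "eigenvalues (c *\<^sub>R A) = image_mset ((*) (of_real c)) (eigenvalues A)"
proof -
  let ?p = "charpoly (complex_mat A)" and ?q = "charpoly (complex_mat (c *\<^sub>R A))"
  let ?R = "proots ?p"
  let ?g = "\<Prod>r\<in>#?R. [:- (of_real c * r), 1:]"
  define k where "k = lead_coeff ?p"
  have p: "?p = smult k (\<Prod>r\<in>#?R. [:- r, 1:])"
    unfolding k_def by (simp only: complex_poly_decompose_multiset)
  have "poly ?q x = of_real c ^ CARD('n) * poly ?p (x / of_real c)" for x
  proof -
    have "(\<chi> i j. (if i = j then x else 0) - complex_mat (c *\<^sub>R A) $ i $ j)
        = (\<chi> i. of_real c *s (\<chi> j. (if i = j then x / of_real c else 0) - complex_mat A $ i $ j))"
      using c by (auto simp: vec_eq_iff complex_mat_def field_simps)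
    then show ?thesis
      unfolding poly_charpoly by (simp add: det_rows_mul)
  qed
  moreover have "poly ?p (x / of_real c) = k * (\<Prod>r\<in>#?R. x / of_real c - r)" for x
    by (subst p) (simp add: poly_prod_mset)
  moreover have "(\<Prod>r\<in>#?R. x / of_real c - r) * of_real c ^ size ?R = poly ?g x" for x
  proof -
    have "(\<Prod>r\<in>#R. x / of_real c - r) * of_real c ^ size R = (\<Prod>r\<in>#R. x - of_real c * r)" for R
      using c by (induction R) (auto simp: field_simps)
    then show ?thesis
      by (simp add: poly_prod_mset)
  qed
  ultimately have "poly ?q x = poly (smult k ?g) x" for x
    by (simp add: size_proots_complex degree_charpoly mult_ac)
  then have q: "?q = smult k ?g"
    by (simp add: poly_eq_poly_eq_iff[symmetric] fun_eq_iff)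
  have "?p \<noteq> 0"
    using degree_charpoly[of "complex_mat A"] by (metis degree_0 zero_less_card_finite less_numeral_extra(3))
  then have "k \<noteq> 0"
    by (simp add: k_def)
  have "proots (\<Prod>r\<in>#R. [:- (of_real c * r), 1:]) = image_mset ((*) (of_real c)) R" for R
  proof (induction R)
    case (add r R)
    let ?P = "\<Prod>r\<in>#R. [:- (of_real c * r), 1:]"
    have "?P \<noteq> 0"
      by (auto simp: prod_mset_zero_iff)
    then have "proots ([:- (of_real c * r), 1:] * ?P) = {#of_real c * r#} + proots ?P"
      by (subst proots_mult) (auto simp del: mult_pCons_left)
    then show ?case
      using add by (simp del: mult_pCons_left)
  qed simp
  then show ?thesis
    unfolding eigenvalues_def q using \<open>k \<noteq> 0\<close> by simp
qed

lemma eigenvalue_moduli_scaleR: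
  fixes A :: "real^'n^'n"
  assumes c: "c \<noteq> 0"
  shows "eigenvalue_moduli (c *\<^sub>R A) = map ((*) \<bar>c\<bar>) (eigenvalue_moduli A)"
proof -
  let ?M = "image_mset cmod (eigenvalues A)"
  have "image_mset cmod (eigenvalues (c *\<^sub>R A)) = image_mset ((*) \<bar>c\<bar>) ?M"
    by (simp add: eigenvalues_scaleR[OF c] image_mset.compositionality o_def norm_mult)
  also have "\<dots> = mset (map ((*) \<bar>c\<bar>) (sorted_list_of_multiset ?M))"
    by simp
  finally have "sorted_list_of_multiset (image_mset cmod (eigenvalues (c *\<^sub>R A)))
      = sort (map ((*) \<bar>c\<bar>) (sorted_list_of_multiset ?M))"
    by (simp only: sorted_list_of_multiset_mset)
  also have "\<dots> = map ((*) \<bar>c\<bar>) (sorted_list_of_multiset ?M)"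
    by (intro sorted_sort_id)
      (auto simp: sorted_map mult_left_mono
        intro!: sorted_wrt_mono_rel[OF _ sorted_sorted_list_of_multiset])
  finally show ?thesis
    by (simp add: eigenvalue_moduli_def rev_map)
qed

lemma length_eigenvalue_moduli: "length (eigenvalue_moduli A) = CARD('n)" for A :: "real^'n^'n"
proof -
  have "length (sorted_list_of_multiset M) = size M" for M :: "real multiset"
    by (metis mset_sorted_list_of_multiset size_mset)
  then show ?thesis
    by (simp add: eigenvalue_moduli_def size_eigenvalues)
qed

lemma biproximal_mat_scaleR:
  fixes A :: "real^'n^'n"
  assumes c: "c \<noteq> 0"
  shows "biproximal_mat (c *\<^sub>R A) \<longleftrightarrow> biproximal_mat A"
proof (cases "CARD('n) = 1")
  case True
  then show ?thesis
    by (simp add: biproximal_mat_def)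
next
  case False
  then have "1 < CARD('n)"
    using zero_less_card_finite[where 'a='n] by linarith
  then show ?thesis
    using c by (simp add: biproximal_mat_def eigenvalue_moduli_scaleR length_eigenvalue_moduli Let_def)
qed

lemma top_eigenvectors_scaleR:
  fixes A :: "real^'n^'n"
  assumes c: "c \<noteq> 0"
  shows "top_eigenvectors (c *\<^sub>R A) = top_eigenvectors A"
proof -
  have "top_eigenvalues (c *\<^sub>R A) = (*) (of_real c) ` top_eigenvalues A"
    using c by (auto simp: top_eigenvalues_def eigenvalues_scaleR norm_mult intro!: imageI)
  moreover have "eigenspace (complex_mat (c *\<^sub>R A)) (of_real c * \<mu>) = eigenspace (complex_mat A) \<mu>" for \<mu>
  proof -
    have "complex_mat (c *\<^sub>R A) *v w = of_real c *s (complex_mat A *v w)" for w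
      by (simp add: vec_eq_iff complex_mat_def matrix_vector_mult_def sum_distrib_left mult_ac)
    then show ?thesis
      using c by (auto simp: eigenspace_def vec_eq_iff mult.assoc)
  qed
  ultimately show ?thesis
    by (simp add: top_eigenvectors_def)
qed

lift_definition biproximal :: "'n::finite pgl \<Rightarrow> bool"
  is "biproximal_mat :: real^'n^'n \<Rightarrow> bool"
  unfolding pgl_rel_def by (auto simp: biproximal_mat_scaleR)

lift_definition E_plus :: "'n::finite pgl \<Rightarrow> 'n proj_space set"
  is "\<lambda>A :: real^'n^'n. projectivization (top_eigenvectors A)"
  unfolding pgl_rel_def by (auto simp: top_eigenvectors_scaleR)

definition E_minus :: "'n::finite pgl \<Rightarrow> 'n proj_space set" where
  "E_minus g = E_plus (pgl_inverse g)"


section \<open>Properly convex domains\<close>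

definition adapted_chart :: "'n::finite proj_space set \<Rightarrow> real^'n \<Rightarrow> bool" where
  "adapted_chart \<Omega> u \<longleftrightarrow>
     closure \<Omega> \<subseteq> affine_chart u \<and>
     bounded (affine_coord u ` \<Omega>) \<and> convex (affine_coord u ` \<Omega>)"

definition properly_convex_domain :: "'n::finite proj_space set \<Rightarrow> bool" where
  "properly_convex_domain \<Omega> \<longleftrightarrow> \<Omega> \<noteq> {} \<and> open \<Omega> \<and> (\<exists>u. adapted_chart \<Omega> u)"

text \<open>
  Segments and the Hilbert metric are computed in an adapted chart; they do not depend on which
  one is chosen.
\<close>

definition coord :: "'n::finite proj_space set \<Rightarrow> 'n proj_space \<Rightarrow> real^'n" where
  "coord \<Omega> = affine_coord (SOME u. adapted_chart \<Omega> u)"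

definition proj_segment ::
    "'n::finite proj_space set \<Rightarrow> 'n proj_space \<Rightarrow> 'n proj_space \<Rightarrow> 'n proj_space set" where
  "proj_segment \<Omega> x y = {p \<in> closure \<Omega>. coord \<Omega> p \<in> closed_segment (coord \<Omega> x) (coord \<Omega> y)}"

definition open_proj_segment ::
    "'n::finite proj_space set \<Rightarrow> 'n proj_space \<Rightarrow> 'n proj_space \<Rightarrow> 'n proj_space set" where
  "open_proj_segment \<Omega> x y = proj_segment \<Omega> x y - {x, y}"

definition proj_line :: "'n::finite proj_space \<Rightarrow> 'n proj_space \<Rightarrow> 'n proj_space set" where
  "proj_line x y = projectivization (span {proj_rep x, proj_rep y})"

text \<open>
  \<open>(a, b)\<close> are the endpoints of the intersection of the closure of \<open>\<Omega>\<close> with the line through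
  \<open>x\<close> and \<open>y\<close>, labelled such that \<open>a, x, y, b\<close> appear in this order.
\<close>

definition line_ends ::
    "'n::finite proj_space set \<Rightarrow> 'n proj_space \<Rightarrow> 'n proj_space \<Rightarrow> 'n proj_space \<times> 'n proj_space" where
  "line_ends \<Omega> x y = (THE (a, b).
     a \<in> frontier \<Omega> \<and> b \<in> frontier \<Omega> \<and>
     closure \<Omega> \<inter> proj_line x y = proj_segment \<Omega> a b \<and>
     x \<in> proj_segment \<Omega> a y \<and> y \<in> proj_segment \<Omega> x b)"

definition hilbert_dist :: "'n::finite proj_space set \<Rightarrow> 'n proj_space \<Rightarrow> 'n proj_space \<Rightarrow> real" where
  "hilbert_dist \<Omega> x y =
     (if x = y then 0
      else let (a, b) = line_ends \<Omega> x y; \<phi> = coord \<Omega> in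
        1 / 2 * ln ((norm (\<phi> b - \<phi> x) * norm (\<phi> y - \<phi> a)) /
                    (norm (\<phi> b - \<phi> y) * norm (\<phi> x - \<phi> a))))"

definition Aut :: "'n::finite proj_space set \<Rightarrow> 'n pgl set" where
  "Aut \<Omega> = {g. pgl_act g ` \<Omega> = \<Omega>}"

definition translation_length :: "'n::finite proj_space set \<Rightarrow> 'n pgl \<Rightarrow> real" where
  "translation_length \<Omega> g = (INF x\<in>\<Omega>. hilbert_dist \<Omega> x (pgl_act g x))"

definition is_axis :: "'n::finite proj_space set \<Rightarrow> 'n pgl \<Rightarrow> 'n proj_space set \<Rightarrow> bool" where
  "is_axis \<Omega> g l \<longleftrightarrow>
     (\<exists>V. subspace V \<and> dim V = 2 \<and> pgl_act g ` projectivization V = projectivization V \<and>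
        l = projectivization V \<inter> \<Omega>) \<and>
     (\<exists>x\<in>closure \<Omega>. \<exists>y\<in>closure \<Omega>. x \<noteq> y \<and> l = open_proj_segment \<Omega> x y)"

definition in_half_triangle :: "'n::finite proj_space set \<Rightarrow> 'n proj_space set \<Rightarrow> bool" where
  "in_half_triangle \<Omega> s \<longleftrightarrow>
     (\<exists>x\<in>frontier \<Omega>. \<exists>y\<in>frontier \<Omega>. s = open_proj_segment \<Omega> x y \<and> s \<subseteq> \<Omega> \<and>
        (\<exists>w\<in>frontier \<Omega>. proj_segment \<Omega> x w \<union> proj_segment \<Omega> w y \<subseteq> frontier \<Omega>))"

definition rank_one_isometry :: "'n::finite proj_space set \<Rightarrow> 'n pgl \<Rightarrow> bool" where
  "rank_one_isometry \<Omega> g \<longleftrightarrow>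
     g \<in> Aut \<Omega> \<and>
     translation_length \<Omega> g > 0 \<and>
     (\<exists>l. is_axis \<Omega> g l) \<and>
     (\<forall>l. is_axis \<Omega> g l \<longrightarrow> \<not> in_half_triangle \<Omega> l)"

end

theory Submission
  imports Defs
begin

text \<open>
  Let \<open>D\<close> be the closed convex cone over \<open>\<Omega>\<close>. A suitably scaled lift \<open>T\<close> of \<open>\<gamma>\<close> preserves \<open>D\<close> and
  satisfies \<open>T a = a\<close>, \<open>T b = q b\<close>; here \<open>q \<le> 1\<close> because \<open>a \<in> E_plus \<gamma>\<close>, and \<open>q \<noteq> 1\<close> because a
  fixed point in \<open>\<Omega>\<close> would force translation length 0. Brouwer's theorem gives functionals
  \<open>f, g \<ge> 0\<close> on \<open>D\<close> with \<open>f \<circ> T = q f\<close>, \<open>g \<circ> T = g\<close>, \<open>f(a) = g(b) = 0\<close>, \<open>f(b) = g(a) = 1\<close>. As the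
  axis is in no half triangle, \<open>f + g\<close> is positive on \<open>D - {0}\<close>, so forward orbits of \<open>T\<close> are bounded,
  and backward ones are too in \<open>D \<inter> ker f\<close>. A compactness argument shows that \<open>D \<inter> ker f\<close> is the
  ray of \<open>a\<close>, whence \<open>T^n w \<longlonglongrightarrow> g(w) a\<close> for all \<open>w\<close>, and symmetrically \<open>q^n T^(-n) w \<longlonglongrightarrow> f(w) b\<close>.
  All five claims are consequences of this north-south dynamics.
\<close>

section \<open>Automorphisms of a convex cone contracting along an axis\<close>

text \<open>Nothing is known beforehand about the other eigenvalues of \<open>T\<close>: there could
  be Jordan blocks or further eigenvalues of modulus 1, so the dynamics is extracted from the cone
  rather than from a normal form. The half triangle condition enters additively: the open segment
  between two distinct boundary points lies in \<Omega> exactly when the sum of their lifts is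
  interior to \<open>D\<close>, so for every nonzero \<open>w\<close> in \<open>D\<close> one of
  \<open>a + w\<close>, \<open>b + w\<close> is interior. Since \<open>f\<close> vanishes at
  \<open>a\<close> and \<open>g\<close> at \<open>b\<close>, this makes \<open>f + g\<close>
  positive. The delicate set is \<open>D \<inter> ker f\<close>, where the decay of \<open>f\<close>
  says nothing. A vector there cannot see \<open>a\<close> through the interior, hence it sees
  \<open>b\<close>, and \<open>b\<close> is contracted by \<open>T\<close>. Statements about
  \<open>b\<close> follow from the symmetry exchanging (\<open>T\<close>, \<open>a\<close>,
  \<open>g\<close>) with (\<open>q T^(-1)\<close>, \<open>b\<close>, \<open>f\<close>). Linear
  algebra returns only for biproximality, where the two limits force all other eigenvalues to have
  modulus below 1, respectively above \<open>q\<close>.\<close>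

lemma closed_cone_norm_bound:
  fixes h :: "'a::euclidean_space"
  assumes cl: "closed D" and scale: "\<And>x c. x \<in> D \<Longrightarrow> 0 \<le> c \<Longrightarrow> c *\<^sub>R x \<in> D"
    and pos: "\<And>x. x \<in> D \<Longrightarrow> x \<noteq> 0 \<Longrightarrow> 0 < h \<bullet> x"
  shows "\<exists>c>0. \<forall>x\<in>D. c * norm x \<le> h \<bullet> x"
proof (cases "D \<inter> sphere 0 1 = {}")
  case True
  have "x = 0" if "x \<in> D" for x
  proof (rule ccontr)
    assume "x \<noteq> 0"
    then have "(1 / norm x) *\<^sub>R x \<in> D \<inter> sphere 0 1"
      using that by (auto intro: scale)
    then show False using True by simp
  qed
  then show ?thesis by (intro exI[of _ 1]) fastforce
next
  case False
  have "compact (D \<inter> sphere 0 1)"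
    using cl by (intro closed_Int_compact) auto
  moreover have "continuous_on (D \<inter> sphere 0 1) (\<lambda>x. h \<bullet> x)"
    by (intro continuous_intros)
  ultimately obtain m where m: "m \<in> D \<inter> sphere 0 1"
      "\<And>y. y \<in> D \<inter> sphere 0 1 \<Longrightarrow> h \<bullet> m \<le> h \<bullet> y"
    using continuous_attains_inf[OF _ False] by metis
  have "(h \<bullet> m) * norm x \<le> h \<bullet> x" if "x \<in> D" for x
  proof (cases "x = 0")
    case False
    then have "(1 / norm x) *\<^sub>R x \<in> D \<inter> sphere 0 1"
      using that by (auto intro: scale)
    from m(2)[OF this] have "h \<bullet> m \<le> (h \<bullet> x) / norm x"
      by simp
    then show ?thesis using False by (simp add: field_simps)
  qed auto
  moreover have "0 < h \<bullet> m"
    using m(1) by (intro pos) auto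
  ultimately show ?thesis by blast
qed

text \<open>The inverse \<open>S\<close> is carried as data so that the assumptions are symmetric
  under time reversal. \<open>T\<close> is normalised to have eigenvalue 1 at \<open>a\<close>. The
  condition \<open>ab_int\<close> encodes that the axis runs through the domain.\<close>

locale cone_auto =
  fixes D :: "'a::euclidean_space set" and T S :: "'a \<Rightarrow> 'a" and a b :: 'a and q :: real
  assumes closed_D: "closed D"
    and add_D: "\<And>x y. x \<in> D \<Longrightarrow> y \<in> D \<Longrightarrow> x + y \<in> D"
    and scale_D: "\<And>x c. x \<in> D \<Longrightarrow> 0 \<le> c \<Longrightarrow> c *\<^sub>R x \<in> D"
    and linear_T: "linear T" and linear_S: "linear S"
    and TS [simp]: "\<And>x. T (S x) = x" and ST [simp]: "\<And>x. S (T x) = x"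
    and T_D: "\<And>x. x \<in> D \<Longrightarrow> T x \<in> D" and S_D: "\<And>x. x \<in> D \<Longrightarrow> S x \<in> D"
    and T_a: "T a = a" and T_b: "T b = q *\<^sub>R b"
    and q: "0 < q" "q < 1"
    and a_D: "a \<in> D" and b_D: "b \<in> D"
    and a_int: "a \<notin> interior D" and b_int: "b \<notin> interior D"
    and ab_int: "a + b \<in> interior D"
    and no_half_triangle: "\<And>w. w \<in> D \<Longrightarrow> w \<noteq> 0 \<Longrightarrow> a + w \<in> interior D \<or> b + w \<in> interior D"
begin

lemma zero_D: "0 \<in> D"
  using scale_D[OF a_D, of 0] by simp

lemma int_sub: "x \<in> interior D \<Longrightarrow> x \<in> D"
  using interior_subset by blast

lemma int_add:
  assumes x: "x \<in> interior D" and y: "y \<in> D"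
  shows "x + y \<in> interior D"
proof -
  have "(\<lambda>z. y + z) ` interior D \<subseteq> interior D"
    by (intro interior_maximal open_translation) (auto intro: add_D y int_sub)
  then show ?thesis
    using x by (auto simp: add.commute)
qed

lemma int_scale:
  assumes x: "x \<in> interior D" and c: "0 < c"
  shows "c *\<^sub>R x \<in> interior D"
proof -
  have "(\<lambda>z. c *\<^sub>R z) ` interior D \<subseteq> interior D"
    using c by (intro interior_maximal open_scaling) (auto intro: scale_D int_sub)
  then show ?thesis
    using x by auto
qed

lemma convex_D: "convex D"
  by (rule convexI) (auto intro: add_D scale_D)

lemma S_a: "S a = a"
  using ST[of a] by (simp add: T_a)

lemma S_b: "S b = (1/q) *\<^sub>R b"
proof -
  have "S (q *\<^sub>R b) = b"
    using ST[of b] by (simp add: T_b)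
  then have "q *\<^sub>R S b = b"
    by (simp add: linear_cmul[OF linear_S])
  then show ?thesis
    using q by (metis (no_types, lifting) less_numeral_extra(3) nonzero_divide_eq_eq scaleR_one scaleR_scaleR mult.commute)
qed

text \<open>Time reversal: \<open>q S\<close> fixes \<open>b\<close> and multiplies \<open>a\<close>
  by \<open>q\<close>, so the roles of the two ends are exchanged with the same constant.\<close>

lemma swap_auto: "cone_auto D (\<lambda>x. q *\<^sub>R S x) (\<lambda>x. (1/q) *\<^sub>R T x) b a q"
proof (rule cone_auto.intro)
  show "linear (\<lambda>x. q *\<^sub>R S x)"
    by (intro linear_compose_scale_right linear_S)
  show "linear (\<lambda>x. (1/q) *\<^sub>R T x)"
    by (intro linear_compose_scale_right linear_T)
qed (use q in \<open>auto simp: closed_D add_D scale_D S_D T_D linear_cmul[OF linear_S] linear_cmul[OF linear_T]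
   S_b S_a a_D b_D a_int b_int ab_int add.commute[of b a] dest: no_half_triangle\<close>)

text \<open>The slice \<open>K\<close> of the dual cone cut out by the values 0 at \<open>b\<close>
  and 1 at \<open>a\<close> is convex, compact because \<open>a + b\<close> is interior, and
  nonempty by a supporting hyperplane at \<open>b\<close>. As \<open>a\<close> and \<open>b\<close>
  are eigenvectors with eigenvalues 1 and \<open>q\<close>, the adjoint of \<open>T\<close> maps
  \<open>K\<close> into itself, and Brouwer provides a fixed point.\<close>

lemma ex_eigenfunctional:
  "\<exists>g. (\<forall>x\<in>D. 0 \<le> g \<bullet> x) \<and> g \<bullet> b = 0 \<and> g \<bullet> a = 1 \<and> (\<forall>x. g \<bullet> T x = g \<bullet> x)"
proof -
  define K where "K = {g. (\<forall>x\<in>D. 0 \<le> g \<bullet> x) \<and> g \<bullet> b = 0 \<and> g \<bullet> a = 1}"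
  have ri: "rel_interior D = interior D"
    using ab_int by (intro rel_interior_nonempty_interior) auto
  obtain h where h: "h \<noteq> 0" "\<And>y. y \<in> D \<Longrightarrow> h \<bullet> b \<le> h \<bullet> y"
      "\<And>y. y \<in> interior D \<Longrightarrow> h \<bullet> b < h \<bullet> y"
    using supporting_hyperplane_rel_boundary[OF convex_D b_D] b_int unfolding ri by metis
  \<comment> \<open>The minimum of \<open>h\<close> over a cone, attained at \<open>b\<close>, can
    only be 0: comparison with 0 gives one inequality, comparison with \<open>2 b\<close> the
    other.\<close>
  have hb: "h \<bullet> b = 0"
    using h(2)[OF zero_D] h(2)[OF scale_D[OF b_D, of 2]] by simp
  have ha: "h \<bullet> a > 0"
    using h(3)[OF ab_int] hb by (simp add: inner_add_right)
  have "(1 / (h \<bullet> a)) *\<^sub>R h \<in> K"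
    using h(2) ha hb by (auto simp: K_def)
  then have ne: "K \<noteq> {}" by auto
  have conv: "convex K"
    by (rule convexI) (auto simp: K_def inner_add_left)
  have "K = (\<Inter>x\<in>D. {g. 0 \<le> g \<bullet> x}) \<inter> {g. g \<bullet> b = 0} \<inter> {g. g \<bullet> a = 1}"
    by (auto simp: K_def)
  moreover have "closed \<dots>"
    by (intro closed_Int closed_INT ballI closed_Collect_le closed_Collect_eq continuous_intros)
  ultimately have cl: "closed K" by simp
  obtain r where r: "r > 0" "cball (a + b) r \<subseteq> D"
    using ab_int by (auto simp: mem_interior_cball)
  have bdd: "bounded K"
  proof (rule boundedI)
    fix g assume g: "g \<in> K"
    show "norm g \<le> 1 / r"
    proof (cases "g = 0")
      case True then show ?thesis using r by simp
    next
      case False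
      \<comment> \<open>Every \<open>g\<close> in \<open>K\<close> has value 1 at
        \<open>a + b\<close>. A step of length \<open>r\<close> against \<open>g\<close> lowers this
        by \<open>r * norm g\<close> and stays in \<open>D\<close>, where \<open>g\<close> is
        nonnegative.\<close>
      have "(a + b) - (r / norm g) *\<^sub>R g \<in> cball (a + b) r"
        using False r by (simp add: dist_norm)
      then have "(a + b) - (r / norm g) *\<^sub>R g \<in> D"
        using r(2) by blast
      then have "0 \<le> g \<bullet> ((a + b) - (r / norm g) *\<^sub>R g)"
        using g by (simp only: K_def mem_Collect_eq)
      also have "\<dots> = 1 - r * norm g"
        using g False by (simp add: K_def inner_diff_right inner_add_right power2_norm_eq_inner[symmetric] power2_eq_square)
      finally show ?thesis
        using r(1) by (simp add: field_simps)
    qed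
  qed
  have comp: "compact K"
    using cl bdd by (simp add: compact_eq_bounded_closed)
  have "linear (adjoint T)"
    by (rule adjoint_linear[OF linear_T])
  then have cont: "continuous_on K (adjoint T)"
    by (simp add: linear_continuous_on linear_conv_bounded_linear)
  have adj: "adjoint T g \<bullet> x = g \<bullet> T x" for g x
    using adjoint_works[OF linear_T, of x g] by (simp add: inner_commute)
  have "adjoint T \<in> K \<rightarrow> K"
    by (auto simp: K_def adj T_a T_b T_D)
  from brouwer[OF comp conv ne cont this] obtain g where "g \<in> K" "adjoint T g = g"
    by blast
  then show ?thesis
    using adj by (intro exI[of _ g]) (auto simp: K_def, metis)
qed

end

text \<open>\<open>f\<close> and \<open>g\<close> form the basis dual to \<open>b\<close> and
  \<open>a\<close>; they turn out to be the coefficients in the limits of backward and forward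
  iteration.\<close>

locale cone_auto_functionals = cone_auto D T S a b q
  for D :: "'a::euclidean_space set" and T S a b q +
  fixes f g :: 'a
  assumes f_D: "\<And>x. x \<in> D \<Longrightarrow> 0 \<le> f \<bullet> x" and g_D: "\<And>x. x \<in> D \<Longrightarrow> 0 \<le> g \<bullet> x"
    and f_a: "f \<bullet> a = 0" and f_b: "f \<bullet> b = 1" and g_a: "g \<bullet> a = 1" and g_b: "g \<bullet> b = 0"
    and f_T: "\<And>x. f \<bullet> T x = q * (f \<bullet> x)" and g_T: "\<And>x. g \<bullet> T x = g \<bullet> x"

context cone_auto
begin

text \<open>\<open>f\<close> is the invariant functional of the reversed automorphism; invariance
  under \<open>q S\<close> amounts to being scaled by \<open>q\<close> under
  \<open>T\<close>.\<close>

lemma ex_functionals: "\<exists>f g. cone_auto_functionals D T S a b q f g"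
proof -
  interpret sw: cone_auto D "\<lambda>x. q *\<^sub>R S x" "\<lambda>x. (1/q) *\<^sub>R T x" b a q
    by (rule swap_auto)
  obtain g where g: "\<forall>x\<in>D. 0 \<le> g \<bullet> x" "g \<bullet> b = 0" "g \<bullet> a = 1" "\<And>x. g \<bullet> T x = g \<bullet> x"
    using ex_eigenfunctional by blast
  obtain f where f: "\<forall>x\<in>D. 0 \<le> f \<bullet> x" "f \<bullet> a = 0" "f \<bullet> b = 1" "\<And>x. f \<bullet> (q *\<^sub>R S x) = f \<bullet> x"
    using sw.ex_eigenfunctional by blast
  have "f \<bullet> T x = q * (f \<bullet> x)" for x
    using f(4)[of "T x"] by simp
  then have "cone_auto_functionals_axioms D T a b q f g"
    using f(1-3) g by (intro cone_auto_functionals_axioms.intro) auto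
  then show ?thesis
    using cone_auto_functionals.intro[OF cone_auto_axioms] by blast
qed

end

section \<open>North-south dynamics on the cone\<close>

context cone_auto_functionals
begin

text \<open>Reversal exchanges \<open>f\<close> and \<open>g\<close> as well, so each result below
  has a mirror image at the other end of the axis.\<close>

lemma swap: "cone_auto_functionals D (\<lambda>x. q *\<^sub>R S x) (\<lambda>x. (1/q) *\<^sub>R T x) b a q g f"
proof -
  interpret sw: cone_auto D "\<lambda>x. q *\<^sub>R S x" "\<lambda>x. (1/q) *\<^sub>R T x" b a q
    by (rule swap_auto)
  show ?thesis
  proof
    show "g \<bullet> q *\<^sub>R S x = q * (g \<bullet> x)" for x
      using g_T[of "S x"] by simp
    show "f \<bullet> q *\<^sub>R S x = f \<bullet> x" for x
      using f_T[of "S x"] by simp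
  qed (auto simp: f_D g_D f_a f_b g_a g_b)
qed

lemma f_S: "f \<bullet> S x = (f \<bullet> x) / q"
  using f_T[of "S x"] q by (simp add: field_simps)

lemma g_S: "g \<bullet> S x = g \<bullet> x"
  using g_T[of "S x"] by simp

lemma functional_int_pos:
  assumes h: "\<And>x. x \<in> D \<Longrightarrow> 0 \<le> h \<bullet> x" and h0: "h \<noteq> 0" and x: "x \<in> interior D"
  shows "0 < h \<bullet> x"
proof -
  obtain r where r: "r > 0" "cball x r \<subseteq> D"
    using x by (auto simp: mem_interior_cball)
  have "x - (r / norm h) *\<^sub>R h \<in> cball x r"
    using h0 r by (simp add: dist_norm)
  then have "0 \<le> h \<bullet> (x - (r / norm h) *\<^sub>R h)"
    using subsetD[OF r(2)] h by blast
  moreover have "\<dots> = h \<bullet> x - r * norm h"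
    using h0 by (simp add: inner_diff_right power2_norm_eq_inner[symmetric] power2_eq_square)
  moreover have "0 < r * norm h"
    using r h0 by simp
  ultimately show ?thesis by linarith
qed

lemma f_int: "x \<in> interior D \<Longrightarrow> 0 < f \<bullet> x"
  using functional_int_pos[of f] f_D f_b by fastforce

lemma g_int: "x \<in> interior D \<Longrightarrow> 0 < g \<bullet> x"
  using functional_int_pos[of g] g_D g_a by fastforce

text \<open>The half triangle condition at work: \<open>f\<close> does not notice \<open>a\<close>,
  so if \<open>a + x\<close> is interior then \<open>f\<close> is positive at \<open>x\<close>;
  otherwise \<open>b + x\<close> is interior and the same holds for \<open>g\<close>.\<close>

lemma fg_pos:
  assumes "x \<in> D" "x \<noteq> 0"
  shows "0 < f \<bullet> x + g \<bullet> x"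
proof -
  have "a + x \<in> interior D \<Longrightarrow> 0 < f \<bullet> x" "b + x \<in> interior D \<Longrightarrow> 0 < g \<bullet> x"
    using f_int[of "a + x"] g_int[of "b + x"] by (simp_all add: inner_add_right f_a g_b)
  then show ?thesis
    using no_half_triangle[OF assms] f_D[OF assms(1)] g_D[OF assms(1)] by fastforce
qed

text \<open>An orbit in \<open>D\<close> is bounded as soon as \<open>f\<close> and \<open>g\<close>
  are bounded along it, and both evolve explicitly under \<open>T\<close> and
  \<open>S\<close>.\<close>

lemma norm_bound: "\<exists>c>0. \<forall>x\<in>D. c * norm x \<le> f \<bullet> x + g \<bullet> x"
  using closed_cone_norm_bound[OF closed_D scale_D, of "f + g"] fg_pos by (simp add: inner_add_left)

lemma T_pow_D: "x \<in> D \<Longrightarrow> (T ^^ n) x \<in> D"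
  by (induction n) (auto simp: T_D)

lemma S_pow_D: "x \<in> D \<Longrightarrow> (S ^^ n) x \<in> D"
  by (induction n) (auto simp: S_D)

lemma linear_T_pow: "linear (T ^^ n)"
proof (induction n)
  case (Suc n)
  then show ?case
    using linear_compose[OF _ linear_T] by (simp add: o_def)
qed (simp add: id_def linear_id[unfolded id_def])

lemma T_pow_a: "(T ^^ n) a = a"
  by (induction n) (auto simp: T_a)

lemma T_pow_b: "(T ^^ n) b = q ^ n *\<^sub>R b"
  by (induction n) (auto simp: T_b linear_cmul[OF linear_T])

lemma T_pow_S_pow: "(T ^^ n) ((S ^^ n) x) = x"
proof (induction n arbitrary: x)
  case (Suc n)
  have "(T ^^ Suc n) ((S ^^ Suc n) x) = (T ^^ n) (T (S ((S ^^ n) x)))"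
    by (simp add: funpow_swap1)
  then show ?case
    by (simp add: Suc)
qed simp

lemma f_T_pow: "f \<bullet> (T ^^ n) x = q ^ n * (f \<bullet> x)"
  by (induction n) (auto simp: f_T)

lemma g_T_pow: "g \<bullet> (T ^^ n) x = g \<bullet> x"
  by (induction n) (auto simp: g_T)

lemma f_S_pow: "f \<bullet> (S ^^ n) x = (f \<bullet> x) / q ^ n"
  by (induction n) (auto simp: f_S)

lemma g_S_pow: "g \<bullet> (S ^^ n) x = g \<bullet> x"
  by (induction n) (auto simp: g_S)

text \<open>
  If \<open>y = z - t a\<close> is nonzero with \<open>t\<close> maximal such that \<open>y \<in> D\<close>, then \<open>b\<close> sees a limit point
  \<open>y'\<close> of the backward orbit of \<open>y\<close> through the interior, so \<open>y' + b - \<epsilon> a\<close> is interior.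
  Moving forward again contracts \<open>b\<close> and fixes \<open>a\<close>, so \<open>y - \<epsilon> a \<in> D\<close>.
\<close>

lemma ker_f:
  assumes z: "z \<in> D" "f \<bullet> z = 0"
  shows "z = (g \<bullet> z) *\<^sub>R a"
proof -
  define I where "I = {t. 0 \<le> t \<and> z - t *\<^sub>R a \<in> D}"
  have "I \<subseteq> {0..g \<bullet> z}"
  proof
    fix t assume "t \<in> I"
    then have "0 \<le> t" "0 \<le> g \<bullet> (z - t *\<^sub>R a)"
      by (auto simp: I_def intro: g_D)
    then show "t \<in> {0..g \<bullet> z}"
      by (simp add: inner_diff_right g_a)
  qed
  then have "bounded I"
    by (rule bounded_subset[OF compact_imp_bounded[OF compact_Icc]])
  moreover have "closed I"
  proof -
    have "I = {0..} \<inter> (\<lambda>t. z - t *\<^sub>R a) -` D"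
      by (auto simp: I_def)
    then show ?thesis
      using closed_D by (auto intro!: closed_Int continuous_closed_vimage continuous_intros)
  qed
  ultimately have "compact I"
    by (simp add: compact_eq_bounded_closed)
  moreover have "0 \<in> I"
    using z by (simp add: I_def)
  ultimately obtain t where t: "t \<in> I" "\<And>s. s \<in> I \<Longrightarrow> s \<le> t"
    using compact_attains_sup[of I] by blast
  define y where "y = z - t *\<^sub>R a"
  have y: "y \<in> D" "f \<bullet> y = 0"
    using t z by (auto simp: y_def I_def inner_diff_right f_a)
  have max: "y - e *\<^sub>R a \<notin> D" if "0 < e" for e
  proof
    assume "y - e *\<^sub>R a \<in> D"
    then have "t + e \<in> I"
      using t(1) that by (auto simp: I_def y_def scaleR_add_left diff_diff_eq)
    then show False
      using t(2) that by fastforce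
  qed
  have "y = 0"
  proof (rule ccontr)
    assume "y \<noteq> 0"
    then have gy: "0 < g \<bullet> y"
      using fg_pos[OF y(1)] y(2) by simp
    obtain c where c: "c > 0" "\<And>x. x \<in> D \<Longrightarrow> c * norm x \<le> f \<bullet> x + g \<bullet> x"
      using norm_bound by blast
    define X where "X n = (S ^^ n) y" for n
    have XD: "X n \<in> D" and fX: "f \<bullet> X n = 0" and gX: "g \<bullet> X n = g \<bullet> y" for n
      using y by (auto simp: X_def S_pow_D f_S_pow g_S_pow)
    \<comment> \<open>Backward iteration divides \<open>f\<close> by \<open>q\<close> each time, but
      \<open>f\<close> vanishes at \<open>y\<close>, and \<open>g\<close> is constant; so this
      backward orbit stays bounded.\<close>
    have "norm (X n) \<le> (g \<bullet> y) / c" for n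
      using c(2)[OF XD[of n]] c(1) by (simp add: fX gX field_simps)
    then have "bounded (range X)"
      by (auto intro!: boundedI)
    from bounded_imp_convergent_subsequence[OF this] obtain y' r where
      r: "strict_mono r" "(X \<circ> r) \<longlonglongrightarrow> y'"
      by blast
    have y'D: "y' \<in> D"
      using closed_sequentially[OF closed_D _ r(2)] XD by simp
    have "(\<lambda>n. h \<bullet> (X \<circ> r) n) \<longlonglongrightarrow> h \<bullet> y'" for h
      using r(2) by (intro tendsto_intros)
    from this[of f] this[of g] have "f \<bullet> y' = 0" "g \<bullet> y' = g \<bullet> y"
      by (simp_all add: fX gX LIMSEQ_const_iff)
    \<comment> \<open>The limit still lies in \<open>ker f\<close>, where \<open>a\<close> is
      invisible: \<open>f\<close> vanishes at \<open>a + y'\<close>, while it is positive on the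
      interior.\<close>
    with gy have "y' \<noteq> 0" "a + y' \<notin> interior D"
      using f_int[of "a + y'"] by (auto simp: inner_add_right f_a)
    with no_half_triangle[OF y'D] have "b + y' \<in> interior D" by blast
    then obtain e where e: "e > 0" "cball (b + y') e \<subseteq> interior D"
      using open_contains_cball[of "interior D"] by auto
    \<comment> \<open>Small enough to keep the shift by \<open>d a\<close> within distance
      \<open>e\<close>; the summand 1 keeps the denominator positive.\<close>
    define d where "d = e / (norm a + 1)"
    have d: "0 < d" "norm (d *\<^sub>R a) \<le> e"
      using e(1) by (auto simp: d_def field_simps abs_of_pos add_nonneg_pos add_pos_nonneg)
    have "b + y' - d *\<^sub>R a \<in> interior D"
      using d e(2) by (auto simp: dist_norm)
    moreover have "(\<lambda>n. b + (X \<circ> r) n - d *\<^sub>R a) \<longlonglongrightarrow> b + y' - d *\<^sub>R a"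
      using r(2) by (intro tendsto_intros)
    ultimately have ev: "\<forall>\<^sub>F n in sequentially. b + (X \<circ> r) n - d *\<^sub>R a \<in> interior D"
      using topological_tendstoD open_interior by blast
    have "\<forall>\<^sub>F n in sequentially. q ^ r n *\<^sub>R b + y - d *\<^sub>R a \<in> D"
      using ev
    proof eventually_elim
      case (elim n)
      then have "(T ^^ r n) (b + (X \<circ> r) n - d *\<^sub>R a) \<in> D"
        by (intro T_pow_D int_sub)
      then show ?case
        by (simp add: linear_add[OF linear_T_pow] linear_diff[OF linear_T_pow] linear_cmul[OF linear_T_pow]
              T_pow_a T_pow_b X_def T_pow_S_pow)
    qed
    moreover have "(\<lambda>n. q ^ r n *\<^sub>R b + y - d *\<^sub>R a) \<longlonglongrightarrow> 0 *\<^sub>R b + y - d *\<^sub>R a"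
    proof (intro tendsto_intros)
      have "(\<lambda>n. q ^ n) \<longlonglongrightarrow> 0"
        using q by (intro LIMSEQ_power_zero) auto
      from LIMSEQ_subseq_LIMSEQ[OF this r(1)] show "(\<lambda>n. q ^ r n) \<longlonglongrightarrow> 0"
        by (simp add: o_def)
    qed
    ultimately have "0 *\<^sub>R b + y - d *\<^sub>R a \<in> D"
      using Lim_in_closed_set[OF closed_D] by force
    then show False
      using max d by simp
  qed
  then have "z = t *\<^sub>R a"
    by (simp add: y_def)
  then show ?thesis
    by (simp add: g_a)
qed

text \<open>The forward orbit is bounded, \<open>f\<close> decays like \<open>q ^ n\<close> along it
  and \<open>g\<close> is constant. Every limit point therefore lies in
  \<open>D \<inter> ker f\<close>, where \<open>ker_f\<close> determines it by its value under
  \<open>g\<close>; a bounded sequence with a single limit point converges.\<close>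

lemma T_pow_tendsto_D:
  assumes w: "w \<in> D"
  shows "(\<lambda>n. (T ^^ n) w) \<longlonglongrightarrow> (g \<bullet> w) *\<^sub>R a"
proof (rule ccontr)
  obtain c where c: "c > 0" "\<And>x. x \<in> D \<Longrightarrow> c * norm x \<le> f \<bullet> x + g \<bullet> x"
    using norm_bound by blast
  assume "\<not> ?thesis"
  then obtain e where e: "e > 0" "\<And>N. \<exists>n\<ge>N. e \<le> dist ((T ^^ n) w) ((g \<bullet> w) *\<^sub>R a)"
    by (auto simp: lim_sequentially not_less)
  then have "infinite {n. e \<le> dist ((T ^^ n) w) ((g \<bullet> w) *\<^sub>R a)}"
    unfolding infinite_nat_iff_unbounded_le by blast
  then obtain s :: "nat \<Rightarrow> nat" where s: "strict_mono s"
      "\<And>n. e \<le> dist ((T ^^ s n) w) ((g \<bullet> w) *\<^sub>R a)"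
    using infinite_enumerate by blast
  have "norm ((T ^^ n) w) \<le> (f \<bullet> w + g \<bullet> w) / c" for n
  proof -
    have "c * norm ((T ^^ n) w) \<le> q ^ n * (f \<bullet> w) + g \<bullet> w"
      using c(2)[OF T_pow_D[OF w, of n]] by (simp add: f_T_pow g_T_pow)
    also have "\<dots> \<le> f \<bullet> w + g \<bullet> w"
      using q f_D[OF w] by (simp add: mult_left_le_one_le power_le_one)
    finally show ?thesis
      using c(1) by (simp add: field_simps)
  qed
  then have "bounded (range (\<lambda>n. (T ^^ s n) w))"
    by (auto intro!: boundedI)
  from bounded_imp_convergent_subsequence[OF this] obtain z r where
      r: "strict_mono r" "((\<lambda>n. (T ^^ s n) w) \<circ> r) \<longlonglongrightarrow> z"
    by blast
  then have lim: "(\<lambda>n. (T ^^ s (r n)) w) \<longlonglongrightarrow> z"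
    by (simp add: o_def)
  have sr: "strict_mono (s \<circ> r)"
    using s(1) r(1) by (simp add: strict_mono_o)
  have "z \<in> D"
    using closed_sequentially[OF closed_D _ lim] w by (simp add: T_pow_D)
  have "(\<lambda>n. g \<bullet> (T ^^ s (r n)) w) \<longlonglongrightarrow> g \<bullet> z"
    using lim by (intro tendsto_intros)
  then have "g \<bullet> z = g \<bullet> w"
    by (simp add: g_T_pow LIMSEQ_const_iff)
  have "(\<lambda>n. f \<bullet> (T ^^ s (r n)) w) \<longlonglongrightarrow> f \<bullet> z"
    using lim by (intro tendsto_intros)
  moreover have "(\<lambda>n. f \<bullet> (T ^^ s (r n)) w) \<longlonglongrightarrow> 0"
  proof -
    have "(\<lambda>n. q ^ n) \<longlonglongrightarrow> 0"
      using q by (intro LIMSEQ_power_zero) auto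
    from LIMSEQ_subseq_LIMSEQ[OF this sr] have "(\<lambda>n. q ^ s (r n) * (f \<bullet> w)) \<longlonglongrightarrow> 0 * (f \<bullet> w)"
      by (intro tendsto_intros) (simp add: o_def)
    then show ?thesis by (simp add: f_T_pow)
  qed
  ultimately have "f \<bullet> z = 0"
    using LIMSEQ_unique by blast
  with ker_f[OF \<open>z \<in> D\<close>] \<open>g \<bullet> z = g \<bullet> w\<close> have "z = (g \<bullet> w) *\<^sub>R a" by simp
  then have "(\<lambda>n. dist ((T ^^ s (r n)) w) ((g \<bullet> w) *\<^sub>R a)) \<longlonglongrightarrow> 0"
    using tendsto_dist[OF lim tendsto_const, of z] by simp
  then have "e \<le> 0"
    by (rule LIMSEQ_le_const) (use s(2) in blast)
  with e(1) show False by simp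
qed

text \<open>As \<open>a + b\<close> is interior, a small multiple of any vector is a difference of
  two elements of \<open>D\<close>; linearity extends the limit from the cone to the whole
  space.\<close>

lemma T_pow_tendsto: "(\<lambda>n. (T ^^ n) w) \<longlonglongrightarrow> (g \<bullet> w) *\<^sub>R a"
proof -
  obtain r where r: "r > 0" "cball (a + b) r \<subseteq> D"
    using ab_int by (auto simp: mem_interior_cball)
  define s where "s = r / (norm w + 1)"
  have s: "0 < s" "norm (s *\<^sub>R w) \<le> r"
    using r(1) by (auto simp: s_def field_simps abs_of_pos add_nonneg_pos add_pos_nonneg)
  define x where "x = (a + b) + s *\<^sub>R w"
  have "a + b \<in> D" "x \<in> D"
    using r s by (auto simp: x_def dist_norm intro: add_D a_D b_D)
  then have "(\<lambda>n. (1/s) *\<^sub>R ((T ^^ n) x - (T ^^ n) (a + b)))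
      \<longlonglongrightarrow> (1/s) *\<^sub>R ((g \<bullet> x) *\<^sub>R a - (g \<bullet> (a + b)) *\<^sub>R a)"
    by (intro tendsto_intros T_pow_tendsto_D)
  moreover have "(1/s) *\<^sub>R ((T ^^ n) x - (T ^^ n) (a + b)) = (T ^^ n) w" for n
    using s by (simp add: x_def linear_add[OF linear_T_pow] linear_cmul[OF linear_T_pow])
  moreover have "(1/s) *\<^sub>R ((g \<bullet> x) *\<^sub>R a - (g \<bullet> (a + b)) *\<^sub>R a) = (g \<bullet> w) *\<^sub>R a"
    using s by (simp add: x_def inner_add_right scaleR_add_left)
  ultimately show ?thesis by simp
qed

lemma swap_pow: "((\<lambda>x. q *\<^sub>R S x) ^^ n) x = q ^ n *\<^sub>R (S ^^ n) x"
  by (induction n) (auto simp: linear_cmul[OF linear_S])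

lemma S_pow_tendsto: "(\<lambda>n. q ^ n *\<^sub>R (S ^^ n) w) \<longlonglongrightarrow> (f \<bullet> w) *\<^sub>R b"
proof -
  interpret sw: cone_auto_functionals D "\<lambda>x. q *\<^sub>R S x" "\<lambda>x. (1/q) *\<^sub>R T x" b a q g f
    by (rule swap)
  show ?thesis
    using sw.T_pow_tendsto by (simp add: swap_pow)
qed

text \<open>
  The obstruction \<open>a + z \<notin> interior D\<close> is invariant under rescaling \<open>a\<close> and under the contraction
  towards \<open>b\<close>, hence passes to \<open>a + (f \<bullet> z) b\<close>.
\<close>

lemma a_add_int:
  assumes z: "z \<in> D" "f \<bullet> z \<noteq> 0"
  shows "a + z \<in> interior D"
proof (rule ccontr)
  assume not: "a + z \<notin> interior D"
  have fz: "0 < f \<bullet> z"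
    using z f_D[of z] by simp
  \<comment> \<open>Enlarging the coefficient of \<open>a\<close> cannot help: dividing by
    \<open>t\<close> and adding a multiple of \<open>z\<close> leads back to
    \<open>a + z\<close>.\<close>
  have 1: "t *\<^sub>R a + z \<notin> interior D" if "t \<ge> 1" for t
  proof
    assume "t *\<^sub>R a + z \<in> interior D"
    then have "(1/t) *\<^sub>R (t *\<^sub>R a + z) \<in> interior D"
      by (rule int_scale) (use that in simp)
    moreover have "(1 - 1/t) *\<^sub>R z \<in> D"
      by (rule scale_D[OF z(1)]) (use that in simp)
    ultimately have "(1/t) *\<^sub>R (t *\<^sub>R a + z) + (1 - 1/t) *\<^sub>R z \<in> interior D"
      by (rule int_add)
    also have "(1/t) *\<^sub>R (t *\<^sub>R a + z) + (1 - 1/t) *\<^sub>R z = a + z"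
      using that by (simp add: algebra_simps)
    finally show False using not by contradiction
  qed
  have int_T: "T x \<in> interior D" if "x \<in> interior D" for x
  proof -
    have "T ` interior D \<subseteq> interior D"
    proof (rule interior_maximal)
      have "T ` interior D = S -` interior D"
        by (auto simp: image_iff) (metis TS)
      then show "open (T ` interior D)"
        using linear_S by (auto intro!: continuous_open_vimage linear_continuous_at simp: linear_conv_bounded_linear)
    qed (auto intro: T_D int_sub)
    then show ?thesis using that by auto
  qed
  have int_T_pow: "(T ^^ n) x \<in> interior D" if "x \<in> interior D" for x n
    using that by (induction n) (auto intro: int_T)
  \<comment> \<open>Applying \<open>T ^^ n\<close>, which fixes \<open>a\<close>, and dividing by
    \<open>q ^ n\<close> gives \<open>(1 / q ^ n) a + z\<close>, excluded by the previous
    step.\<close>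
  have 2: "a + q ^ n *\<^sub>R (S ^^ n) z \<notin> interior D" for n
  proof
    assume "a + q ^ n *\<^sub>R (S ^^ n) z \<in> interior D"
    then have "(1 / q ^ n) *\<^sub>R (T ^^ n) (a + q ^ n *\<^sub>R (S ^^ n) z) \<in> interior D"
      using q by (intro int_scale int_T_pow) auto
    also have "(1 / q ^ n) *\<^sub>R (T ^^ n) (a + q ^ n *\<^sub>R (S ^^ n) z) = (1 / q ^ n) *\<^sub>R a + z"
      using q by (simp add: linear_add[OF linear_T_pow] linear_cmul[OF linear_T_pow] T_pow_a T_pow_S_pow scaleR_add_right)
    finally show False
      using 1[of "1 / q ^ n"] q by (simp add: power_le_one)
  qed
  have "a + (f \<bullet> z) *\<^sub>R b \<in> - interior D"
  proof (rule closed_sequentially)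
    show "(\<lambda>n. a + q ^ n *\<^sub>R (S ^^ n) z) \<longlonglongrightarrow> a + (f \<bullet> z) *\<^sub>R b"
      by (intro tendsto_intros S_pow_tendsto)
  qed (use 2 in auto)
  moreover have "a + (f \<bullet> z) *\<^sub>R b \<in> interior D"
  proof -
    \<comment> \<open>The limit point dominates \<open>m (a + b)\<close>, which is interior, with a
      remainder in \<open>D\<close>.\<close>
    define m where "m = min 1 (f \<bullet> z)"
    have m: "0 < m" "m \<le> 1" "m \<le> f \<bullet> z"
      using fz by (auto simp: m_def)
    have "m *\<^sub>R (a + b) + ((1 - m) *\<^sub>R a + (f \<bullet> z - m) *\<^sub>R b) \<in> interior D"
      using m by (intro int_add int_scale ab_int add_D scale_D a_D b_D) auto
    also have "m *\<^sub>R (a + b) + ((1 - m) *\<^sub>R a + (f \<bullet> z - m) *\<^sub>R b) = a + (f \<bullet> z) *\<^sub>R b"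
      by (simp add: algebra_simps)
    finally show ?thesis .
  qed
  ultimately show False by simp
qed

lemma ker_g:
  assumes "z \<in> D" "g \<bullet> z = 0"
  shows "z = (f \<bullet> z) *\<^sub>R b"
proof -
  interpret sw: cone_auto_functionals D "\<lambda>x. q *\<^sub>R S x" "\<lambda>x. (1/q) *\<^sub>R T x" b a q g f
    by (rule swap)
  show ?thesis using sw.ker_f assms .
qed

lemma b_add_int:
  assumes "z \<in> D" "g \<bullet> z \<noteq> 0"
  shows "b + z \<in> interior D"
proof -
  interpret sw: cone_auto_functionals D "\<lambda>x. q *\<^sub>R S x" "\<lambda>x. (1/q) *\<^sub>R T x" b a q g f
    by (rule swap)
  show ?thesis using sw.a_add_int assms .
qed

text \<open>If \<open>g\<close> does not vanish at \<open>z\<close>, invariance of \<open>g\<close>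
  forces eigenvalue 1, so the orbit is constant and equals its own limit. Otherwise
  \<open>ker_g\<close> applies.\<close>

lemma eigenvector_cases:
  assumes z: "z \<in> D" and k: "T z = k *\<^sub>R z"
  shows "z = (g \<bullet> z) *\<^sub>R a \<or> z = (f \<bullet> z) *\<^sub>R b"
proof (cases "g \<bullet> z = 0")
  case True then show ?thesis using ker_g z by blast
next
  case False
  then have "k = 1"
    using g_T[of z] by (simp add: k)
  then have "(T ^^ n) z = z" for n
    using k by (induction n) auto
  then have "z = (g \<bullet> z) *\<^sub>R a"
    using T_pow_tendsto[of z] by (simp add: LIMSEQ_const_iff)
  then show ?thesis ..
qed

end
section \<open>Simple dominant eigenvalues\<close>

text \<open>The matrix determinant lemma over the identity. The rows of the identity are perturbed
  one at a time (\<open>M X\<close> has the rows in \<open>X\<close> perturbed); by linearity each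
  new row contributes one extra determinant.\<close>

lemma det_one_plus_rank_one:
  fixes u v :: "'a::field^'n"
  shows "det (\<chi> i j. (if i = j then 1 else 0) + u $ i * v $ j) = 1 + (\<Sum>i\<in>UNIV. v $ i * u $ i)"
proof -
  let ?e = "\<lambda>i. axis i (1::'a) :: 'a^'n"
  define M where "M X = (\<chi> i. if i \<in> X then ?e i + u $ i *s v else ?e i)" for X
  \<comment> \<open>Once row \<open>k\<close> is \<open>v\<close> itself, the perturbations of the
    other rows are multiples of row \<open>k\<close> and can be removed without changing the
    determinant.\<close>
  have det_upd: "det (\<chi> i. if i = k then v else M X $ i) = v $ k" if k: "k \<notin> X" for X k
  proof -
    have fin: "finite X" by simp
    have "det (\<chi> i. if i = k then v else M X $ i) = det (\<chi> i. if i = k then v else ?e i)"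
      using fin k
    proof (induction X rule: finite_induct)
      case empty
      then show ?case by (simp add: M_def cong: if_cong)
    next
      case (insert x X)
      let ?N = "\<chi> i. if i = k then v else M X $ i"
      have "u $ x *s v \<in> vec.span {row j ?N |j. j \<noteq> x}"
        using insert.prems by (intro vec.span_scale vec.span_base) (auto simp: row_def vec_eq_iff intro!: exI[of _ k])
      from det_row_span[OF this]
      have "det (\<chi> i. if i = x then row x ?N + u $ x *s v else row i ?N) = det ?N" .
      moreover have "(\<chi> i. if i = x then row x ?N + u $ x *s v else row i ?N)
          = (\<chi> i. if i = k then v else M (insert x X) $ i)"
        using insert.hyps insert.prems by (auto simp: vec_eq_iff row_def M_def)
      ultimately show ?case
        using insert by simp
    qed
    also have "\<dots> = v $ k"
    proof -
      let ?N = "\<chi> i. if i = k then v $ k *s ?e i else ?e i"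
      \<comment> \<open>All coordinates of \<open>v\<close> except the one at \<open>k\<close> are
        combinations of the other rows, which are unit vectors.\<close>
      have "v - v $ k *s ?e k = (\<Sum>j\<in>UNIV - {k}. v $ j *s ?e j)"
      proof -
        have "v = (\<Sum>j\<in>UNIV. v $ j *s ?e j)"
          by (simp add: vec_eq_iff sum_component axis_def vector_scalar_mult_def if_distrib cong: if_cong)
        then show ?thesis
          by (simp add: sum_diff1)
      qed
      also have "\<dots> \<in> vec.span {row j ?N |j. j \<noteq> k}"
      proof (rule vec.span_sum, rule vec.span_scale, rule vec.span_base)
        fix j assume "j \<in> UNIV - {k}"
        then have "row j ?N = ?e j" "j \<noteq> k" by (simp_all add: row_def vec_eq_iff)
        then show "?e j \<in> {row j ?N |j. j \<noteq> k}"
          by (intro CollectI exI[of _ j]) simp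
      qed
      finally have "det (\<chi> i. if i = k then row k ?N + (v - v $ k *s ?e k) else row i ?N) = det ?N"
        by (rule det_row_span)
      moreover have "(\<chi> i. if i = k then row k ?N + (v - v $ k *s ?e k) else row i ?N)
          = (\<chi> i. if i = k then v else ?e i)"
        by (auto simp: vec_eq_iff row_def)
      moreover have "det ?N = v $ k * det (\<chi> i. if i = k then ?e i else ?e i)"
        by (rule det_row_mul)
      moreover have "(\<chi> i. if i = k then ?e i else ?e i) = mat 1"
        by (auto simp: vec_eq_iff mat_def axis_def)
      ultimately show ?thesis by simp
    qed
    finally show ?thesis .
  qed
  have "det (M X) = 1 + (\<Sum>i\<in>X. v $ i * u $ i)" for X
  proof -
    have "finite X" by simp
    then show ?thesis
    proof (induction X rule: finite_induct)
      case empty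
      have "M {} = mat 1"
        by (auto simp: M_def vec_eq_iff mat_def axis_def)
      then show ?case by simp
    next
      case (insert k X)
      have 1: "M (insert k X) = (\<chi> i. if i = k then ?e k + u $ k *s v else M X $ i)"
        using insert.hyps by (auto simp: M_def vec_eq_iff)
      have 2: "(\<chi> i. if i = k then ?e k else M X $ i) = M X"
        using insert.hyps by (auto simp: M_def vec_eq_iff)
      have "det (M (insert k X)) = det (\<chi> i. if i = k then ?e k else M X $ i)
          + det (\<chi> i. if i = k then u $ k *s v else M X $ i)"
        unfolding 1 by (rule det_row_add)
      also have "\<dots> = det (M X) + u $ k * v $ k"
        unfolding 2 using det_row_mul[of k "u $ k" "\<lambda>_. v" "\<lambda>i. M X $ i"] det_upd[OF insert.hyps(2)] by simp
      finally show ?case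
        using insert by (simp add: algebra_simps)
    qed
  qed
  moreover have "M UNIV = (\<chi> i j. (if i = j then 1 else 0) + u $ i * v $ j)"
    by (simp add: M_def vec_eq_iff axis_def)
  ultimately show ?thesis by metis
qed

text \<open>Because \<open>u\<close> is an eigenvector of \<open>M\<close>, the matrix
  \<open>x - B\<close> factors as \<open>x - M\<close> times a rank one perturbation of the
  identity. The identity is stated cross-multiplied to be polynomial; it holds for all
  \<open>x\<close> other than \<rho>, hence everywhere.\<close>

lemma charpoly_rank_one_update:
  fixes M :: "complex^'n^'n"
  assumes u: "M *v u = \<rho> *s u" and h: "(\<Sum>i\<in>UNIV. h $ i * u $ i) = 1"
  shows "charpoly M * [:-s, 1:] = charpoly (\<chi> i j. M $ i $ j + (s - \<rho>) * u $ i * h $ j) * [:-\<rho>, 1:]"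
    (is "_ = charpoly ?B * _")
proof -
  have eq: "poly (charpoly M * [:-s, 1:]) x = poly (charpoly ?B * [:-\<rho>, 1:]) x" if x: "x \<noteq> \<rho>" for x
  proof -
    \<comment> \<open>The factor \<open>x - M\<close> scales \<open>u\<close> by
      \<open>x - \<rho>\<close>, so this \<open>c\<close> produces exactly the coefficient
      \<open>\<rho> - s\<close> of the update; \<open>1 + c\<close> becomes the determinant of the
      second factor.\<close>
    obtain c where c: "c * (x - \<rho>) = \<rho> - s" "1 + c = (x - s) / (x - \<rho>)"
      using x by (intro that[of "(\<rho> - s) / (x - \<rho>)"]) (auto simp: field_simps)
    let ?X = "(\<chi> i j. (if i = j then x else 0) - M $ i $ j) :: complex^'n^'n"
    let ?R = "(\<chi> i j. (if i = j then 1 else 0) + (c *s u) $ i * h $ j) :: complex^'n^'n"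
    have Mu: "(\<Sum>k\<in>UNIV. M $ i $ k * u $ k) = \<rho> * u $ i" for i
      using arg_cong[OF u, of "\<lambda>w. w $ i"] by (simp add: matrix_vector_mult_def)
    have "(?X ** ?R) $ i $ j = (if i = j then x else 0) - ?B $ i $ j" for i j
    proof -
      have "(?X ** ?R) $ i $ j = (\<Sum>k\<in>UNIV. (if k = j then (if i = j then x else 0) - M $ i $ j else 0)
          + (if k = i then x * c * u $ i * h $ j else 0) - c * h $ j * (M $ i $ k * u $ k))"
        unfolding matrix_matrix_mult_def by (auto intro!: sum.cong simp: algebra_simps)
      also have "\<dots> = (if i = j then x else 0) - M $ i $ j + x * c * u $ i * h $ j
          - c * h $ j * (\<rho> * u $ i)"
        by (simp add: sum.distrib sum_subtractf Mu flip: sum_distrib_left)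
      also have "\<dots> = (if i = j then x else 0) - M $ i $ j + (c * (x - \<rho>)) * u $ i * h $ j"
        by (simp add: algebra_simps)
      also note c(1)
      finally show ?thesis
        by (simp add: algebra_simps)
    qed
    then have XR: "(\<chi> i j. (if i = j then x else 0) - ?B $ i $ j) = ?X ** ?R"
      by (simp add: vec_eq_iff)
    have "poly (charpoly ?B) x = poly (charpoly M) x * det ?R"
      unfolding poly_charpoly XR by (rule det_mul)
    also have "det ?R = 1 + c * (\<Sum>i\<in>UNIV. h $ i * u $ i)"
      unfolding det_one_plus_rank_one by (simp add: sum_distrib_left mult_ac)
    also have "\<dots> = (x - s) / (x - \<rho>)"
      using c by (simp add: h)
    finally show ?thesis
      using x by (simp add: field_simps)
  qed
  show ?thesis
  proof (rule ccontr)
    assume "\<not> ?thesis"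
    then have "charpoly M * [:-s, 1:] - charpoly ?B * [:-\<rho>, 1:] \<noteq> 0"
      by simp
    from poly_roots_finite[OF this] have "finite {x. x \<noteq> \<rho>}"
      by (rule rev_finite_subset) (use eq in auto)
    then have "finite (insert \<rho> {x. x \<noteq> \<rho>})" by simp
    moreover have "insert \<rho> {x. x \<noteq> \<rho>} = UNIV" by auto
    ultimately show False
      using infinite_UNIV_char_0 by metis
  qed
qed

lemma charpoly_root_iff:
  "poly (charpoly M) x = 0 \<longleftrightarrow> (\<exists>v. v \<noteq> 0 \<and> M *v v = x *s v)" for M :: "complex^'n^'n"
proof -
  let ?X = "(\<chi> i j. (if i = j then x else 0) - M $ i $ j) :: complex^'n^'n"
  have X: "?X *v v = x *s v - M *v v" for v
  proof -
    have "(?X *v v) $ i = (\<Sum>k\<in>UNIV. (if k = i then x * v $ i else 0) - M $ i $ k * v $ k)" for i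
      unfolding matrix_vector_mult_def by (auto intro!: sum.cong simp: algebra_simps)
    then show ?thesis
      by (simp add: vec_eq_iff sum_subtractf matrix_vector_mult_def)
  qed
  have "det ?X = 0 \<longleftrightarrow> (\<exists>v. v \<noteq> 0 \<and> ?X *v v = 0)"
    using invertible_det_nz[of ?X] matrix_left_invertible_ker[of ?X] invertible_left_inverse[of ?X] by auto
  then show ?thesis
    unfolding poly_charpoly X right_minus_eq by (simp only: eq_commute)
qed

lemma charpoly_nonzero: "charpoly M \<noteq> 0" for M :: "complex^'n^'n"
  using degree_charpoly[of M] by (metis degree_0 zero_less_card_finite less_numeral_extra(3))

text \<open>
  Moving the eigenvalue \<open>\<rho>\<close> to \<open>s\<close> by a rank one perturbation shows at once that \<open>\<rho>\<close> is simple
  and that the remaining eigenvalues have eigenvectors in the kernel of \<open>h\<close>.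
\<close>

lemma proots_charpoly_simple:
  fixes M :: "complex^'n^'n"
  assumes u: "M *v u = \<rho> *s u" and h: "(\<Sum>i\<in>UNIV. h $ i * u $ i) = 1"
    and hM: "\<And>w. (\<Sum>i\<in>UNIV. h $ i * (M *v w) $ i) = \<rho> * (\<Sum>i\<in>UNIV. h $ i * w $ i)"
    and P: "\<And>\<nu> v. v \<noteq> 0 \<Longrightarrow> M *v v = \<nu> *s v \<Longrightarrow> (\<Sum>i\<in>UNIV. h $ i * v $ i) = 0 \<Longrightarrow> P \<nu>"
    and s: "P s" "s \<noteq> \<rho>"
  shows "\<exists>R. proots (charpoly M) = add_mset \<rho> R \<and> (\<forall>\<nu>. \<nu> \<in># R \<longrightarrow> P \<nu>)"
proof -
  define B where "B = (\<chi> i j. M $ i $ j + (s - \<rho>) * u $ i * h $ j)"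
  have lin: "proots [:-c, 1:] = {#c#}" for c :: complex
    by simp
  have nz: "[:-c, 1:] \<noteq> 0" for c :: complex
    by simp
  have "proots (charpoly M * [:-s, 1:]) = proots (charpoly B * [:-\<rho>, 1:])"
    using charpoly_rank_one_update[OF u h] by (simp only: B_def)
  then have eq: "proots (charpoly M) + {#s#} = proots (charpoly B) + {#\<rho>#}"
    by (simp only: proots_mult[OF charpoly_nonzero nz] lin)
  \<comment> \<open>Since \<open>s\<close> differs from \<rho>, the extra copy of \<rho> on the
    right must be matched by a root of the polynomial of \<open>M\<close>.\<close>
  then have "\<rho> \<in># proots (charpoly M)"
    using s(2) by (metis add_mset_add_single insert_noteq_member multi_member_this union_single_eq_member)
  then obtain R where R: "proots (charpoly M) = add_mset \<rho> R"
    by (metis mset_add)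
  with eq have "proots (charpoly B) = add_mset s R" by simp
  with set_count_proots[OF charpoly_nonzero[of B]] have "{x. poly (charpoly B) x = 0} = insert s (set_mset R)"
    by simp
  then have RB: "poly (charpoly B) \<nu> = 0" if "\<nu> \<in># R" for \<nu>
    using that by blast
  have "P \<nu>" if "\<nu> \<in># R" for \<nu>
  proof -
    from RB[OF that] obtain v where v: "v \<noteq> 0" "B *v v = \<nu> *s v"
      unfolding charpoly_root_iff by blast
    let ?h = "\<lambda>w. \<Sum>i\<in>UNIV. h $ i * w $ i"
    have Bv: "B *v v = M *v v + ((s - \<rho>) * ?h v) *s u"
      by (simp add: B_def vec_eq_iff matrix_vector_mult_def distrib_right sum.distrib)
        (simp add: sum_distrib_left mult_ac)
    have lin_h: "?h (x + k *s y) = ?h x + k * ?h y" for x y k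
      by (simp add: distrib_left sum.distrib sum_distrib_left mult_ac)
    \<comment> \<open>\<open>h\<close> is a left eigenvector of \<open>B\<close> for
      \<open>s\<close>. So an eigenvector of \<open>B\<close> has eigenvalue \<open>s\<close> or
      lies in the kernel of \<open>h\<close>, where \<open>B\<close> agrees with
      \<open>M\<close>.\<close>
    have "?h (B *v v) = ?h (M *v v) + (s - \<rho>) * ?h v * ?h u"
      unfolding Bv by (rule lin_h)
    also have "\<dots> = s * ?h v"
      unfolding hM h by (simp add: algebra_simps)
    finally have "\<nu> * ?h v = s * ?h v"
      using lin_h[of 0 \<nu> v] unfolding v(2) by auto
    then consider "\<nu> = s" | "?h v = 0" by auto
    then show "P \<nu>"
    proof cases
      case 2
      then show ?thesis
        using P[OF v(1)] v(2) Bv by simp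
    qed (use s in simp)
  qed
  with R show ?thesis by blast
qed

section \<open>Real operators on complex vectors\<close>

lemma complex_vec_scaleR: "complex_vec (c *\<^sub>R x) = of_real c *s complex_vec x"
  by (simp add: complex_vec_def vec_eq_iff)

lemma complex_vec_eq_0_iff: "complex_vec x = 0 \<longleftrightarrow> x = 0"
  by (simp add: complex_vec_def vec_eq_iff)

lemma complex_mat_vec: "complex_mat A *v complex_vec x = complex_vec (A *v x)"
  by (simp add: complex_mat_def complex_vec_def vec_eq_iff matrix_vector_mult_def)

lemma complex_mat_mult: "complex_mat A ** complex_mat B = complex_mat (A ** B)"
  by (simp add: complex_mat_def vec_eq_iff matrix_matrix_mult_def)

lemma complex_vec_decompose: "\<exists>x y. v = complex_vec x + \<i> *s complex_vec y"
  by (intro exI[of _ "\<chi> i. Re (v $ i)"] exI[of _ "\<chi> i. Im (v $ i)"])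
     (simp add: complex_vec_def vec_eq_iff complex_eq)

lemma complex_vec_pairing: "(\<Sum>i\<in>UNIV. complex_vec g $ i * complex_vec x $ i) = of_real (g \<bullet> x)"
  by (simp add: complex_vec_def inner_vec_def)

lemma complex_mat_pairing:
  assumes g: "\<And>x. g \<bullet> (A *v x) = k * (g \<bullet> x)"
  shows "(\<Sum>i\<in>UNIV. complex_vec g $ i * (complex_mat A *v w) $ i)
    = of_real k * (\<Sum>i\<in>UNIV. complex_vec g $ i * w $ i)"
proof -
  obtain x y where w: "w = complex_vec x + \<i> *s complex_vec y"
    using complex_vec_decompose by blast
  have p: "(\<Sum>i\<in>UNIV. complex_vec g $ i * (complex_vec x + \<i> *s complex_vec y) $ i)
      = of_real (g \<bullet> x) + \<i> * of_real (g \<bullet> y)" for x y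
    by (simp add: complex_vec_pairing[symmetric] distrib_left sum.distrib sum_distrib_left mult_ac)
  have "complex_mat A *v w = complex_vec (A *v x) + \<i> *s complex_vec (A *v y)"
    by (simp add: w vec.add vec.scale complex_mat_vec matrix_vector_right_distrib)
  then show ?thesis
    by (simp only: p w g) (simp add: algebra_simps)
qed

text \<open>Real and imaginary parts of \<open>v\<close> both lie in the kernel of \<open>g\<close>,
  so their iterates tend to 0. Hence \<open>\<nu> ^ n v\<close> tends to 0, which excludes modulus
  at least 1.\<close>

lemma eigenvalue_in_kernel_lt_1:
  fixes A :: "real^'n^'n"
  assumes lim: "\<And>x. (\<lambda>n. ((\<lambda>x. A *v x) ^^ n) x) \<longlonglongrightarrow> (g \<bullet> x) *\<^sub>R a"
    and v: "v \<noteq> 0" "complex_mat A *v v = \<nu> *s v" "(\<Sum>i\<in>UNIV. complex_vec g $ i * v $ i) = 0"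
  shows "cmod \<nu> < 1"
proof (rule ccontr)
  assume "\<not> ?thesis"
  then have nu: "1 \<le> cmod \<nu>" by simp
  obtain x y where xy: "v = complex_vec x + \<i> *s complex_vec y"
    using complex_vec_decompose by blast
  have "of_real (g \<bullet> x) + \<i> * of_real (g \<bullet> y) = 0"
    using v(3) by (simp add: xy complex_vec_pairing[symmetric] distrib_left sum.distrib sum_distrib_left mult_ac)
  then have g: "g \<bullet> x = 0" "g \<bullet> y = 0"
    by (auto simp: complex_eq_iff)
  obtain i where i: "v $ i \<noteq> 0"
    using v(1) by (auto simp: vec_eq_iff)
  define T where "T = (\<lambda>x. A *v x)"
  have pow: "complex_vec ((T ^^ n) x) + \<i> *s complex_vec ((T ^^ n) y) = \<nu> ^ n *s v" for n
  proof (induction n)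
    case 0
    then show ?case by (simp add: xy)
  next
    case (Suc n)
    have "complex_vec ((T ^^ Suc n) x) + \<i> *s complex_vec ((T ^^ Suc n) y)
        = complex_mat A *v (complex_vec ((T ^^ n) x) + \<i> *s complex_vec ((T ^^ n) y))"
      by (simp add: T_def matrix_vector_right_distrib vec.scale complex_mat_vec)
    also have "\<dots> = \<nu> ^ n *s (complex_mat A *v v)"
      by (simp add: Suc vec.scale)
    finally show ?case
      by (simp add: v(2) vec_eq_iff mult_ac)
  qed
  have "(\<lambda>n. of_real ((T ^^ n) x $ i) + \<i> * of_real ((T ^^ n) y $ i)) \<longlonglongrightarrow> of_real ((0 *\<^sub>R a) $ i) + \<i> * of_real ((0 *\<^sub>R a) $ i)"
    using lim[of x] lim[of y] unfolding g T_def by (intro tendsto_intros)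
  moreover have "of_real ((T ^^ n) x $ i) + \<i> * of_real ((T ^^ n) y $ i) = \<nu> ^ n * v $ i" for n
    using arg_cong[OF pow[of n], of "\<lambda>w. w $ i"] by (simp add: complex_vec_def)
  ultimately have "(\<lambda>n. \<nu> ^ n * v $ i) \<longlonglongrightarrow> 0" by simp
  then have "(\<lambda>n. cmod (\<nu> ^ n * v $ i)) \<longlonglongrightarrow> 0"
    by (rule tendsto_norm_zero)
  moreover have "cmod (v $ i) \<le> cmod (\<nu> ^ n * v $ i)" for n
    using nu by (simp add: norm_mult norm_power mult_le_cancel_right1 one_le_power)
  ultimately have "cmod (v $ i) \<le> 0"
    by (intro LIMSEQ_le_const) auto
  with i show False by simp
qed

section \<open>Ordered moduli and the top eigenspaces\<close>

lemma sorted_list_of_multiset_add_max: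
  fixes x :: "'a::linorder"
  assumes "\<And>y. y \<in># R \<Longrightarrow> y < x"
  shows "sorted_list_of_multiset (add_mset x R) = sorted_list_of_multiset R @ [x]"
proof -
  have "sorted_list_of_multiset (add_mset x R) = sort (sorted_list_of_multiset R @ [x])"
    by (simp flip: sorted_list_of_multiset_mset)
  also have "\<dots> = sorted_list_of_multiset R @ [x]"
    using assms by (intro sorted_sort_id) (auto simp: sorted_append less_imp_le)
  finally show ?thesis .
qed

lemma sorted_list_of_multiset_add_min:
  fixes x :: "'a::linorder"
  assumes "\<And>y. y \<in># R \<Longrightarrow> x < y"
  shows "sorted_list_of_multiset (add_mset x R) = x # sorted_list_of_multiset R"
proof -
  have "sorted_list_of_multiset (add_mset x R) = sort (x # sorted_list_of_multiset R)"
    by (simp flip: sorted_list_of_multiset_mset)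
  also have "\<dots> = x # sorted_list_of_multiset R"
    using assms by (intro sorted_sort_id) (auto simp: less_imp_le)
  finally show ?thesis .
qed

text \<open>The sorted list of moduli is read from both ends: a strict maximum splits off its head,
  a strict minimum its last entry. At least two entries are needed for neighbours to exist.\<close>

lemma biproximal_matI:
  fixes A :: "real^'n^'n"
  assumes n: "2 \<le> CARD('n)"
    and top: "eigenvalues A = add_mset \<rho> R" "\<And>\<nu>. \<nu> \<in># R \<Longrightarrow> cmod \<nu> < cmod \<rho>"
    and bot: "eigenvalues A = add_mset \<sigma> Q" "\<And>\<nu>. \<nu> \<in># Q \<Longrightarrow> cmod \<sigma> < cmod \<nu>"
  shows "biproximal_mat A"
proof -
  let ?l = "eigenvalue_moduli A"
  let ?r = "rev (sorted_list_of_multiset (image_mset cmod R))"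
  let ?t = "rev (sorted_list_of_multiset (image_mset cmod Q))"
  have 1: "?l = cmod \<rho> # ?r"
    using top(2) by (subst eigenvalue_moduli_def, subst top(1), subst image_mset_add_mset,
      subst sorted_list_of_multiset_add_max) auto
  have 2: "?l = ?t @ [cmod \<sigma>]"
    using bot(2) by (subst eigenvalue_moduli_def, subst bot(1), subst image_mset_add_mset,
      subst sorted_list_of_multiset_add_min) auto
  have len: "length ?r = CARD('n) - 1" "length ?t = CARD('n) - 1"
    using arg_cong[OF 1, of length] arg_cong[OF 2, of length] by (simp_all add: length_eigenvalue_moduli)
  have "?r ! 0 \<in> set ?r"
    using len n by (intro nth_mem) simp
  then have "?r ! 0 < cmod \<rho>"
    using top(2) by auto
  moreover have "?l ! 1 = ?r ! 0" "?l ! 0 = cmod \<rho>"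
    unfolding 1 by simp_all
  moreover have "?t ! (CARD('n) - 2) \<in> set ?t"
    using len n by (intro nth_mem) simp
  then have "cmod \<sigma> < ?t ! (CARD('n) - 2)"
    using bot(2) by auto
  moreover have "?l ! (CARD('n) - 1) = cmod \<sigma>" "?l ! (CARD('n) - 2) = ?t ! (CARD('n) - 2)"
    unfolding 2 using len n by (simp_all add: nth_append)
  ultimately show ?thesis
    by (simp add: biproximal_mat_def Let_def numeral_2_eq_2)
qed

lemma eigenvalue_real:
  assumes "A *v x = k *\<^sub>R x" "x \<noteq> 0"
  shows "of_real k \<in># eigenvalues A"
proof -
  have "complex_mat A *v complex_vec x = of_real k *s complex_vec x"
    by (simp add: complex_mat_vec assms complex_vec_scaleR)
  then have "poly (charpoly (complex_mat A)) (of_real k) = 0"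
    unfolding charpoly_root_iff using assms(2) complex_vec_eq_0_iff by blast
  then show ?thesis
    using charpoly_nonzero[of "complex_mat A"] by (simp add: eigenvalues_def)
qed

text \<open>Eigenspaces for distinct eigenvalues are independent, so an eigenvector inside the sum
  of the top eigenspaces has a top eigenvalue. For the axis this yields the comparison of the
  eigenvalues at its two ends.\<close>

lemma top_eigenvector_eigenvalue:
  assumes x: "A *v x = k *\<^sub>R x" "x \<noteq> 0" and top: "x \<in> top_eigenvectors A"
  shows "of_real k \<in> top_eigenvalues A"
proof (rule ccontr)
  assume k: "of_real k \<notin> top_eigenvalues A"
  let ?M = "complex_mat A"
  have fin: "finite (top_eigenvalues A)"
  proof (rule finite_subset)
    show "top_eigenvalues A \<subseteq> set_mset (eigenvalues A)"
      by (auto simp: top_eigenvalues_def)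
  qed simp
  have "v = 0" if "F \<subseteq> top_eigenvalues A" "v \<in> vec.span (\<Union>\<mu>\<in>F. eigenspace ?M \<mu>)" "?M *v v = of_real k *s v" for F v
    using finite_subset[OF that(1) fin] that
  proof (induction F arbitrary: v rule: finite_induct)
    case empty
    then show ?case by simp
  next
    case (insert \<mu> F)
    \<comment> \<open>\<open>M - \<mu>\<close> kills the eigenspace of \<mu> and preserves the
      others, so it maps the span over \<open>insert \<mu> F\<close> into the span over
      \<open>F\<close>. On \<open>v\<close> it is multiplication by a nonzero scalar.\<close>
    let ?L = "\<lambda>v. ?M *v v - \<mu> *s v"
    have "?L w \<in> vec.span (\<Union>\<mu>\<in>F. eigenspace ?M \<mu>)" if "w \<in> vec.span (\<Union>\<mu>\<in>insert \<mu> F. eigenspace ?M \<mu>)" for w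
      using that
    proof (induction rule: vec.span_induct_alt)
      case base
      then show ?case by (simp add: vec.span_zero)
    next
      case (step c x y)
      have L: "?L (c *s x + y) = c *s ?L x + ?L y"
        unfolding matrix_vector_right_distrib vec.scale by (simp add: vec_eq_iff algebra_simps)
      have "?L x \<in> vec.span (\<Union>\<mu>\<in>F. eigenspace ?M \<mu>)"
      proof -
        from step obtain \<nu> where nu: "\<nu> \<in> insert \<mu> F" "?M *v x = \<nu> *s x"
          by (auto simp: eigenspace_def)
        show ?thesis
        proof (cases "\<nu> = \<mu>")
          case True
          then show ?thesis using nu by (simp add: vec.span_zero)
        next
          case False
          then have "x \<in> vec.span (\<Union>\<mu>\<in>F. eigenspace ?M \<mu>)"
            using nu by (intro vec.span_base) (auto simp: eigenspace_def)
          then show ?thesis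
            unfolding nu(2) by (intro vec.span_diff vec.span_scale)
        qed
      qed
      then show ?case
        unfolding L using step by (intro vec.span_add vec.span_scale)
    qed
    from this[OF insert.prems(2)] have "?L v \<in> vec.span (\<Union>\<mu>\<in>F. eigenspace ?M \<mu>)" .
    moreover have "?L v = (of_real k - \<mu>) *s v"
      unfolding insert.prems(3) by (simp add: vec_eq_iff algebra_simps)
    moreover have ne: "of_real k - \<mu> \<noteq> 0"
      using k insert.prems(1) by auto
    ultimately have "(inverse (of_real k - \<mu>)) *s ((of_real k - \<mu>) *s v) \<in> vec.span (\<Union>\<mu>\<in>F. eigenspace ?M \<mu>)"
      by (metis vec.span_scale)
    then have "v \<in> vec.span (\<Union>\<mu>\<in>F. eigenspace ?M \<mu>)"
      unfolding vector_smult_assoc left_inverse[OF ne] vector_smult_lid .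
    then show ?case
      using insert by blast
  qed
  from this[OF subset_refl, of "complex_vec x"] top x show False
    by (simp add: top_eigenvectors_def complex_mat_vec complex_vec_scaleR complex_vec_eq_0_iff)
qed

section \<open>The cone over a properly convex domain\<close>

lemma proj_pt_scaleR: "v \<noteq> 0 \<Longrightarrow> c \<noteq> 0 \<Longrightarrow> proj_pt (c *\<^sub>R v) = proj_pt v"
  using proj_pt_eq_iff[of v "c *\<^sub>R v"] by (auto simp: proj_rel_def)

lemma proj_pt_eqD: "proj_pt v = proj_pt w \<Longrightarrow> v \<noteq> 0 \<Longrightarrow> w \<noteq> 0 \<Longrightarrow> \<exists>c. c \<noteq> 0 \<and> w = c *\<^sub>R v"
  using proj_pt_eq_iff[of v w] by (auto simp: proj_rel_def)

lemma proj_rep_nonzero: "proj_rep p \<noteq> 0"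
  using Quotient3_rep_reflp[OF Quotient3_proj_space, of p] by (simp add: proj_rel_refl)

lemma proj_pt_rep: "proj_pt (proj_rep p) = p"
  by (rule Quotient3_abs_rep[OF Quotient3_proj_space])

lemma ex_proj_pt: "\<exists>v. v \<noteq> 0 \<and> p = proj_pt v"
  using proj_rep_nonzero proj_pt_rep by metis

lemma proj_pt_in_projectivization:
  assumes W: "\<And>c w. w \<in> W \<Longrightarrow> c *\<^sub>R w \<in> W" and v: "v \<noteq> 0"
  shows "proj_pt v \<in> projectivization W \<longleftrightarrow> v \<in> W"
proof
  assume "proj_pt v \<in> projectivization W"
  then obtain w where w: "w \<in> W" "w \<noteq> 0" "proj_pt w = proj_pt v"
    by (auto simp: projectivization_def)
  then show "v \<in> W"
    using proj_pt_eqD[OF w(3) w(2) v] W by auto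
qed (use v in \<open>auto simp: projectivization_def\<close>)

lemma proj_pt_in_affine_chart: "v \<noteq> 0 \<Longrightarrow> proj_pt v \<in> affine_chart u \<longleftrightarrow> u \<bullet> v \<noteq> 0"
proof
  assume v: "v \<noteq> 0" and "proj_pt v \<in> affine_chart u"
  then obtain w where w: "u \<bullet> w \<noteq> 0" "w \<noteq> 0" "proj_pt w = proj_pt v"
    by (auto simp: affine_chart_def projectivization_def)
  then show "u \<bullet> v \<noteq> 0"
    using proj_pt_eqD[OF w(3) w(2) v] by auto
qed (auto simp: affine_chart_def projectivization_def)

lemma affine_coord_proj_pt: "v \<noteq> 0 \<Longrightarrow> affine_coord u (proj_pt v) = v /\<^sub>R (u \<bullet> v)"
  by (rule affine_coord.abs_eq) (simp add: proj_rel_refl)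

lemma pgl_act_proj_pt: "invertible A \<Longrightarrow> v \<noteq> 0 \<Longrightarrow> pgl_act (pgl_of A) (proj_pt v) = proj_pt (A *v v)"
  by (rule pgl_act.abs_eq) (auto simp: proj_rel_refl pgl_rel_def intro: exI[of _ 1])

lemma ex_pgl_of: "\<exists>A. invertible A \<and> \<gamma> = pgl_of A"
proof (intro exI[of _ "pgl_rep \<gamma>"] conjI)
  show "invertible (pgl_rep \<gamma>)"
    using Quotient3_rep_reflp[OF Quotient3_pgl, of \<gamma>] by (simp add: pgl_rel_def)
  show "\<gamma> = pgl_of (pgl_rep \<gamma>)"
    by (rule Quotient3_abs_rep[OF Quotient3_pgl, symmetric])
qed

lemma pgl_of_uminus: "invertible A \<Longrightarrow> pgl_of (- A) = pgl_of A"
  using Quotient3_rel[OF Quotient3_pgl, of A "- A"] invertible_scaleR[of A "-1"]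
  by (auto simp: pgl_rel_def intro: exI[of _ "-1"] exI[of _ 1])

lemma top_eigenvectors_scale: "x \<in> top_eigenvectors A \<Longrightarrow> c *\<^sub>R x \<in> top_eigenvectors A"
  by (simp add: top_eigenvectors_def complex_vec_scaleR vec.span_scale)

lemma frontier_open: "open S \<Longrightarrow> frontier S = closure S - S" for S :: "'a::topological_space set"
  by (simp add: frontier_def interior_open)

text \<open>The assumption \<open>coord\<close> fixes \<open>u\<close> to be a chart that computes
  \<open>coord \<Omega>\<close>, so segments and the metric can be calculated in \<phi>.\<close>

locale domain_chart =
  fixes \<Omega> :: "'n::finite proj_space set" and u :: "real^'n"
  assumes open_dom: "open \<Omega>" and dom_nonempty: "\<Omega> \<noteq> {}"
    and chart: "closure \<Omega> \<subseteq> affine_chart u"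
    and convex_chart: "convex (affine_coord u ` \<Omega>)"
    and coord: "coord \<Omega> = affine_coord u"
begin

abbreviation \<phi> :: "'n proj_space \<Rightarrow> real^'n" where "\<phi> \<equiv> affine_coord u"

text \<open>One of the two opposite halves of the preimage of the domain; its slice at height
  \<open>u = 1\<close> is the domain seen in the chart.\<close>

definition C :: "(real^'n) set" where "C = {v. 0 < u \<bullet> v \<and> proj_pt v \<in> \<Omega>}"

definition D :: "(real^'n) set" where "D = closure C"

lemma C_pos: "v \<in> C \<Longrightarrow> 0 < u \<bullet> v" and C_nonzero: "v \<in> C \<Longrightarrow> v \<noteq> 0"
  by (auto simp: C_def)

lemma coord_closure:
  assumes "p \<in> closure \<Omega>"
  shows "u \<bullet> \<phi> p = 1" "proj_pt (\<phi> p) = p" "\<phi> p \<noteq> 0"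
proof -
  obtain v where v: "v \<noteq> 0" "p = proj_pt v"
    using ex_proj_pt by blast
  then have uv: "u \<bullet> v \<noteq> 0"
    using assms chart proj_pt_in_affine_chart by blast
  have phi: "\<phi> p = inverse (u \<bullet> v) *\<^sub>R v"
    by (simp add: v affine_coord_proj_pt)
  show "u \<bullet> \<phi> p = 1"
    using uv by (simp add: phi)
  then show "\<phi> p \<noteq> 0" by auto
  show "proj_pt (\<phi> p) = p"
    unfolding phi using uv v by (simp add: proj_pt_scaleR)
qed

lemma coord_eq_iff: "p \<in> closure \<Omega> \<Longrightarrow> r \<in> closure \<Omega> \<Longrightarrow> \<phi> p = \<phi> r \<longleftrightarrow> p = r"
  by (metis coord_closure(2))

lemma open_C: "open C"
proof -
  have "C = {v. 0 < u \<bullet> v} \<inter> {v. v \<noteq> 0 \<and> proj_pt v \<in> \<Omega>}"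
    by (auto simp: C_def)
  moreover have "open {v. v \<noteq> 0 \<and> proj_pt v \<in> \<Omega>}"
    using open_dom by (simp add: open_proj_space_def)
  ultimately show ?thesis
    by (auto intro!: open_Int open_Collect_less continuous_intros)
qed

lemma scale_C: "v \<in> C \<Longrightarrow> 0 < c \<Longrightarrow> c *\<^sub>R v \<in> C"
  using C_nonzero[of v] by (simp add: C_def proj_pt_scaleR)

text \<open>Rescale both vectors to height 1 and combine them with weights proportional to their
  heights; the result is a positive multiple of \<open>v + w\<close>.\<close>

lemma add_C:
  assumes "v \<in> C" "w \<in> C"
  shows "v + w \<in> C"
proof -
  have pos: "0 < u \<bullet> v" "0 < u \<bullet> w" "v \<noteq> 0" "w \<noteq> 0"
    using assms C_pos C_nonzero by auto
  let ?s = "u \<bullet> v + u \<bullet> w"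
  have "v /\<^sub>R (u \<bullet> v) \<in> \<phi> ` \<Omega>" "w /\<^sub>R (u \<bullet> w) \<in> \<phi> ` \<Omega>"
    using assms pos by (auto simp: C_def affine_coord_proj_pt[symmetric])
  then have "(u \<bullet> v / ?s) *\<^sub>R (v /\<^sub>R (u \<bullet> v)) + (u \<bullet> w / ?s) *\<^sub>R (w /\<^sub>R (u \<bullet> w)) \<in> \<phi> ` \<Omega>"
    using pos by (intro convexD[OF convex_chart]) (auto simp: add_divide_distrib[symmetric])
  moreover have "(u \<bullet> v / ?s) *\<^sub>R (v /\<^sub>R (u \<bullet> v)) + (u \<bullet> w / ?s) *\<^sub>R (w /\<^sub>R (u \<bullet> w)) = (1 / ?s) *\<^sub>R (v + w)"
    using pos by (simp add: scaleR_add_right field_simps)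
  ultimately obtain p where p: "p \<in> \<Omega>" "(1 / ?s) *\<^sub>R (v + w) = \<phi> p"
    by auto
  have "p \<in> closure \<Omega>"
    using p(1) closure_subset by blast
  have "v + w \<noteq> 0"
    using pos by (metis add_pos_pos inner_add_right inner_zero_right less_irrefl)
  then have "proj_pt (v + w) = proj_pt (\<phi> p)"
    unfolding p(2)[symmetric] using pos by (intro proj_pt_scaleR[symmetric]) auto
  then show ?thesis
    using coord_closure(2)[OF \<open>p \<in> closure \<Omega>\<close>] p(1) pos by (simp add: C_def inner_add_right)
qed

lemma convex_C: "convex C"
proof (rule convexI)
  fix x y and s t :: real
  assume xy: "x \<in> C" "y \<in> C" and st: "0 \<le> s" "0 \<le> t" "s + t = 1"
  then consider "s = 0" "t = 1" | "s = 1" "t = 0" | "0 < s" "0 < t"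
    by linarith
  then show "s *\<^sub>R x + t *\<^sub>R y \<in> C"
    using xy by cases (auto intro: add_C scale_C)
qed

lemma C_nonempty: "C \<noteq> {}"
proof -
  obtain p where p: "p \<in> \<Omega>" using dom_nonempty by blast
  then have "p \<in> closure \<Omega>" using closure_subset by blast
  then have "\<phi> p \<in> C"
    using p coord_closure by (simp add: C_def)
  then show ?thesis by blast
qed

lemma closed_D: "closed D"
  by (simp add: D_def)

lemma C_subset_D: "C \<subseteq> D"
  by (simp add: D_def closure_subset)

text \<open>An open convex set is the interior of its closure. This translates the interior
  conditions of the abstract cone into membership in the domain.\<close>

lemma interior_D: "interior D = C"
  unfolding D_def using convex_interior_closure[OF convex_C] open_C by (simp add: interior_open)

lemma zero_D: "0 \<in> D"
proof -
  obtain v where v: "v \<in> C" using C_nonempty by blast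
  have "(\<lambda>n. inverse (real (Suc n)) *\<^sub>R v) \<longlonglongrightarrow> 0 *\<^sub>R v"
    by (intro tendsto_intros LIMSEQ_inverse_real_of_nat)
  moreover have "inverse (real (Suc n)) *\<^sub>R v \<in> C" for n
    using v by (intro scale_C) auto
  ultimately show ?thesis
    unfolding D_def closure_sequential by (intro exI[of _ "\<lambda>n. inverse (real (Suc n)) *\<^sub>R v"]) auto
qed

lemma scale_D: "v \<in> D \<Longrightarrow> 0 \<le> c \<Longrightarrow> c *\<^sub>R v \<in> D"
proof (cases "c = 0")
  case False
  assume "v \<in> D" "0 \<le> c"
  then obtain x where x: "\<And>n. x n \<in> C" "x \<longlonglongrightarrow> v"
    unfolding D_def closure_sequential by blast
  then have "(\<lambda>n. c *\<^sub>R x n) \<longlonglongrightarrow> c *\<^sub>R v"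
    by (intro tendsto_intros)
  moreover have "c *\<^sub>R x n \<in> C" for n
    using x False \<open>0 \<le> c\<close> by (intro scale_C) auto
  ultimately show ?thesis
    unfolding D_def closure_sequential by (intro exI[of _ "\<lambda>n. c *\<^sub>R x n"]) auto
qed (simp add: zero_D)

lemma add_D: "v \<in> D \<Longrightarrow> w \<in> D \<Longrightarrow> v + w \<in> D"
proof -
  assume "v \<in> D" "w \<in> D"
  then obtain x y where x: "\<And>n. x n \<in> C" "x \<longlonglongrightarrow> v" and y: "\<And>n. y n \<in> C" "y \<longlonglongrightarrow> w"
    unfolding D_def closure_sequential by blast
  then have "(\<lambda>n. x n + y n) \<longlonglongrightarrow> v + w"
    by (intro tendsto_intros)
  moreover have "x n + y n \<in> C" for n
    using x y by (intro add_C) auto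
  ultimately show ?thesis
    unfolding D_def closure_sequential by (intro exI[of _ "\<lambda>n. x n + y n"]) auto
qed

text \<open>Matches the closure upstairs with the closure in the quotient topology. One direction
  pulls back an open set; the other shows that an open set upstairs has open image. Strict
  positivity comes from the chart containing the whole closure.\<close>

lemma mem_D_iff:
  assumes v: "v \<noteq> 0"
  shows "v \<in> D \<longleftrightarrow> 0 < u \<bullet> v \<and> proj_pt v \<in> closure \<Omega>"
proof
  assume vD: "v \<in> D"
  have "proj_pt v \<in> closure \<Omega>"
  proof (rule ccontr)
    let ?U = "{w. w \<noteq> 0 \<and> proj_pt w \<in> - closure \<Omega>}"
    assume "proj_pt v \<notin> closure \<Omega>"
    then have "v \<in> ?U" using v by simp
    moreover have "open ?U"
      unfolding open_proj_space_def[symmetric] by (intro open_Compl closed_closure)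
    ultimately have "?U \<inter> C \<noteq> {}"
      using vD open_Int_closure_eq_empty[of ?U C] unfolding D_def by blast
    then show False
      using closure_subset[of \<Omega>] by (auto simp: C_def)
  qed
  moreover from this have "u \<bullet> v \<noteq> 0"
    using chart proj_pt_in_affine_chart[OF v] by blast
  moreover have "D \<subseteq> {v. 0 \<le> u \<bullet> v}"
    unfolding D_def
    by (rule closure_minimal) (auto dest: C_pos less_imp_le intro!: closed_Collect_le continuous_intros)
  then have "0 \<le> u \<bullet> v"
    using vD by auto
  ultimately show "0 < u \<bullet> v \<and> proj_pt v \<in> closure \<Omega>"
    by simp
next
  assume R: "0 < u \<bullet> v \<and> proj_pt v \<in> closure \<Omega>"
  show "v \<in> D"
  proof (rule ccontr)
    assume "v \<notin> D"
    \<comment> \<open>If \<open>v\<close> were outside \<open>D\<close>, this would be an open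
      neighbourhood. The preimage of its image is the union of its nonzero multiples, hence open, so
      the image meets the domain; but a positive lift of a point of the domain lies in
      \<open>C\<close>.\<close>
    define U where "U = {v. 0 < u \<bullet> v} - D"
    have U: "open U" "v \<in> U" "0 \<notin> U"
      using R \<open>v \<notin> D\<close> closed_D by (auto simp: U_def intro!: open_Diff open_Collect_less continuous_intros)
    define W where "W = proj_pt ` U"
    have "{w. w \<noteq> 0 \<and> proj_pt w \<in> W} = (\<Union>c\<in>-{0}. (*\<^sub>R) c ` U)"
    proof (rule set_eqI, rule iffI)
      fix w assume "w \<in> {w. w \<noteq> 0 \<and> proj_pt w \<in> W}"
      then obtain x where x: "w \<noteq> 0" "x \<in> U" "proj_pt x = proj_pt w"
        by (auto simp: W_def)
      then obtain c where "c \<noteq> 0" "w = c *\<^sub>R x"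
        using proj_pt_eqD[OF x(3)] U(3) by metis
      then show "w \<in> (\<Union>c\<in>-{0}. (*\<^sub>R) c ` U)" using x by blast
    next
      fix w assume "w \<in> (\<Union>c\<in>-{0}. (*\<^sub>R) c ` U)"
      then obtain c x where x: "c \<noteq> 0" "x \<in> U" "w = c *\<^sub>R x" by blast
      then have "x \<noteq> 0" using U by auto
      with x show "w \<in> {w. w \<noteq> 0 \<and> proj_pt w \<in> W}"
        by (auto simp: W_def proj_pt_scaleR)
    qed
    moreover have "open (\<Union>c\<in>-{0}. (*\<^sub>R) c ` U)"
      using U by (auto intro!: open_UN open_scaling)
    ultimately have "open W"
      by (simp add: open_proj_space_def)
    moreover have "proj_pt v \<in> W"
      using U by (simp add: W_def)
    ultimately have "W \<inter> \<Omega> \<noteq> {}"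
      using R open_Int_closure_eq_empty[of W \<Omega>] by blast
    then obtain x where "x \<in> U" "proj_pt x \<in> \<Omega>"
      by (auto simp: W_def)
    then show False
      using C_subset_D by (auto simp: U_def C_def)
  qed
qed

lemma D_pos: "v \<in> D \<Longrightarrow> v \<noteq> 0 \<Longrightarrow> 0 < u \<bullet> v"
  by (simp add: mem_D_iff)

lemma coord_D: "p \<in> closure \<Omega> \<Longrightarrow> \<phi> p \<in> D"
  by (simp add: mem_D_iff coord_closure)

lemma coord_C_iff: "p \<in> closure \<Omega> \<Longrightarrow> \<phi> p \<in> C \<longleftrightarrow> p \<in> \<Omega>"
  by (simp add: C_def coord_closure)

lemma proj_pt_closure: "v \<in> D \<Longrightarrow> v \<noteq> 0 \<Longrightarrow> proj_pt v \<in> closure \<Omega>"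
  by (simp add: mem_D_iff)

lemma coord_proj_pt: "v \<in> D \<Longrightarrow> v \<noteq> 0 \<Longrightarrow> \<phi> (proj_pt v) = (1 / (u \<bullet> v)) *\<^sub>R v"
  by (simp add: affine_coord_proj_pt divide_inverse)

lemma proj_pt_dom_iff: "v \<in> D \<Longrightarrow> v \<noteq> 0 \<Longrightarrow> proj_pt v \<in> \<Omega> \<longleftrightarrow> v \<in> C"
  by (simp add: mem_D_iff C_def)

lemma add_CD: "x \<in> C \<Longrightarrow> y \<in> D \<Longrightarrow> x + y \<in> C"
proof -
  assume x: "x \<in> C" and y: "y \<in> D"
  have "(\<lambda>z. y + z) ` C \<subseteq> interior D"
    by (intro interior_maximal open_translation open_C) (use C_subset_D y in \<open>auto intro: add_D\<close>)
  then show ?thesis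
    using x by (auto simp: add.commute interior_D)
qed

text \<open>Split off the largest common multiple of \<open>x + y\<close>; the remainder lies in
  \<open>D\<close> and cannot leave the open cone. So interiority of a sum depends only on the two
  rays.\<close>

lemma pos_comb_C:
  assumes "x \<in> D" "y \<in> D" "x + y \<in> C" "0 < s" "0 < t"
  shows "s *\<^sub>R x + t *\<^sub>R y \<in> C"
proof -
  define m where "m = min s t"
  have m: "0 < m" "m \<le> s" "m \<le> t" using assms by (auto simp: m_def)
  have "m *\<^sub>R (x + y) + ((s - m) *\<^sub>R x + (t - m) *\<^sub>R y) \<in> C"
    using m by (intro add_CD[OF scale_C[OF assms(3)]] add_D scale_D assms(1,2)) auto
  then show ?thesis by (simp add: algebra_simps)
qed

lemma pos_comb_C_conv:
  assumes "x \<in> D" "y \<in> D" "s *\<^sub>R x + t *\<^sub>R y \<in> C" "0 \<le> s" "0 \<le> t"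
  shows "x + y \<in> C"
proof -
  \<comment> \<open>The extra 1 keeps \<open>m\<close> positive, so that division by it is
    allowed.\<close>
  define m where "m = max 1 (max s t)"
  have m: "0 < m" "s \<le> m" "t \<le> m" by (auto simp: m_def)
  have "(1 / m) *\<^sub>R ((s *\<^sub>R x + t *\<^sub>R y) + ((m - s) *\<^sub>R x + (m - t) *\<^sub>R y)) \<in> C"
    using m by (intro scale_C add_CD[OF assms(3)] add_D scale_D assms(1,2)) auto
  also have "(s *\<^sub>R x + t *\<^sub>R y) + ((m - s) *\<^sub>R x + (m - t) *\<^sub>R y) = m *\<^sub>R (x + y)"
    by (simp add: algebra_simps)
  finally show ?thesis using m by simp
qed

lemma proj_segment_iff: "r \<in> proj_segment \<Omega> p p' \<longleftrightarrow> r \<in> closure \<Omega> \<and> \<phi> r \<in> closed_segment (\<phi> p) (\<phi> p')"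
  by (simp add: proj_segment_def coord)

lemma open_proj_segment_iff:
  assumes "p \<in> closure \<Omega>" "p' \<in> closure \<Omega>"
  shows "r \<in> open_proj_segment \<Omega> p p' \<longleftrightarrow> r \<in> closure \<Omega> \<and> \<phi> r \<in> open_segment (\<phi> p) (\<phi> p')"
proof (cases "r \<in> closure \<Omega>")
  case True
  then show ?thesis
    using coord_eq_iff[OF True assms(1)] coord_eq_iff[OF True assms(2)]
    by (simp add: open_proj_segment_def proj_segment_iff open_segment_def)
qed (simp add: open_proj_segment_def proj_segment_iff)

lemma closed_segment_coord:
  assumes "p \<in> closure \<Omega>" "p' \<in> closure \<Omega>" "v \<in> closed_segment (\<phi> p) (\<phi> p')"
  shows "v \<in> D \<and> u \<bullet> v = 1 \<and> proj_pt v \<in> closure \<Omega> \<and> \<phi> (proj_pt v) = v"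
proof -
  obtain t where t: "v = (1 - t) *\<^sub>R \<phi> p + t *\<^sub>R \<phi> p'" "0 \<le> t" "t \<le> 1"
    using assms(3) by (auto simp: in_segment)
  have vD: "v \<in> D"
    unfolding t(1) using t(2,3) by (intro add_D scale_D coord_D assms(1,2)) auto
  have uv: "u \<bullet> v = 1"
    by (simp add: t(1) inner_add_right coord_closure assms)
  then have "v \<noteq> 0" by auto
  then show ?thesis
    using vD uv proj_pt_closure coord_proj_pt by simp
qed

lemma proj_segment_image:
  assumes "p \<in> closure \<Omega>" "p' \<in> closure \<Omega>"
  shows "\<phi> ` proj_segment \<Omega> p p' = closed_segment (\<phi> p) (\<phi> p')"
proof (rule set_eqI, rule iffI)
  fix v assume "v \<in> closed_segment (\<phi> p) (\<phi> p')"
  from closed_segment_coord[OF assms this] this show "v \<in> \<phi> ` proj_segment \<Omega> p p'"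
    by (auto simp: proj_segment_iff image_iff intro!: bexI[of _ "proj_pt v"])
qed (auto simp: proj_segment_iff)

lemma open_proj_segment_image:
  assumes "p \<in> closure \<Omega>" "p' \<in> closure \<Omega>"
  shows "\<phi> ` open_proj_segment \<Omega> p p' = open_segment (\<phi> p) (\<phi> p')"
proof (rule set_eqI, rule iffI)
  fix v assume v: "v \<in> open_segment (\<phi> p) (\<phi> p')"
  then have "v \<in> closed_segment (\<phi> p) (\<phi> p')"
    by (simp add: open_segment_def)
  from closed_segment_coord[OF assms this] v show "v \<in> \<phi> ` open_proj_segment \<Omega> p p'"
    by (auto simp: open_proj_segment_iff[OF assms] image_iff intro!: bexI[of _ "proj_pt v"])
qed (auto simp: open_proj_segment_iff[OF assms])

text \<open>The midpoint decides for the whole open segment. Distinctness matters, since for equal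
  endpoints the segment is empty.\<close>

lemma open_proj_segment_subset_iff:
  assumes p: "p \<in> closure \<Omega>" "p' \<in> closure \<Omega>" "p \<noteq> p'"
  shows "open_proj_segment \<Omega> p p' \<subseteq> \<Omega> \<longleftrightarrow> \<phi> p + \<phi> p' \<in> C"
proof
  assume sub: "open_proj_segment \<Omega> p p' \<subseteq> \<Omega>"
  have "midpoint (\<phi> p) (\<phi> p') \<in> open_segment (\<phi> p) (\<phi> p')"
    using p coord_eq_iff by simp
  then obtain r where r: "r \<in> open_proj_segment \<Omega> p p'" "\<phi> r = midpoint (\<phi> p) (\<phi> p')"
    unfolding open_proj_segment_image[OF p(1,2), symmetric] by auto
  then have "r \<in> \<Omega>" using sub by blast
  then have "\<phi> r \<in> C"
    using coord_C_iff closure_subset by blast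
  then have "2 *\<^sub>R \<phi> r \<in> C" by (intro scale_C) auto
  then show "\<phi> p + \<phi> p' \<in> C"
    by (simp add: r(2) midpoint_def)
next
  assume C: "\<phi> p + \<phi> p' \<in> C"
  show "open_proj_segment \<Omega> p p' \<subseteq> \<Omega>"
  proof
    fix r assume "r \<in> open_proj_segment \<Omega> p p'"
    then obtain t where t: "r \<in> closure \<Omega>" "\<phi> r = (1 - t) *\<^sub>R \<phi> p + t *\<^sub>R \<phi> p'" "0 < t" "t < 1"
      using open_proj_segment_iff[OF p(1,2)] by (auto simp: in_segment)
    then have "\<phi> r \<in> C"
      using p C by (auto intro: pos_comb_C coord_D)
    then show "r \<in> \<Omega>" using t coord_C_iff by blast
  qed
qed

lemma proj_segment_frontier_iff:
  assumes p: "p \<in> closure \<Omega>" "p' \<in> closure \<Omega>"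
  shows "proj_segment \<Omega> p p' \<subseteq> frontier \<Omega> \<longleftrightarrow> \<phi> p + \<phi> p' \<notin> C"
proof
  assume sub: "proj_segment \<Omega> p p' \<subseteq> frontier \<Omega>"
  show "\<phi> p + \<phi> p' \<notin> C"
  proof
    assume C: "\<phi> p + \<phi> p' \<in> C"
    have "midpoint (\<phi> p) (\<phi> p') \<in> closed_segment (\<phi> p) (\<phi> p')" by simp
    then obtain r where r: "r \<in> proj_segment \<Omega> p p'" "\<phi> r = midpoint (\<phi> p) (\<phi> p')"
      unfolding proj_segment_image[OF p(1,2), symmetric] by auto
    then have "\<phi> r \<in> C"
      using scale_C[OF C, of "1/2"] by (simp add: midpoint_def)
    moreover have "r \<in> closure \<Omega> - \<Omega>"
      using r sub frontier_open[OF open_dom] by auto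
    ultimately show False using coord_C_iff by blast
  qed
next
  assume nC: "\<phi> p + \<phi> p' \<notin> C"
  show "proj_segment \<Omega> p p' \<subseteq> frontier \<Omega>"
  proof
    fix r assume "r \<in> proj_segment \<Omega> p p'"
    then obtain t where t: "r \<in> closure \<Omega>" "\<phi> r = (1 - t) *\<^sub>R \<phi> p + t *\<^sub>R \<phi> p'" "0 \<le> t" "t \<le> 1"
      by (auto simp: in_segment proj_segment_iff)
    then have "\<phi> r \<notin> C"
      using nC pos_comb_C_conv[OF coord_D coord_D, OF p, of "1 - t" t] by auto
    then show "r \<in> frontier \<Omega>"
      using t(1) coord_C_iff[OF t(1)] frontier_open[OF open_dom] by blast
  qed
qed

end
section \<open>The Hilbert metric and axes\<close>

lemma closed_segment_on_line:
  fixes x z :: "'a::real_vector"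
  assumes "t0 \<le> t1"
  shows "w \<in> closed_segment (x + t0 *\<^sub>R z) (x + t1 *\<^sub>R z) \<longleftrightarrow> (\<exists>t. t0 \<le> t \<and> t \<le> t1 \<and> w = x + t *\<^sub>R z)"
proof
  assume "w \<in> closed_segment (x + t0 *\<^sub>R z) (x + t1 *\<^sub>R z)"
  then obtain s where s: "0 \<le> s" "s \<le> 1" "w = (1 - s) *\<^sub>R (x + t0 *\<^sub>R z) + s *\<^sub>R (x + t1 *\<^sub>R z)"
    by (auto simp: in_segment)
  then have "w = x + (t0 + s * (t1 - t0)) *\<^sub>R z"
    by (simp add: algebra_simps)
  moreover have "0 \<le> s * (t1 - t0)" "s * (t1 - t0) \<le> 1 * (t1 - t0)"
    using s assms by (simp, intro mult_right_mono) auto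
  ultimately show "\<exists>t. t0 \<le> t \<and> t \<le> t1 \<and> w = x + t *\<^sub>R z"
    by (intro exI[of _ "t0 + s * (t1 - t0)"]) auto
next
  assume "\<exists>t. t0 \<le> t \<and> t \<le> t1 \<and> w = x + t *\<^sub>R z"
  then obtain t where t: "t0 \<le> t" "t \<le> t1" "w = x + t *\<^sub>R z" by blast
  show "w \<in> closed_segment (x + t0 *\<^sub>R z) (x + t1 *\<^sub>R z)"
  proof (cases "t0 = t1")
    case False
    define s where "s = (t - t0) / (t1 - t0)"
    have s: "0 \<le> s" "s \<le> 1" "t = t0 + s * (t1 - t0)"
      using t False assms by (auto simp: s_def)
    then have "w = (1 - s) *\<^sub>R (x + t0 *\<^sub>R z) + s *\<^sub>R (x + t1 *\<^sub>R z)"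
      unfolding t(3) s(3) by (simp add: algebra_simps)
    then show ?thesis
      using s by (auto simp: in_segment)
  qed (use t in auto)
qed

context domain_chart
begin

lemma open_direction:
  assumes "v \<in> C"
  shows "\<exists>e>0. \<forall>t. \<bar>t\<bar> \<le> e \<longrightarrow> v + t *\<^sub>R w \<in> C"
proof -
  have "open ((\<lambda>t. v + t *\<^sub>R w) -` C)"
    using open_C by (intro continuous_open_vimage) (auto intro!: continuous_intros)
  moreover have "0 \<in> (\<lambda>t. v + t *\<^sub>R w) -` C"
    using assms by simp
  ultimately obtain e where "e > 0" "cball 0 e \<subseteq> (\<lambda>t. v + t *\<^sub>R w) -` C"
    by (meson open_contains_cball)
  then show ?thesis
    by (intro exI[of _ e]) (auto simp: dist_norm)
qed

lemma proj_line_iff: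
  assumes p: "p \<in> closure \<Omega>" and x: "x \<in> closure \<Omega>" and y: "y \<in> closure \<Omega>"
  shows "p \<in> proj_line x y \<longleftrightarrow> (\<exists>t. \<phi> p = \<phi> x + t *\<^sub>R (\<phi> y - \<phi> x))"
proof -
  have "\<exists>c. c \<noteq> 0 \<and> proj_rep r = c *\<^sub>R \<phi> r" if "r \<in> closure \<Omega>" for r
    using proj_pt_eqD[of "\<phi> r" "proj_rep r"] coord_closure[OF that] proj_pt_rep proj_rep_nonzero by metis
  then obtain c d where c: "c \<noteq> 0" "proj_rep x = c *\<^sub>R \<phi> x" and d: "d \<noteq> 0" "proj_rep y = d *\<^sub>R \<phi> y"
    using x y by metis
  have "p \<in> proj_line x y \<longleftrightarrow> \<phi> p \<in> span {proj_rep x, proj_rep y}"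
    unfolding proj_line_def
    using proj_pt_in_projectivization[of "span {proj_rep x, proj_rep y}" "\<phi> p"] coord_closure[OF p] span_scale
    by metis
  also have "\<dots> \<longleftrightarrow> (\<exists>t. \<phi> p = \<phi> x + t *\<^sub>R (\<phi> y - \<phi> x))"
  proof
    assume "\<phi> p \<in> span {proj_rep x, proj_rep y}"
    then obtain k l where "\<phi> p - k *\<^sub>R proj_rep x = l *\<^sub>R proj_rep y"
      by (auto simp: span_breakdown_eq span_singleton)
    then have kl: "\<phi> p = (k * c) *\<^sub>R \<phi> x + (l * d) *\<^sub>R \<phi> y"
      using c d by (simp add: algebra_simps)
    \<comment> \<open>All three points have height 1, so the two coefficients must sum to 1.\<close>
    then have "u \<bullet> \<phi> p = (k * c) * (u \<bullet> \<phi> x) + (l * d) * (u \<bullet> \<phi> y)"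
      by (simp add: inner_add_right)
    then have kc: "k * c = 1 - l * d"
      using coord_closure p x y by simp
    have "\<phi> p = \<phi> x + (l * d) *\<^sub>R (\<phi> y - \<phi> x)"
      unfolding kl kc by (simp add: algebra_simps)
    then show "\<exists>t. \<phi> p = \<phi> x + t *\<^sub>R (\<phi> y - \<phi> x)" ..
  next
    assume "\<exists>t. \<phi> p = \<phi> x + t *\<^sub>R (\<phi> y - \<phi> x)"
    then obtain t where t: "\<phi> p = \<phi> x + t *\<^sub>R (\<phi> y - \<phi> x)" ..
    have "\<phi> x = (1 / c) *\<^sub>R proj_rep x" "\<phi> y = (1 / d) *\<^sub>R proj_rep y"
      using c d by simp_all
    then have "\<phi> x \<in> span {proj_rep x, proj_rep y}" "\<phi> y \<in> span {proj_rep x, proj_rep y}"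
      by (metis insertI1 insertI2 span_base span_scale)+
    then show "\<phi> p \<in> span {proj_rep x, proj_rep y}"
      unfolding t by (intro span_add span_scale span_diff)
  qed
  finally show ?thesis .
qed

text \<open>Evaluating the description in \<open>line_ends\<close> requires existence and
  uniqueness. With \<open>x\<close> at parameter 0 and \<open>y\<close> at 1, the line meets
  \<open>D\<close> in a compact set of parameters, whose extremes give the endpoints.\<close>

lemma line_ends_param:
  assumes x: "x \<in> \<Omega>" and y: "y \<in> \<Omega>" and xy: "x \<noteq> y"
  shows "\<exists>a b s t. line_ends \<Omega> x y = (a, b) \<and> s < 0 \<and> 1 < t \<and>
    \<phi> a = \<phi> x + s *\<^sub>R (\<phi> y - \<phi> x) \<and> \<phi> b = \<phi> x + t *\<^sub>R (\<phi> y - \<phi> x)"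
proof -
  define Z where "Z = \<phi> y - \<phi> x"
  have cl: "x \<in> closure \<Omega>" "y \<in> closure \<Omega>"
    using x y closure_subset by auto
  have uZ: "u \<bullet> Z = 0"
    using cl coord_closure by (simp add: Z_def inner_diff_right)
  have Z0: "Z \<noteq> 0"
    using coord_eq_iff[OF cl] xy by (simp add: Z_def)
  have XC: "\<phi> x \<in> C" "\<phi> y \<in> C"
    using x y cl coord_C_iff by auto
  have Y: "\<phi> y = \<phi> x + 1 *\<^sub>R Z" and X: "\<phi> x = \<phi> x + 0 *\<^sub>R Z"
    by (simp_all add: Z_def)
  have inj: "\<phi> x + s *\<^sub>R Z = \<phi> x + t *\<^sub>R Z \<longleftrightarrow> s = t" for s t
    using Z0 by simp
  have uline: "u \<bullet> (\<phi> x + t *\<^sub>R Z) = 1" for t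
    using coord_closure(1)[OF cl(1)] by (simp add: inner_add_right uZ)
  define I where "I = {t. \<phi> x + t *\<^sub>R Z \<in> D}"
  \<comment> \<open>\<open>u\<close> is positive on \<open>D\<close> away from 0, so the slice of
    \<open>D\<close> at height 1 is bounded, and with it the parameter set.\<close>
  obtain c where c: "c > 0" "\<And>v. v \<in> D \<Longrightarrow> c * norm v \<le> u \<bullet> v"
    using closed_cone_norm_bound[OF closed_D scale_D, of u] D_pos by blast
  have "I \<subseteq> cball 0 ((1 / c + norm (\<phi> x)) / norm Z)"
  proof
    fix t assume "t \<in> I"
    then have "c * norm (\<phi> x + t *\<^sub>R Z) \<le> 1"
      using c(2) uline by (fastforce simp: I_def)
    then have "norm (\<phi> x + t *\<^sub>R Z) \<le> 1 / c"
      using c(1) by (simp add: field_simps)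
    then have "norm (t *\<^sub>R Z) \<le> 1 / c + norm (\<phi> x)"
      using norm_triangle_ineq4[of "\<phi> x + t *\<^sub>R Z" "\<phi> x"] by simp
    then have "\<bar>t\<bar> \<le> (1 / c + norm (\<phi> x)) / norm Z"
      using Z0 by (simp add: pos_le_divide_eq)
    then show "t \<in> cball 0 ((1 / c + norm (\<phi> x)) / norm Z)"
      by (simp add: dist_norm)
  qed
  then have "bounded I"
    by (rule bounded_subset[OF bounded_cball])
  moreover have "closed I"
  proof -
    have "I = (\<lambda>t. \<phi> x + t *\<^sub>R Z) -` D"
      by (auto simp: I_def)
    then show ?thesis
      using closed_D by (auto intro!: continuous_closed_vimage continuous_intros)
  qed
  ultimately have comp: "compact I"
    by (simp add: compact_eq_bounded_closed)
  have I01: "0 \<in> I" "1 \<in> I"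
    unfolding I_def mem_Collect_eq Y[symmetric] X[symmetric] using XC C_subset_D by auto
  obtain t0 where t0: "t0 \<in> I" "\<And>s. s \<in> I \<Longrightarrow> t0 \<le> s"
    using compact_attains_inf[OF comp] I01 by blast
  obtain t1 where t1: "t1 \<in> I" "\<And>s. s \<in> I \<Longrightarrow> s \<le> t1"
    using compact_attains_sup[OF comp] I01 by blast
  \<comment> \<open>From a point of the open cone one can move both ways. Hence the extremes lie
    strictly beyond \<open>x\<close> and \<open>y\<close>, and on the frontier.\<close>
  have not_extreme: "\<exists>e>0. t - e \<in> I \<and> t + e \<in> I" if "\<phi> x + t *\<^sub>R Z \<in> C" for t
  proof -
    from open_direction[OF that] obtain e
      where e: "e > 0" "\<And>s. \<bar>s\<bar> \<le> e \<Longrightarrow> \<phi> x + t *\<^sub>R Z + s *\<^sub>R Z \<in> C"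
      by blast
    from e(2)[of e] e(2)[of "-e"] e(1) have "t - e \<in> I" "t + e \<in> I"
      using C_subset_D by (auto simp: I_def algebra_simps)
    then show ?thesis using e(1) by blast
  qed
  have t0_neg: "t0 < 0"
    using not_extreme[of 0] XC t0(2) by force
  have t1_pos: "1 < t1"
    using not_extreme[of 1] XC t1(2) Y by force
  have t0_C: "\<phi> x + t0 *\<^sub>R Z \<notin> C" and t1_C: "\<phi> x + t1 *\<^sub>R Z \<notin> C"
    using not_extreme t0(2) t1(2) by force+
  define a where "a = proj_pt (\<phi> x + t0 *\<^sub>R Z)"
  define b where "b = proj_pt (\<phi> x + t1 *\<^sub>R Z)"
  have pt: "proj_pt (\<phi> x + t *\<^sub>R Z) \<in> closure \<Omega>" "\<phi> (proj_pt (\<phi> x + t *\<^sub>R Z)) = \<phi> x + t *\<^sub>R Z"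
    if "t \<in> I" for t
  proof -
    have nz: "\<phi> x + t *\<^sub>R Z \<noteq> 0"
      using uline[of t] by auto
    have D: "\<phi> x + t *\<^sub>R Z \<in> D"
      using that by (simp add: I_def)
    show "proj_pt (\<phi> x + t *\<^sub>R Z) \<in> closure \<Omega>" "\<phi> (proj_pt (\<phi> x + t *\<^sub>R Z)) = \<phi> x + t *\<^sub>R Z"
      using proj_pt_closure[OF D nz] coord_proj_pt[OF D nz] uline[of t] by simp_all
  qed
  have a: "a \<in> closure \<Omega>" "\<phi> a = \<phi> x + t0 *\<^sub>R Z" and b: "b \<in> closure \<Omega>" "\<phi> b = \<phi> x + t1 *\<^sub>R Z"
    using pt[OF t0(1)] pt[OF t1(1)] by (simp_all add: a_def b_def)
  have afr: "a \<in> frontier \<Omega>" and bfr: "b \<in> frontier \<Omega>"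
    using a b t0_C t1_C coord_C_iff[OF a(1)] coord_C_iff[OF b(1)] by (simp_all add: frontier_open[OF open_dom])
  have line: "closure \<Omega> \<inter> proj_line x y = proj_segment \<Omega> a b"
  proof (rule set_eqI)
    fix p
    show "p \<in> closure \<Omega> \<inter> proj_line x y \<longleftrightarrow> p \<in> proj_segment \<Omega> a b"
    proof (cases "p \<in> closure \<Omega>")
      case True
      have "p \<in> proj_line x y \<longleftrightarrow> (\<exists>t. \<phi> p = \<phi> x + t *\<^sub>R Z)"
        using proj_line_iff[OF True cl] by (simp add: Z_def)
      also have "\<dots> \<longleftrightarrow> (\<exists>t. t0 \<le> t \<and> t \<le> t1 \<and> \<phi> p = \<phi> x + t *\<^sub>R Z)"
        using coord_D[OF True] t0(2) t1(2) unfolding I_def by (metis mem_Collect_eq)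
      also have "\<dots> \<longleftrightarrow> \<phi> p \<in> closed_segment (\<phi> a) (\<phi> b)"
        unfolding a b by (rule closed_segment_on_line[symmetric]) (use t0_neg t1_pos in simp)
      finally show ?thesis
        using True by (simp add: proj_segment_iff)
    qed (simp add: proj_segment_iff)
  qed
  have "\<phi> x \<in> closed_segment (\<phi> x + t0 *\<^sub>R Z) (\<phi> x + 1 *\<^sub>R Z)"
    by (subst closed_segment_on_line) (use t0_neg in \<open>auto intro: exI[of _ 0]\<close>)
  then have xs: "x \<in> proj_segment \<Omega> a y"
    using cl by (simp add: proj_segment_iff a Y)
  have "\<phi> y \<in> closed_segment (\<phi> x + 0 *\<^sub>R Z) (\<phi> x + t1 *\<^sub>R Z)"
    by (subst closed_segment_on_line) (use t1_pos Y in \<open>auto intro: exI[of _ 1]\<close>)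
  then have ys: "y \<in> proj_segment \<Omega> x b"
    using cl by (simp add: proj_segment_iff b)
  \<comment> \<open>A segment determines its endpoints up to order. The reversed order would put
    \<open>x\<close> between \<open>y\<close> and the far end, at parameter at least 1.\<close>
  have uniq: "(a', b') = (a, b)" if h: "a' \<in> frontier \<Omega>" "b' \<in> frontier \<Omega>"
      "closure \<Omega> \<inter> proj_line x y = proj_segment \<Omega> a' b'" "x \<in> proj_segment \<Omega> a' y" for a' b'
  proof -
    have cl': "a' \<in> closure \<Omega>" "b' \<in> closure \<Omega>"
      using h(1,2) by (simp_all add: frontier_def)
    have "\<phi> ` proj_segment \<Omega> a' b' = \<phi> ` proj_segment \<Omega> a b"
      using h(3) line by simp
    then have "closed_segment (\<phi> a') (\<phi> b') = closed_segment (\<phi> a) (\<phi> b)"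
      by (simp add: proj_segment_image cl' a(1) b(1))
    then have "{\<phi> a', \<phi> b'} = {\<phi> a, \<phi> b}"
      by (simp add: closed_segment_eq)
    then consider "a' = a" "b' = b" | "a' = b" "b' = a"
      using coord_eq_iff cl' a(1) b(1) by (metis doubleton_eq_iff)
    then show ?thesis
    proof cases
      case 2
      with h(4) have "\<phi> x \<in> closed_segment (\<phi> x + t1 *\<^sub>R Z) (\<phi> x + 1 *\<^sub>R Z)"
        unfolding Y[symmetric] by (simp add: proj_segment_iff b)
      then have "\<phi> x \<in> closed_segment (\<phi> x + 1 *\<^sub>R Z) (\<phi> x + t1 *\<^sub>R Z)"
        by (simp only: closed_segment_commute)
      then obtain t where "1 \<le> t" "\<phi> x = \<phi> x + t *\<^sub>R Z"
        using closed_segment_on_line[of 1 t1 "\<phi> x" "\<phi> x" Z] t1_pos less_imp_le by metis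
      then show ?thesis
        using Z0 by simp
    qed simp
  qed
  have "line_ends \<Omega> x y = (a, b)"
    unfolding line_ends_def
  proof (rule the_equality)
    show "case (a, b) of (a, b) \<Rightarrow> a \<in> frontier \<Omega> \<and> b \<in> frontier \<Omega> \<and>
     closure \<Omega> \<inter> proj_line x y = proj_segment \<Omega> a b \<and>
     x \<in> proj_segment \<Omega> a y \<and> y \<in> proj_segment \<Omega> x b"
      using afr bfr line xs ys by simp
  qed (use uniq in \<open>auto split: prod.splits\<close>)
  then show ?thesis
    using a b t0_neg t1_pos unfolding Z_def by blast
qed

lemma hilbert_dist_nonneg:
  assumes x: "x \<in> \<Omega>" and y: "y \<in> \<Omega>"
  shows "0 \<le> hilbert_dist \<Omega> x y"
proof (cases "x = y")
  case False
  define Z where "Z = \<phi> y - \<phi> x"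
  obtain a b s t where ends: "line_ends \<Omega> x y = (a, b)" "s < 0" "1 < t"
    and ab: "\<phi> a = \<phi> x + s *\<^sub>R Z" "\<phi> b = \<phi> x + t *\<^sub>R Z"
    using line_ends_param[OF x y False] unfolding Z_def by blast
  have "x \<in> closure \<Omega>" "y \<in> closure \<Omega>"
    using x y closure_subset by auto
  then have Z0: "0 < norm Z"
    using coord_eq_iff[of y x] False by (simp add: Z_def)
  have "\<phi> b - \<phi> x = t *\<^sub>R Z" "\<phi> y - \<phi> a = (1 - s) *\<^sub>R Z" "\<phi> b - \<phi> y = (t - 1) *\<^sub>R Z" "\<phi> x - \<phi> a = (- s) *\<^sub>R Z"
    unfolding ab by (simp_all add: Z_def algebra_simps)
  then have "norm (\<phi> b - \<phi> x) * norm (\<phi> y - \<phi> a) / (norm (\<phi> b - \<phi> y) * norm (\<phi> x - \<phi> a))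
      = (t * (1 - s)) / ((t - 1) * (- s))"
    using Z0 ends by simp
  moreover have "1 \<le> (t * (1 - s)) / ((t - 1) * (- s))"
  proof -
    have "0 < (t - 1) * (- s)"
      using ends by (intro mult_pos_pos) auto
    moreover have "(t - 1) * (- s) \<le> t * (1 - s)"
      using ends by (simp add: algebra_simps)
    ultimately show ?thesis
      by (simp only: le_divide_eq_1_pos)
  qed
  ultimately show ?thesis
    using False by (simp add: hilbert_dist_def ends coord ln_ge_zero)
qed (simp add: hilbert_dist_def)

text \<open>A fixed point contributes the value 0. Nonnegativity of the metric supplies the lower
  bound without which the real infimum would carry no information.\<close>

lemma translation_length_fixed_point:
  assumes "\<gamma> \<in> Aut \<Omega>" "p \<in> \<Omega>" "pgl_act \<gamma> p = p"
  shows "translation_length \<Omega> \<gamma> \<le> 0"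
proof -
  have "pgl_act \<gamma> x \<in> \<Omega>" if "x \<in> \<Omega>" for x
    using assms(1) that by (auto simp: Aut_def)
  then have "bdd_below ((\<lambda>x. hilbert_dist \<Omega> x (pgl_act \<gamma> x)) ` \<Omega>)"
    using hilbert_dist_nonneg by (intro bdd_belowI2[of _ 0]) auto
  from cINF_lower[OF this assms(2)] show ?thesis
    unfolding translation_length_def by (simp add: assms(3) hilbert_dist_def)
qed

end

section \<open>Boundary rays, segments and half triangles\<close>

context domain_chart
begin

text \<open>In the plane of \<open>X\<close> and \<open>Y\<close> the cone is exactly the quadrant
  they span, so its boundary vectors lie on one of the two rays.\<close>

lemma boundary_comb:
  assumes X: "X \<in> D" "X \<notin> C" and Y: "Y \<in> D" "Y \<notin> C" and XY: "X + Y \<in> C"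
    and w: "s *\<^sub>R X + t *\<^sub>R Y \<in> D" "s *\<^sub>R X + t *\<^sub>R Y \<notin> C" "s *\<^sub>R X + t *\<^sub>R Y \<noteq> 0"
  shows "(0 < s \<and> t = 0) \<or> (s = 0 \<and> 0 < t)"
proof -
  have X0: "X \<noteq> 0" and Y0: "Y \<noteq> 0"
    using XY X Y by auto
  have pos: "0 < u \<bullet> X" "0 < u \<bullet> Y" "0 < s * (u \<bullet> X) + t * (u \<bullet> Y)"
    using D_pos[OF X(1) X0] D_pos[OF Y(1) Y0] D_pos[OF w(1,3)] by (simp_all add: inner_add_right)
  \<comment> \<open>A negative coefficient is cancelled by adding a multiple of
    \<open>X' + Y'\<close>, which is interior; what remains would be an interior multiple of the
    boundary vector \<open>X'\<close>.\<close>
  have neg: False if "X' \<in> D" "X' \<notin> C" "X' + Y' \<in> C" "s' *\<^sub>R X' + t' *\<^sub>R Y' \<in> D" "t' < 0" "0 < s'" for X' Y' s' t'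
  proof -
    have "(1 / (s' - t')) *\<^sub>R ((- t') *\<^sub>R (X' + Y') + (s' *\<^sub>R X' + t' *\<^sub>R Y')) \<in> C"
      using that by (intro scale_C add_CD[OF scale_C[OF that(3)]] that(4)) auto
    also have "(- t') *\<^sub>R (X' + Y') + (s' *\<^sub>R X' + t' *\<^sub>R Y') = (s' - t') *\<^sub>R X'"
      by (simp add: algebra_simps)
    finally show False
      using that by simp
  qed
  have "\<not> (0 < s \<and> 0 < t)"
    using pos_comb_C[OF X(1) Y(1) XY] w(2) by blast
  moreover have "\<not> (0 < s \<and> t < 0)"
    using neg[OF X XY w(1)] by blast
  moreover have "\<not> (s < 0 \<and> 0 < t)"
    using neg[of Y X t s] Y XY w(1) by (auto simp: add.commute)
  moreover have "\<not> (s \<le> 0 \<and> t \<le> 0)"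
    using pos by (auto simp: not_less dest!: mult_nonpos_nonneg[of s "u \<bullet> X"] mult_nonpos_nonneg[of t "u \<bullet> Y"])
  ultimately show ?thesis by linarith
qed

lemma open_proj_segment_commute: "open_proj_segment \<Omega> x y = open_proj_segment \<Omega> y x"
  by (simp add: open_proj_segment_def proj_segment_def closed_segment_commute insert_commute)

lemma open_proj_segment_ends:
  assumes "x \<in> closure \<Omega>" "y \<in> closure \<Omega>" "x' \<in> closure \<Omega>" "y' \<in> closure \<Omega>"
    and "x \<noteq> y" "open_proj_segment \<Omega> x y = open_proj_segment \<Omega> x' y'"
  shows "x = x' \<and> y = y' \<or> x = y' \<and> y = x'"
proof -
  have "open_segment (\<phi> x) (\<phi> y) = open_segment (\<phi> x') (\<phi> y')"
    using assms open_proj_segment_image by metis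
  moreover have "\<phi> x \<noteq> \<phi> y"
    using assms coord_eq_iff by blast
  ultimately have "{\<phi> x, \<phi> y} = {\<phi> x', \<phi> y'}"
    unfolding open_segment_eq by blast
  then have "\<phi> x = \<phi> x' \<and> \<phi> y = \<phi> y' \<or> \<phi> x = \<phi> y' \<and> \<phi> y = \<phi> x'"
    by (simp add: doubleton_eq_iff)
  then show ?thesis
    using assms(1-4) coord_eq_iff by meson
qed

lemma half_triangleI:
  assumes "a \<in> frontier \<Omega>" "b \<in> frontier \<Omega>" "w \<in> frontier \<Omega>" "a \<noteq> b"
    and "\<phi> a + \<phi> b \<in> C" "\<phi> a + \<phi> w \<notin> C" "\<phi> b + \<phi> w \<notin> C"
  shows "in_half_triangle \<Omega> (open_proj_segment \<Omega> a b)"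
proof -
  have cl: "a \<in> closure \<Omega>" "b \<in> closure \<Omega>" "w \<in> closure \<Omega>"
    using assms by (simp_all add: frontier_def)
  have "open_proj_segment \<Omega> a b \<subseteq> \<Omega>"
    using open_proj_segment_subset_iff[OF cl(1,2)] assms by blast
  moreover have "proj_segment \<Omega> a w \<subseteq> frontier \<Omega>" "proj_segment \<Omega> w b \<subseteq> frontier \<Omega>"
    using proj_segment_frontier_iff cl assms by (simp_all add: add.commute)
  ultimately show ?thesis
    unfolding in_half_triangle_def using assms(1-3) by blast
qed

lemma half_triangleE:
  assumes cl: "a \<in> closure \<Omega>" "z \<in> closure \<Omega>" "a \<noteq> z" and tri: "in_half_triangle \<Omega> (open_proj_segment \<Omega> a z)"
  obtains w where "w \<in> frontier \<Omega>" "\<phi> a + \<phi> w \<notin> C" "\<phi> z + \<phi> w \<notin> C" "\<phi> a + \<phi> z \<in> C"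
proof -
  from tri obtain x y w where x: "x \<in> frontier \<Omega>" and y: "y \<in> frontier \<Omega>" and w: "w \<in> frontier \<Omega>"
    and seg: "open_proj_segment \<Omega> a z = open_proj_segment \<Omega> x y"
    and sub: "open_proj_segment \<Omega> a z \<subseteq> \<Omega>"
    and fr: "proj_segment \<Omega> x w \<subseteq> frontier \<Omega>" "proj_segment \<Omega> w y \<subseteq> frontier \<Omega>"
    unfolding in_half_triangle_def Un_subset_iff by (elim bexE conjE) (rule that, assumption+)
  have cl': "x \<in> closure \<Omega>" "y \<in> closure \<Omega>" "w \<in> closure \<Omega>"
    using x y w by (simp_all add: frontier_def)
  have nC: "\<phi> x + \<phi> w \<notin> C" "\<phi> y + \<phi> w \<notin> C"
    using proj_segment_frontier_iff fr cl' by (metis add.commute)+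
  have "a = x \<and> z = y \<or> a = y \<and> z = x"
    using open_proj_segment_ends[OF cl(1,2) cl'(1,2) cl(3) seg] .
  then have "\<phi> a + \<phi> w \<notin> C" "\<phi> z + \<phi> w \<notin> C"
    using nC by auto
  moreover have "\<phi> a + \<phi> z \<in> C"
    using open_proj_segment_subset_iff[OF cl] sub by blast
  ultimately show ?thesis
    using that w by blast
qed

end

section \<open>Lifts of automorphisms to the cone\<close>

locale domain_auto = domain_chart \<Omega> u
  for \<Omega> :: "'n::finite proj_space set" and u +
  fixes \<gamma> :: "'n pgl" and B B' :: "real^'n^'n"
  assumes BB': "\<And>x. B *v (B' *v x) = x" and B'B: "\<And>x. B' *v (B *v x) = x"
    and act: "\<And>v. v \<noteq> 0 \<Longrightarrow> pgl_act \<gamma> (proj_pt v) = proj_pt (B *v v)"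
    and B_C: "\<And>v. v \<in> C \<Longrightarrow> B *v v \<in> C" and B'_C: "\<And>v. v \<in> C \<Longrightarrow> B' *v v \<in> C"

text \<open>A lift maps \<open>C\<close> into the union of \<open>C\<close> and its negative. As
  \<open>u\<close> never vanishes on the image of the convex set \<open>C\<close>, its sign there is
  constant, and a change of sign of the matrix makes it positive.\<close>

lemma (in domain_chart) ex_cone_lift:
  assumes g: "\<gamma> \<in> Aut \<Omega>"
  shows "\<exists>B B'. \<gamma> = pgl_of B \<and> invertible B \<and> domain_auto \<Omega> u \<gamma> B B'"
proof -
  obtain A where A: "invertible A" "\<gamma> = pgl_of A"
    using ex_pgl_of by blast
  have img: "pgl_act \<gamma> ` \<Omega> = \<Omega>"
    using g by (simp add: Aut_def)
  have Av0: "A *v v \<noteq> 0" if "v \<noteq> 0" for v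
    using inj_matrix_vector_mult[OF A(1)] that by (metis injD matrix_vector_mult_0_right)
  have A_dom: "proj_pt (A *v v) \<in> \<Omega>" if "v \<in> C" for v
  proof -
    have "pgl_act \<gamma> (proj_pt v) \<in> \<Omega>"
      using that img by (auto simp: C_def)
    then show ?thesis
      using pgl_act_proj_pt[OF A(1) C_nonzero[OF that]] A(2) by simp
  qed
  have uA: "u \<bullet> (A *v v) \<noteq> 0" if "v \<in> C" for v
  proof -
    have "proj_pt (A *v v) \<in> affine_chart u"
      using A_dom[OF that] chart closure_subset by blast
    then show ?thesis
      using proj_pt_in_affine_chart[OF Av0[OF C_nonzero[OF that]]] by blast
  qed
  have same_sign: "False" if vw: "v \<in> C" "w \<in> C" "0 < u \<bullet> (A *v v)" "u \<bullet> (A *v w) < 0" for v w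
  proof -
    \<comment> \<open>The weights are chosen so that \<open>u\<close> vanishes on the image of this
      positive combination.\<close>
    let ?z = "(- (u \<bullet> (A *v w))) *\<^sub>R v + (u \<bullet> (A *v v)) *\<^sub>R w"
    have "?z \<in> C"
      using vw by (intro add_C scale_C) auto
    moreover have "u \<bullet> (A *v ?z) = 0"
      by (simp add: matrix_vector_right_distrib matrix_vector_mult_diff_distrib matrix_vector_mult_scaleR inner_add_right inner_diff_right)
    ultimately show False using uA by blast
  qed
  have "\<exists>s. (s = 1 \<or> s = -1) \<and> (\<forall>v\<in>C. 0 < s * (u \<bullet> (A *v v)))"
  proof (cases "\<exists>v\<in>C. 0 < u \<bullet> (A *v v)")
    case True
    then show ?thesis
      using same_sign uA by (intro exI[of _ 1]) (auto, metis linorder_neqE_linordered_idom)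
  next
    case False
    then show ?thesis
      using uA by (intro exI[of _ "-1"]) (auto, metis linorder_neqE_linordered_idom)
  qed
  then obtain s :: real where s: "s = 1 \<or> s = -1" "\<And>v. v \<in> C \<Longrightarrow> 0 < s * (u \<bullet> (A *v v))"
    by blast
  define B where "B = s *\<^sub>R A"
  have B: "invertible B" "\<gamma> = pgl_of B"
    using s(1) A invertible_scaleR[OF A(1), of s] pgl_of_uminus[OF A(1)] by (auto simp: B_def)
  obtain B' where B': "B ** B' = mat 1" "B' ** B = mat 1"
    using B(1) by (auto simp: invertible_def)
  have BB': "B *v (B' *v x) = x" "B' *v (B *v x) = x" for x
    using B' by (simp_all add: matrix_vector_mul_assoc)
  have Bv: "B *v v = s *\<^sub>R (A *v v)" for v
    by (simp add: B_def scaleR_matrix_vector_assoc)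
  have B_C: "B *v v \<in> C" if "v \<in> C" for v
  proof -
    have "proj_pt (B *v v) = proj_pt (A *v v)"
      unfolding Bv using s(1) Av0[OF C_nonzero[OF that]] by (intro proj_pt_scaleR) auto
    then show ?thesis
      using s(2)[OF that] A_dom[OF that] by (simp add: C_def Bv)
  qed
  have act: "pgl_act \<gamma> (proj_pt v) = proj_pt (B *v v)" if "v \<noteq> 0" for v
    unfolding B(2) by (rule pgl_act_proj_pt[OF B(1) that])
  have B'_C: "B' *v v \<in> C" if v: "v \<in> C" for v
  proof -
    have "proj_pt v \<in> \<Omega>" using v by (simp add: C_def)
    then obtain r where r: "r \<in> \<Omega>" "proj_pt v = pgl_act \<gamma> r"
      using img by blast
    have rcl: "r \<in> closure \<Omega>" using r closure_subset by blast
    then have rC: "\<phi> r \<in> C" using r coord_C_iff by blast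
    then have BC: "B *v \<phi> r \<in> C" by (rule B_C)
    have "proj_pt (B *v \<phi> r) = proj_pt v"
      using act[OF C_nonzero[OF rC]] r(2) coord_closure(2)[OF rcl] by simp
    then obtain c where c: "c \<noteq> 0" "v = c *\<^sub>R (B *v \<phi> r)"
      using proj_pt_eqD C_nonzero BC v by metis
    \<comment> \<open>\<open>v\<close> and \<open>B *v \<phi> r\<close> span the same line and both
      have positive height.\<close>
    have "0 < c"
      using C_pos[OF v] C_pos[OF BC] unfolding c(2) by (simp add: zero_less_mult_iff)
    moreover have "B' *v v = c *\<^sub>R \<phi> r"
      unfolding c(2) by (simp add: matrix_vector_mult_scaleR BB')
    ultimately show ?thesis
      using rC scale_C by simp
  qed
  have "domain_auto \<Omega> u \<gamma> B B'"
    by (intro domain_auto.intro domain_chart_axioms domain_auto_axioms.intro BB' act B_C B'_C)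
  then show ?thesis using B by blast
qed

context domain_auto
begin

lemma B_D: "v \<in> D \<Longrightarrow> B *v v \<in> D" and B'_D: "v \<in> D \<Longrightarrow> B' *v v \<in> D"
proof -
  have "(*v) M ` closure C \<subseteq> closure C" if "\<And>v. v \<in> C \<Longrightarrow> M *v v \<in> C" for M :: "real^'n^'n"
    by (rule image_closure_subset)
       (use that closure_subset in \<open>auto intro!: linear_continuous_on simp: matrix_vector_mul_linear linear_conv_bounded_linear[symmetric]\<close>)
  from this[OF B_C] this[OF B'_C]
  show "v \<in> D \<Longrightarrow> B *v v \<in> D" "v \<in> D \<Longrightarrow> B' *v v \<in> D"
    by (auto simp: D_def)
qed

lemma B_eq_0: "B *v v = 0 \<Longrightarrow> v = 0"
  using B'B[of v] by simp

lemma B_C_iff: "B *v v \<in> C \<longleftrightarrow> v \<in> C"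
  using B_C[of v] B'_C[of "B *v v"] B'B by metis

lemma fixed_point_iff:
  assumes p: "p \<in> closure \<Omega>"
  shows "pgl_act \<gamma> p = p \<longleftrightarrow> (\<exists>k. B *v \<phi> p = k *\<^sub>R \<phi> p)"
proof -
  have nz: "\<phi> p \<noteq> 0" "B *v \<phi> p \<noteq> 0"
    using coord_closure[OF p] B_eq_0 by auto
  have pt: "pgl_act \<gamma> p = proj_pt (B *v \<phi> p)"
    using act[OF nz(1)] coord_closure[OF p] by simp
  show ?thesis
  proof
    assume "pgl_act \<gamma> p = p"
    then have "proj_pt (\<phi> p) = proj_pt (B *v \<phi> p)"
      using pt coord_closure[OF p] by simp
    from proj_pt_eqD[OF this nz] show "\<exists>k. B *v \<phi> p = k *\<^sub>R \<phi> p" by blast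
  next
    assume "\<exists>k. B *v \<phi> p = k *\<^sub>R \<phi> p"
    then obtain k where k: "B *v \<phi> p = k *\<^sub>R \<phi> p" ..
    then have "k \<noteq> 0" using nz by auto
    then show "pgl_act \<gamma> p = p"
      using pt nz(1) coord_closure[OF p] by (simp add: k proj_pt_scaleR)
  qed
qed

lemma eigenvalue_pos:
  assumes "v \<in> D" "v \<noteq> 0" "B *v v = k *\<^sub>R v"
  shows "0 < k"
proof -
  have "0 < u \<bullet> (B *v v)"
    using B_D[OF assms(1)] B_eq_0 assms(2) by (intro D_pos) auto
  then show ?thesis
    using D_pos[OF assms(1,2)] by (simp add: assms(3) zero_less_mult_iff)
qed

text \<open>The lift preserves the plane of the axis and the boundary of the cone, so it permutes
  the two boundary rays. If it fixes them, the endpoints are fixed; if it swaps them, the plane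
  contains an interior eigenvector.\<close>

lemma axis_cases:
  assumes "is_axis \<Omega> \<gamma> l"
  shows "\<exists>x y. x \<in> closure \<Omega> \<and> y \<in> closure \<Omega> \<and> x \<noteq> y \<and> l = open_proj_segment \<Omega> x y \<and>
    x \<notin> \<Omega> \<and> y \<notin> \<Omega> \<and> \<phi> x + \<phi> y \<in> C \<and>
    (pgl_act \<gamma> x = x \<and> pgl_act \<gamma> y = y \<or> (\<exists>p\<in>\<Omega>. pgl_act \<gamma> p = p))"
proof -
  obtain V x y where V: "subspace V" "dim V = 2" "pgl_act \<gamma> ` projectivization V = projectivization V"
      "l = projectivization V \<inter> \<Omega>"
    and x: "x \<in> closure \<Omega>" and y: "y \<in> closure \<Omega>" and xy: "x \<noteq> y" and l: "l = open_proj_segment \<Omega> x y"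
    using assms unfolding is_axis_def by (elim conjE exE bexE) (rule that)
  let ?X = "\<phi> x" and ?Y = "\<phi> y"
  have inV: "proj_pt v \<in> projectivization V \<longleftrightarrow> v \<in> V" if "v \<noteq> 0" for v
    using that V(1) by (intro proj_pt_in_projectivization) (simp_all add: subspace_scale)
  have XY: "?X + ?Y \<in> C"
    using open_proj_segment_subset_iff[OF x y xy] V(4) l by blast
  have neq: "?X \<noteq> ?Y"
    using coord_eq_iff x y xy by blast
  have segV: "open_segment ?X ?Y \<subseteq> V"
  proof
    fix v assume "v \<in> open_segment ?X ?Y"
    then obtain r where r: "r \<in> l" "v = \<phi> r"
      unfolding open_proj_segment_image[OF x y, symmetric] l by blast
    then have "r \<in> closure \<Omega>" "r \<in> projectivization V"
      using V(4) closure_subset by auto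
    then show "v \<in> V"
      using inV[of "\<phi> r"] coord_closure[of r] r(2) by simp
  qed
  have seg_pt: "(1 - t) *\<^sub>R ?X + t *\<^sub>R ?Y \<in> V" if "0 < t" "t < 1" for t
    using segV neq that unfolding in_segment subset_iff by blast
  \<comment> \<open>Only the open segment is known to lie in \<open>V\<close>; its endpoints are
    recovered linearly from the points at one and two thirds.\<close>
  have pts: "(1 - 1/3) *\<^sub>R ?X + (1/3) *\<^sub>R ?Y \<in> V" "(1 - 2/3) *\<^sub>R ?X + (2/3) *\<^sub>R ?Y \<in> V"
    by (intro seg_pt; simp)+
  have comb: "2 *\<^sub>R v - w \<in> V" if "v \<in> V" "w \<in> V" for v w
    using that V(1) by (simp add: subspace_diff subspace_scale)
  note comb[OF pts] comb[OF pts(2,1)]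
  moreover have "2 *\<^sub>R ((1 - 1/3) *\<^sub>R ?X + (1/3) *\<^sub>R ?Y) - ((1 - 2/3) *\<^sub>R ?X + (2/3) *\<^sub>R ?Y) = ?X"
      "2 *\<^sub>R ((1 - 2/3) *\<^sub>R ?X + (2/3) *\<^sub>R ?Y) - ((1 - 1/3) *\<^sub>R ?X + (1/3) *\<^sub>R ?Y) = ?Y"
    by (simp_all add: vec_eq_iff algebra_simps)
  ultimately have XYV: "?X \<in> V" "?Y \<in> V" by simp_all
  \<comment> \<open>The endpoints belong to the projective line but not to its intersection
    \<open>l\<close> with the domain, so they lie outside the domain.\<close>
  have ends: "r \<notin> l" if "r = x \<or> r = y" for r
    using that unfolding l open_proj_segment_def by blast
  have xO: "x \<notin> \<Omega>" and yO: "y \<notin> \<Omega>"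
    using ends inV[of ?X] inV[of ?Y] XYV coord_closure[OF x] coord_closure[OF y] V(4) by auto
  then have X: "?X \<in> D" "?X \<notin> C" and Y: "?Y \<in> D" "?Y \<notin> C"
    using coord_D coord_C_iff x y by auto
  have BV: "B *v v \<in> V" if "v \<in> V" "v \<noteq> 0" for v
  proof -
    have "pgl_act \<gamma> (proj_pt v) \<in> projectivization V"
      using V(3) inV that by blast
    then show ?thesis
      using act[OF that(2)] inV[of "B *v v"] B_eq_0 that(2) by auto
  qed
  have span: "\<exists>s t. v = s *\<^sub>R ?X + t *\<^sub>R ?Y" if "v \<in> V" for v
  proof -
    have "?X \<notin> span {?Y}"
    proof
      assume "?X \<in> span {?Y}"
      then obtain k where k: "?X = k *\<^sub>R ?Y"
        by (auto simp: span_singleton)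
      then have "u \<bullet> ?X = k * (u \<bullet> ?Y)" by (metis inner_scaleR_right)
      then have "k = 1"
        using coord_closure(1)[OF x] coord_closure(1)[OF y] by simp
      then show False
        using k neq by simp
    qed
    then have "independent {?X, ?Y}"
      using coord_closure(3)[OF y] by (intro independent_insertI) (auto simp: independent_empty)
    then have "dim (span {?X, ?Y}) = 2"
      using neq by (simp add: dim_eq_card_independent)
    then have "span {?X, ?Y} = V"
      using XYV V(1,2) by (intro subspace_dim_equal span_minimal) auto
    then have "v \<in> span {?X, ?Y}" using that by simp
    then obtain s t where "v - s *\<^sub>R ?X = t *\<^sub>R ?Y"
      by (auto simp: span_breakdown_eq span_singleton)
    then show ?thesis
      by (intro exI[of _ s] exI[of _ t]) (simp add: algebra_simps)
  qed
  have B_cases: "\<exists>k>0. B *v v = k *\<^sub>R ?X \<or> B *v v = k *\<^sub>R ?Y" if v: "v = ?X \<or> v = ?Y" for v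
  proof -
    have v0: "v \<noteq> 0" and vV: "v \<in> V" and vD: "v \<in> D" and vC: "v \<notin> C"
      using v coord_closure(3) x y XYV X Y by auto
    obtain s t where st: "B *v v = s *\<^sub>R ?X + t *\<^sub>R ?Y"
      using span[OF BV[OF vV v0]] by blast
    have "(0 < s \<and> t = 0) \<or> (s = 0 \<and> 0 < t)"
      using boundary_comb[OF X Y XY, of s t] B_D[OF vD] B_C_iff[of v] vC B_eq_0[of v] v0
      unfolding st by blast
    then show ?thesis
      unfolding st by auto
  qed
  obtain k where k: "0 < k" "B *v ?X = k *\<^sub>R ?X \<or> B *v ?X = k *\<^sub>R ?Y"
    using B_cases by blast
  obtain m where m: "0 < m" "B *v ?Y = m *\<^sub>R ?X \<or> B *v ?Y = m *\<^sub>R ?Y"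
    using B_cases by blast
  \<comment> \<open>Two different rays cannot go to the same one, as \<open>B\<close> is
    injective.\<close>
  have not_same: "\<not> (\<exists>Z. B *v ?X = k *\<^sub>R Z \<and> B *v ?Y = m *\<^sub>R Z)"
  proof
    assume "\<exists>Z. B *v ?X = k *\<^sub>R Z \<and> B *v ?Y = m *\<^sub>R Z"
    then obtain Z where "B *v ?X = k *\<^sub>R Z" "B *v ?Y = m *\<^sub>R Z" by blast
    then have "B *v (m *\<^sub>R ?X - k *\<^sub>R ?Y) = 0"
      by (simp add: matrix_vector_mult_diff_distrib matrix_vector_mult_scaleR)
    then have eq: "m *\<^sub>R ?X = k *\<^sub>R ?Y"
      using B_eq_0 by fastforce
    then have "m * (u \<bullet> ?X) = k * (u \<bullet> ?Y)"
      by (metis inner_scaleR_right)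
    then have "m = k"
      using coord_closure(1)[OF x] coord_closure(1)[OF y] by simp
    then show False
      using eq neq k(1) by simp
  qed
  have "pgl_act \<gamma> x = x \<and> pgl_act \<gamma> y = y \<or> (\<exists>p\<in>\<Omega>. pgl_act \<gamma> p = p)"
  proof (cases "B *v ?X = k *\<^sub>R ?X \<and> B *v ?Y = m *\<^sub>R ?Y")
    case True
    then show ?thesis
      using fixed_point_iff x y by blast
  next
    case False
    then have sw: "B *v ?X = k *\<^sub>R ?Y" "B *v ?Y = m *\<^sub>R ?X"
      using k(2) m(2) not_same by blast+
    \<comment> \<open>These weights balance the swap: \<open>B\<close> sends \<open>P\<close> to
      \<open>sqrt (k m)\<close> times itself.\<close>
    define P where "P = sqrt m *\<^sub>R ?X + sqrt k *\<^sub>R ?Y"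
    have PC: "P \<in> C"
      unfolding P_def using k m XY by (intro pos_comb_C X Y) auto
    have "B *v P = (sqrt m * k) *\<^sub>R ?Y + (sqrt k * m) *\<^sub>R ?X"
      by (simp add: P_def matrix_vector_right_distrib matrix_vector_mult_scaleR sw)
    also have "\<dots> = (sqrt k * sqrt m) *\<^sub>R P"
      using k(1) m(1) by (simp add: P_def algebra_simps real_sqrt_mult_self)
    finally have BP: "B *v P = (sqrt k * sqrt m) *\<^sub>R P" .
    have P0: "P \<noteq> 0" using C_nonzero[OF PC] .
    have "proj_pt P \<in> \<Omega>" using PC by (simp add: C_def)
    moreover have "pgl_act \<gamma> (proj_pt P) = proj_pt P"
      unfolding act[OF P0] BP using k(1) m(1) P0 by (intro proj_pt_scaleR) auto
    ultimately show ?thesis by blast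
  qed
  then show ?thesis
    using x y xy l xO yO XY by blast
qed

end
section \<open>Rank one isometries\<close>

text \<open>The simple eigenvalue criterion is used twice: with \<open>g\<close> for the eigenvalue
  1, and with \<open>f\<close> for \<open>q\<close>, where the bound on the other eigenvalues comes
  from the reversed contraction.\<close>

lemma biproximal_cone_auto:
  fixes M N :: "real^'n::finite^'n"
  assumes "cone_auto_functionals D (\<lambda>x. M *v x) (\<lambda>x. N *v x) a b q f g"
  shows "biproximal_mat M"
proof -
  interpret cone_auto_functionals D "\<lambda>x. M *v x" "\<lambda>x. N *v x" a b q f g
    by (rule assms)
  \<comment> \<open>The auxiliary \<open>s = 0\<close> is any number of modulus below 1, to which
    the eigenvalue 1 is moved.\<close>
  have "\<exists>R. proots (charpoly (complex_mat M)) = add_mset 1 R \<and> (\<forall>\<nu>. \<nu> \<in># R \<longrightarrow> cmod \<nu> < 1)"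
  proof (rule proots_charpoly_simple[where s = 0])
    show "complex_mat M *v complex_vec a = 1 *s complex_vec a"
      by (simp add: complex_mat_vec T_a)
    show "(\<Sum>i\<in>UNIV. complex_vec g $ i * complex_vec a $ i) = 1"
      by (simp add: complex_vec_pairing g_a)
    show "(\<Sum>i\<in>UNIV. complex_vec g $ i * (complex_mat M *v w) $ i) = 1 * (\<Sum>i\<in>UNIV. complex_vec g $ i * w $ i)" for w
      using complex_mat_pairing[of g M 1 w] g_T by simp
    show "cmod \<nu> < 1" if "v \<noteq> 0" "complex_mat M *v v = \<nu> *s v" "(\<Sum>i\<in>UNIV. complex_vec g $ i * v $ i) = 0" for \<nu> v
      by (rule eigenvalue_in_kernel_lt_1[OF T_pow_tendsto that])
  qed simp_all
  then obtain R where R: "eigenvalues M = add_mset 1 R" "\<And>\<nu>. \<nu> \<in># R \<Longrightarrow> cmod \<nu> < 1"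
    unfolding eigenvalues_def by blast
  \<comment> \<open>Here \<open>s = 1\<close> serves, since its modulus exceeds \<open>q\<close>. An
    eigenvalue \<nu> of \<open>M\<close> on the kernel of \<open>f\<close> becomes
    \<open>q / \<nu>\<close> for \<open>q N\<close>, which contracts that kernel.\<close>
  have "\<exists>Q. proots (charpoly (complex_mat M)) = add_mset (of_real q) Q \<and> (\<forall>\<nu>. \<nu> \<in># Q \<longrightarrow> q < cmod \<nu>)"
  proof (rule proots_charpoly_simple[where s = 1])
    show "complex_mat M *v complex_vec b = of_real q *s complex_vec b"
      by (simp add: complex_mat_vec T_b complex_vec_scaleR)
    show "(\<Sum>i\<in>UNIV. complex_vec f $ i * complex_vec b $ i) = 1"
      by (simp add: complex_vec_pairing f_b)
    show "(\<Sum>i\<in>UNIV. complex_vec f $ i * (complex_mat M *v w) $ i) = of_real q * (\<Sum>i\<in>UNIV. complex_vec f $ i * w $ i)" for w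
      by (rule complex_mat_pairing) (rule f_T)
    show "q < cmod \<nu>" if v: "v \<noteq> 0" "complex_mat M *v v = \<nu> *s v" "(\<Sum>i\<in>UNIV. complex_vec f $ i * v $ i) = 0" for \<nu> v
    proof -
      have "N *v (M *v x) = x" for x by (rule ST)
      then have "N ** M = mat 1"
        by (simp add: matrix_eq matrix_vector_mul_assoc)
      then have "complex_mat N ** complex_mat M = mat 1"
        unfolding complex_mat_mult by (simp add: complex_mat_def mat_def vec_eq_iff)
      then have "complex_mat N *v (\<nu> *s v) = v"
        unfolding v(2)[symmetric] by (simp add: matrix_vector_mul_assoc)
      then have Nv: "\<nu> *s (complex_mat N *v v) = v"
        by (simp add: vec.scale)
      then have nu: "\<nu> \<noteq> 0"
        using v(1) by auto
      have "complex_mat N *v v = inverse \<nu> *s (\<nu> *s (complex_mat N *v v))"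
        using nu by (simp add: vector_smult_assoc)
      then have N_eig: "complex_mat N *v v = inverse \<nu> *s v"
        unfolding Nv .
      have qN: "(\<lambda>x. (q *\<^sub>R N) *v x) = (\<lambda>x. q *\<^sub>R (N *v x))"
        by (simp add: scaleR_matrix_vector_assoc)
      have "complex_mat (q *\<^sub>R N) *v v = of_real q *s (complex_mat N *v v)"
        by (simp add: complex_mat_def matrix_vector_mult_def vec_eq_iff sum_distrib_left mult.assoc)
      then have "complex_mat (q *\<^sub>R N) *v v = (of_real q * inverse \<nu>) *s v"
        unfolding N_eig by (simp add: vector_smult_assoc)
      moreover have "(\<lambda>n. ((\<lambda>x. (q *\<^sub>R N) *v x) ^^ n) x) \<longlonglongrightarrow> (f \<bullet> x) *\<^sub>R b" for x
        unfolding qN swap_pow by (rule S_pow_tendsto)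
      ultimately have "cmod (of_real q * inverse \<nu>) < 1"
        using v(1,3) by (intro eigenvalue_in_kernel_lt_1)
      then have "q / cmod \<nu> < 1"
        using q by (simp add: norm_mult norm_inverse divide_inverse)
      then show ?thesis
        using nu by simp
    qed
  qed (use q in auto)
  then obtain Q where Q: "eigenvalues M = add_mset (of_real q) Q" "\<And>\<nu>. \<nu> \<in># Q \<Longrightarrow> q < cmod \<nu>"
    unfolding eigenvalues_def by blast
  \<comment> \<open>The two eigenvalues 1 and \<open>q\<close> differ, so the dimension is at least
    2.\<close>
  have "of_real q \<in># add_mset 1 R"
    using Q(1) R(1) by (metis union_single_eq_member)
  then have "of_real q \<in># R"
    using q by auto
  then have "size R \<noteq> 0" by auto
  moreover have "Suc (size R) = CARD('n)"
    using size_eigenvalues[of M] by (simp add: R(1))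
  ultimately have "2 \<le> CARD('n)" by linarith
  from biproximal_matI[OF this R(1) _ Q(1)] show ?thesis
    using R(2) Q(2) q by simp
qed

theorem proposition6p5:
  fixes \<Omega> :: "'n::finite proj_space set" and \<gamma> :: "'n pgl" and a b :: "'n proj_space"
  assumes "properly_convex_domain \<Omega>"
    and "\<gamma> \<in> Aut \<Omega>"
    and "rank_one_isometry \<Omega> \<gamma>"
    and "a \<in> closure \<Omega>" and "b \<in> closure \<Omega>"
    and "is_axis \<Omega> \<gamma> (open_proj_segment \<Omega> a b)"
    and "a \<in> E_plus \<gamma>" and "b \<in> E_minus \<gamma>"
  shows "biproximal \<gamma> \<and>
    (\<forall>l. is_axis \<Omega> \<gamma> l \<longleftrightarrow> l = open_proj_segment \<Omega> a b) \<and>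
    {p \<in> closure \<Omega>. pgl_act \<gamma> p = p} = {a, b} \<and>
    (\<forall>z'\<in>frontier \<Omega> - {a, b}.
       open_proj_segment \<Omega> a z' \<union> open_proj_segment \<Omega> b z' \<subseteq> \<Omega>) \<and>
    (\<forall>z\<in>frontier \<Omega> - {a, b}.
       \<not> in_half_triangle \<Omega> (open_proj_segment \<Omega> a z) \<and>
       \<not> in_half_triangle \<Omega> (open_proj_segment \<Omega> b z))"
proof -
  \<comment> \<open>This is the same choice as in the definition of \<open>coord\<close>, so that
    \<open>domain_chart\<close> applies.\<close>
  define u where "u = (SOME u. adapted_chart \<Omega> u)"
  have "\<exists>u. adapted_chart \<Omega> u"
    using assms(1) by (simp add: properly_convex_domain_def)
  then have "adapted_chart \<Omega> u"
    unfolding u_def by (rule someI_ex)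
  then interpret domain_chart \<Omega> u
    using assms(1) by unfold_locales (auto simp: properly_convex_domain_def adapted_chart_def coord_def u_def)
  obtain B B' where B: "\<gamma> = pgl_of B" "invertible B" "domain_auto \<Omega> u \<gamma> B B'"
    using ex_cone_lift[OF assms(2)] by blast
  interpret domain_auto \<Omega> u \<gamma> B B'
    by (rule B(3))
  have no_fixed: "pgl_act \<gamma> p \<noteq> p" if "p \<in> \<Omega>" for p
    using translation_length_fixed_point[OF assms(2) that] assms(3)
    unfolding rank_one_isometry_def by auto
  have cl: "a \<in> closure \<Omega>" "b \<in> closure \<Omega>"
    by (rule assms)+
  \<comment> \<open>Positive translation length rules out the swapping case.\<close>
  have axis: "\<exists>x y. x \<in> closure \<Omega> \<and> y \<in> closure \<Omega> \<and> x \<noteq> y \<and> l = open_proj_segment \<Omega> x y \<and>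
      x \<notin> \<Omega> \<and> y \<notin> \<Omega> \<and> \<phi> x + \<phi> y \<in> C \<and> pgl_act \<gamma> x = x \<and> pgl_act \<gamma> y = y"
    if "is_axis \<Omega> \<gamma> l" for l
    using axis_cases[OF that] no_fixed by metis
  obtain x y where xy: "x \<in> closure \<Omega>" "y \<in> closure \<Omega>" "x \<noteq> y"
      "open_proj_segment \<Omega> a b = open_proj_segment \<Omega> x y"
      "x \<notin> \<Omega>" "y \<notin> \<Omega>" "\<phi> x + \<phi> y \<in> C" "pgl_act \<gamma> x = x" "pgl_act \<gamma> y = y"
    using axis[OF assms(6)] by blast
  have "x = a \<and> y = b \<or> x = b \<and> y = a"
    by (rule open_proj_segment_ends[OF xy(1,2) cl xy(3) xy(4)[symmetric]])
  with xy have ab: "a \<noteq> b" "a \<notin> \<Omega>" "b \<notin> \<Omega>" "\<phi> a + \<phi> b \<in> C" "pgl_act \<gamma> a = a" "pgl_act \<gamma> b = b"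
    by (auto simp: add.commute)
  have fr: "a \<in> frontier \<Omega>" "b \<in> frontier \<Omega>"
    using ab cl by (simp_all add: frontier_open[OF open_dom])
  obtain \<mu> \<nu> where mu: "B *v \<phi> a = \<mu> *\<^sub>R \<phi> a" and nu: "B *v \<phi> b = \<nu> *\<^sub>R \<phi> b"
    using fixed_point_iff cl ab(5,6) by metis
  have nz: "\<phi> a \<noteq> 0" "\<phi> b \<noteq> 0"
    using coord_closure(3) cl by auto
  have pos: "0 < \<mu>" "0 < \<nu>"
    using eigenvalue_pos[OF coord_D nz(1) mu] eigenvalue_pos[OF coord_D nz(2) nu] cl by auto
  have "\<phi> a \<in> top_eigenvectors B"
  proof -
    have "E_plus \<gamma> = projectivization (top_eigenvectors B)"
      unfolding B(1) using B(2) by (intro E_plus.abs_eq) (auto simp: pgl_rel_def intro: exI[of _ 1])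
    then have "proj_pt (\<phi> a) \<in> projectivization (top_eigenvectors B)"
      using assms(7) coord_closure(2)[OF cl(1)] by simp
    then show ?thesis
      using proj_pt_in_projectivization[OF top_eigenvectors_scale nz(1)] by blast
  qed
  \<comment> \<open>\<mu> has maximal modulus and \<nu> is another eigenvalue of the lift; both are
    positive.\<close>
  from top_eigenvector_eigenvalue[OF mu nz(1) this] have "\<nu> \<le> \<mu>"
    using eigenvalue_real[OF nu nz(2)] pos by (auto simp: top_eigenvalues_def)
  \<comment> \<open>With equal eigenvalues the axis would be fixed pointwise, in particular at a
    point of the domain.\<close>
  moreover have "\<nu> \<noteq> \<mu>"
  proof
    assume "\<nu> = \<mu>"
    then have "B *v (\<phi> a + \<phi> b) = \<mu> *\<^sub>R (\<phi> a + \<phi> b)"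
      by (simp add: matrix_vector_right_distrib mu nu scaleR_add_right)
    then have "pgl_act \<gamma> (proj_pt (\<phi> a + \<phi> b)) = proj_pt (\<phi> a + \<phi> b)"
      using act[OF C_nonzero[OF ab(4)]] pos C_nonzero[OF ab(4)] by (simp add: proj_pt_scaleR)
    moreover have "proj_pt (\<phi> a + \<phi> b) \<in> \<Omega>"
      using ab(4) by (simp add: C_def)
    ultimately show False using no_fixed by blast
  qed
  ultimately have less: "\<nu> < \<mu>" by simp
  define M where "M = (1 / \<mu>) *\<^sub>R B"
  define N where "N = \<mu> *\<^sub>R B'"
  have Mv: "M *v v = (1 / \<mu>) *\<^sub>R (B *v v)" and Nv: "N *v v = \<mu> *\<^sub>R (B' *v v)" for v
    by (simp_all add: M_def N_def scaleR_matrix_vector_assoc)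
  \<comment> \<open>A vector \<open>w\<close> violating this is a boundary vector, since otherwise
    the sums would be interior; its point would be the third vertex of a half triangle containing
    the axis.\<close>
  have no_tri: "\<phi> a + w \<in> C \<or> \<phi> b + w \<in> C" if w: "w \<in> D" "w \<noteq> 0" for w
  proof (rule ccontr)
    assume not: "\<not> (\<phi> a + w \<in> C \<or> \<phi> b + w \<in> C)"
    let ?p = "proj_pt w"
    have "w \<notin> C"
      using not add_CD[of w "\<phi> a"] coord_D[OF cl(1)] by (auto simp: add.commute)
    then have pfr: "?p \<in> frontier \<Omega>"
      using proj_pt_closure[OF w] proj_pt_dom_iff[OF w] by (simp add: frontier_open[OF open_dom])
    have "\<phi> c + \<phi> ?p \<notin> C" if c: "c \<in> closure \<Omega>" "\<phi> c + w \<notin> C" for c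
    proof
      assume "\<phi> c + \<phi> ?p \<in> C"
      then have "1 *\<^sub>R \<phi> c + (1 / (u \<bullet> w)) *\<^sub>R w \<in> C"
        using coord_proj_pt[OF w] by simp
      from pos_comb_C_conv[OF coord_D[OF c(1)] w(1) this] c(2) D_pos[OF w] show False
        by simp
    qed
    then have "in_half_triangle \<Omega> (open_proj_segment \<Omega> a b)"
      using not cl by (intro half_triangleI[OF fr pfr ab(1,4)]) auto
    then show False
      using assms(3,6) by (simp add: rank_one_isometry_def)
  qed
  have "cone_auto D (\<lambda>x. M *v x) (\<lambda>x. N *v x) (\<phi> a) (\<phi> b) (\<nu> / \<mu>)"
  proof (rule cone_auto.intro)
    show "M *v (N *v x) = x" "N *v (M *v x) = x" for x
      using pos by (simp_all add: Mv Nv matrix_vector_mult_scaleR BB' B'B)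
    show "M *v x \<in> D" "N *v x \<in> D" if "x \<in> D" for x
      using pos that by (simp_all add: Mv Nv scale_D B_D B'_D)
    show "M *v \<phi> a = \<phi> a" "M *v \<phi> b = (\<nu> / \<mu>) *\<^sub>R \<phi> b"
      using pos by (simp_all add: Mv mu nu)
    show "\<phi> a \<notin> interior D" "\<phi> b \<notin> interior D"
      using ab cl coord_C_iff by (simp_all add: interior_D)
    show "\<phi> a + w \<in> interior D \<or> \<phi> b + w \<in> interior D" if "w \<in> D" "w \<noteq> 0" for w
      using no_tri[OF that] by (simp add: interior_D)
  qed (use pos less cl ab in \<open>auto simp: closed_D add_D scale_D coord_D interior_D matrix_vector_mul_linear\<close>)
  then obtain f g where fg: "cone_auto_functionals D (\<lambda>x. M *v x) (\<lambda>x. N *v x) (\<phi> a) (\<phi> b) (\<nu> / \<mu>) f g"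
    using cone_auto.ex_functionals by blast
  interpret K: cone_auto_functionals D "\<lambda>x. M *v x" "\<lambda>x. N *v x" "\<phi> a" "\<phi> b" "\<nu> / \<mu>" f g
    by (rule fg)
  have coord_mult: "p = c" if "p \<in> closure \<Omega>" "c \<in> closure \<Omega>" "\<phi> p = k *\<^sub>R \<phi> c" for p c k
  proof -
    have "u \<bullet> \<phi> p = k * (u \<bullet> \<phi> c)"
      using that(3) by (metis inner_scaleR_right)
    then have "k = 1"
      using coord_closure(1)[OF that(1)] coord_closure(1)[OF that(2)] by simp
    then show ?thesis
      using that coord_eq_iff by simp
  qed
  have biprox: "biproximal \<gamma>"
  proof -
    have "biproximal_mat M"
      by (rule biproximal_cone_auto[OF fg])
    then have "biproximal_mat B"
      unfolding M_def using pos by (simp add: biproximal_mat_scaleR)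
    moreover have "biproximal (pgl_of B) = biproximal_mat B"
      using B(2) by (intro biproximal.abs_eq) (auto simp: pgl_rel_def intro: exI[of _ 1])
    ultimately show ?thesis
      by (simp add: B(1))
  qed
  have fixed: "p = a \<or> p = b" if p: "p \<in> closure \<Omega>" "pgl_act \<gamma> p = p" for p
  proof -
    obtain k where "B *v \<phi> p = k *\<^sub>R \<phi> p"
      using fixed_point_iff p by blast
    then have "M *v \<phi> p = (k / \<mu>) *\<^sub>R \<phi> p"
      by (simp add: Mv)
    from K.eigenvector_cases[OF coord_D[OF p(1)] this] show ?thesis
      using coord_mult p(1) cl by blast
  qed
  then have fixed_set: "{p \<in> closure \<Omega>. pgl_act \<gamma> p = p} = {a, b}"
    using cl ab by blast
  have axis_iff: "is_axis \<Omega> \<gamma> l \<longleftrightarrow> l = open_proj_segment \<Omega> a b" for l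
  proof
    assume "is_axis \<Omega> \<gamma> l"
    from axis[OF this] obtain x y where xy: "x \<in> closure \<Omega>" "y \<in> closure \<Omega>" "x \<noteq> y"
      "l = open_proj_segment \<Omega> x y" "pgl_act \<gamma> x = x" "pgl_act \<gamma> y = y"
      by blast
    then have "x = a \<and> y = b \<or> x = b \<and> y = a"
      using fixed by blast
    then show "l = open_proj_segment \<Omega> a b"
      using xy(4) open_proj_segment_commute by blast
  qed (use assms(6) in simp)
  \<comment> \<open>If \<open>f\<close> vanished at \<open>z\<close>, then \<open>ker_f\<close>
    would put \<open>z\<close> on the ray of \<open>a\<close>. Otherwise the sum is interior by
    \<open>a_add_int\<close>.\<close>
  have visible: "\<phi> a + \<phi> z \<in> C" if "z \<in> frontier \<Omega>" "z \<noteq> a" for z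
  proof -
    have z: "z \<in> closure \<Omega>" using that by (simp add: frontier_def)
    then have "f \<bullet> \<phi> z \<noteq> 0"
      using K.ker_f[OF coord_D[OF z]] coord_mult[OF z cl(1)] that by blast
    then show ?thesis
      using K.a_add_int[OF coord_D[OF z]] by (simp add: interior_D)
  qed
  have visible': "\<phi> b + \<phi> z \<in> C" if "z \<in> frontier \<Omega>" "z \<noteq> b" for z
  proof -
    have z: "z \<in> closure \<Omega>" using that by (simp add: frontier_def)
    then have "g \<bullet> \<phi> z \<noteq> 0"
      using K.ker_g[OF coord_D[OF z]] coord_mult[OF z cl(2)] that by blast
    then show ?thesis
      using K.b_add_int[OF coord_D[OF z]] by (simp add: interior_D)
  qed
  have segments: "open_proj_segment \<Omega> c z \<subseteq> \<Omega>" if "c \<in> {a, b}" "z \<in> frontier \<Omega> - {a, b}" for c z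
    using that visible[of z] visible'[of z] open_proj_segment_subset_iff[of c z] cl
    by (auto simp: frontier_def)
  have no_half_triangles: "\<not> in_half_triangle \<Omega> (open_proj_segment \<Omega> c z)" if c: "c \<in> {a, b}" and z: "z \<in> frontier \<Omega> - {a, b}" for c z
  proof
    assume tri: "in_half_triangle \<Omega> (open_proj_segment \<Omega> c z)"
    have "c \<in> closure \<Omega>" "z \<in> closure \<Omega>" "c \<noteq> z"
      using c z cl by (auto simp: frontier_def)
    from half_triangleE[OF this tri] obtain w where w: "w \<in> frontier \<Omega>" "\<phi> c + \<phi> w \<notin> C" "\<phi> z + \<phi> w \<notin> C" "\<phi> c + \<phi> z \<in> C"
      by blast
    \<comment> \<open>The end \<open>c\<close> sees every other boundary point through the domain,
      so the third vertex must be \<open>c\<close> itself; but then the side from \<open>z\<close>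
      to it is the segment that crosses the domain.\<close>
    then have "w = c"
      using c visible[of w] visible'[of w] by blast
    then show False
      using w(3,4) by (simp add: add.commute)
  qed
  show ?thesis
    by (intro conjI allI ballI Un_least biprox fixed_set axis_iff segments no_half_triangles) simp_all
qed

end
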